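(* Let $d,T\ge1$, let $\mu=\mathcal N(a,A)$ and $\nu=\mathcal N(b,B)$ be non-degenerate Gaussian measures on $\mathbb R^{dT}$ whose covariance matrices have Cholesky decompositions $A=LL^\top$ and $B=MM^\top$, and let $\lambda\ge0$. For $t=1,\dots,T$ let $U_tS_tV_t^\top$ be the singular value decomposition of the $d\times d$ block $(M^\top L)_{t,t}$ (with $U_t,V_t$ orthogonal and $S_t$ the diagonal matrix of singular values), let $S=\operatorname{diag}(S_1,\dots,S_T)$, and let $D_\lambda=f_\lambda(S)$ (element-wise), with diagonal blocks $(D_\lambda)_t=f_\lambda(S_t)$. For any block diagonal contraction matrix $P=\operatorname{diag}(P_1,\dots,P_T)\in\mathbb R^{dT\times dT}$, $P_t\in\mathbb R^{d\times d}$, define $$\pi_P:=\mathcal N\left(\begin{bmatrix}a\\ b\end{bmatrix},\begin{bmatrix}LL^\top & LPM^\top\\ MP^\top L^\top & MM^\top\end{bmatrix}\right).$$ Then: (i) If $\lambda>0$, let $P_t=V_t(D_\lambda)_tU_t^\top$, $t=1,\dots,T$. Then $\pi^*=\pi_P$ is the unique optimizer of $\mathcal{AW}_{2,\lambda}(\mu,\nu)$. (ii) If $\lambda=0$, let $P_t=V_tD_tU_t^\top$, where $D_t\in\mathbb R^{d\times d}$ is a contraction with $(D_t)_{ii}=1$ whenever $(S_t)_{ii}\ne0$, $i=1,\dots,d$, $t=1,\dots,T$. Then $\pi^*=\pi_P$ is an optimizer of $\mathcal{AW}_2(\mu,\nu)$, and all Gaussian optimizers have such a representation. Moreover, $\pi^*$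 is the unique optimizer if and only if $S$ is invertible.
   Context: $\mathbb R^{dT}$ is the space of $d$-dimensional paths $x=(x_1,\dots,x_T)$, $x_t\in\mathbb R^d$, with Euclidean norm $|\cdot|$. Write $x_{1:t}=(x_1,\dots,x_t)\in\mathbb R^{dt}$. For a matrix $K\in\mathbb R^{dT\times dT}$, $K_{s,t}\in\mathbb R^{d\times d}$ denotes its $(s,t)$ block, $s,t\in\{1,\dots,T\}$. A matrix is a contraction if its spectral norm satisfies $\|\cdot\|_2\le1$. For a probability measure $\mu$ on $\mathbb R^{dT}$, $\mu_{x_{1:t}}$ denotes the regular conditional law under $\mu$ of $x_{t+1:T}$ given $x_{1:t}$; for a probability $\pi$ on $\mathbb R^{dT}\times\mathbb R^{dT}$, $\pi_{x_{1:t},y_{1:t}}$ denotes the regular conditional law of $(x_{t+1:T},y_{t+1:T})$ given $(x_{1:t},y_{1:t})$ (kernels being understood up to a.e. equality). $\mathrm{Cpl}(\mu,\nu)$ is the set of probability measures with first marginal $\mu$ and second marginal $\nu$. A coupling $\pi\in\mathrm{Cpl}(\mu,\nu)$ is bi-causal, written $\pi\in\mathrm{Cpl}_{\mathrm{bc}}(\mu,\nu)$, if for all $t=1,\dots,T-1$ and all $x_{1:t},y_{1:t}\in\mathbb R^{dt}$ one has $\pi_{x_{1:t},y_{1:t}}\in\mathrm{Cpl}(\mu_{x_{1:t}},\nu_{y_{1:t}})$. The entropic adapted 2-Wasserstein distance is $$\mathcal{AW}_{2,\lambda}^2(\mu,\nu)=\inf_{\pi\in\mathrm{Cpl}_{\mathrm{bc}}(\mu,\nu)}\int|x-y|^2\,d\pi+\lambda\,\mathcal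 D_{\mathrm{KL}}(\pi\,|\,\mu\otimes\nu),$$ where $\mathcal D_{\mathrm{KL}}(\mu|\nu)=\int\log(d\mu/d\nu)\,d\mu$ if $\mu\ll\nu$ and $+\infty$ otherwise. For $\lambda=0$ the entropic term is absent and one writes $\mathcal{AW}_2=\mathcal{AW}_{2,0}$. An optimizer is a bi-causal coupling attaining the infimum. Gaussian measures such as $\pi_P$ may have singular covariance. In the Cholesky decompositions, $L,M\in\mathbb R^{dT\times dT}$ are lower triangular with positive diagonal entries. For $\lambda\ge0$, $f_\lambda:\mathbb R\to\mathbb R$ is $$f_\lambda(x)=\operatorname{sign}(x)\Big(\sqrt{\big(\tfrac{\lambda}{4|x|}\big)^2+1}-\tfrac{\lambda}{4|x|}\Big)\ \text{ if }x\ne0,\qquad f_\lambda(0)=0,$$ with the convention $\operatorname{sign}(0)=0$. *)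

theory Defs
  imports "HOL-Probability.Probability"
begin

text \<open>
  A finite linearly ordered index type \<open>'t\<close> plays the role of \<open>{1,\<dots>,T}\<close> and \<open>'d\<close> that of
  \<open>{1,\<dots>,d}\<close>.  The path space of dimension \<open>dT\<close> is \<open>real^('t \<times> 'd)\<close>, whose coordinate \<open>(t,i)\<close>
  is the \<open>i\<close>-th component of \<open>x\<^sub>t\<close>; its norm is the Euclidean one.
\<close>

subsection \<open>Matrices\<close>

definition block :: "real^('t::finite \<times> 'd::finite)^('t \<times> 'd) \<Rightarrow> 't \<Rightarrow> 't \<Rightarrow> real^'d^'d" where
  "block K s t = (\<chi> i j. K $ (s, i) $ (t, j))"

definition block_diag :: "('t::finite \<Rightarrow> real^'d::finite^'d) \<Rightarrow> real^('t \<times> 'd)^('t \<times> 'd)" where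
  "block_diag K = (\<chi> p q. if fst p = fst q then K (fst p) $ snd p $ snd q else 0)"

definition block_2x2 ::
  "real^'n::finite^'n \<Rightarrow> real^'n^'n \<Rightarrow> real^'n^'n \<Rightarrow> real^'n^'n \<Rightarrow> real^('n + 'n)^('n + 'n)" where
  "block_2x2 A B C D = (\<chi> k l.
     case k of
       Inl i \<Rightarrow> (case l of Inl j \<Rightarrow> A $ i $ j | Inr j \<Rightarrow> B $ i $ j)
     | Inr i \<Rightarrow> (case l of Inl j \<Rightarrow> C $ i $ j | Inr j \<Rightarrow> D $ i $ j))"

definition contraction :: "real^'n::finite^'n \<Rightarrow> bool" where
  "contraction K \<longleftrightarrow> onorm ((*v) K) \<le> 1"

definition pos_semidef :: "real^'n::finite^'n \<Rightarrow> bool" where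
  "pos_semidef A \<longleftrightarrow> transpose A = A \<and> (\<forall>x. 0 \<le> x \<bullet> (A *v x))"

definition pos_def :: "real^'n::finite^'n \<Rightarrow> bool" where
  "pos_def A \<longleftrightarrow> transpose A = A \<and> (\<forall>x. x \<noteq> 0 \<longrightarrow> 0 < x \<bullet> (A *v x))"

text \<open>
  Triangularity refers to the lexicographic order on the coordinates \<open>(t,i)\<close>, time first.  It is
  spelled out because \<open>(<)\<close> on pairs is the componentwise order in the Analysis library.
\<close>

definition lower_triangular ::
  "real^('t::{finite,linorder} \<times> 'd::{finite,linorder})^('t \<times> 'd) \<Rightarrow> bool" where
  "lower_triangular L \<longleftrightarrow> (\<forall>s i t j. s < t \<or> (s = t \<and> i < j) \<longrightarrow> L $ (s, i) $ (t, j) = 0)"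

definition cholesky ::
  "real^('t::{finite,linorder} \<times> 'd::{finite,linorder})^('t \<times> 'd) \<Rightarrow> real^('t \<times> 'd)^('t \<times> 'd) \<Rightarrow> bool" where
  "cholesky A L \<longleftrightarrow> A = L ** transpose L \<and> lower_triangular L \<and> (\<forall>p. 0 < L $ p $ p)"

text \<open>The singular values on the diagonal of \<open>S\<close> may come in any order.\<close>

definition is_svd ::
  "real^'d::finite^'d \<Rightarrow> real^'d^'d \<Rightarrow> real^'d^'d \<Rightarrow> real^'d^'d \<Rightarrow> bool" where
  "is_svd K U S V \<longleftrightarrow>
     orthogonal_matrix U \<and> orthogonal_matrix V \<and>
     (\<forall>i j. i \<noteq> j \<longrightarrow> S $ i $ j = 0) \<and> (\<forall>i. 0 \<le> S $ i $ i) \<and>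
     K = U ** S ** transpose V"

definition f_lam :: "real \<Rightarrow> real \<Rightarrow> real" where
  "f_lam lam x =
     (if x = 0 then 0 else sgn x * (sqrt ((lam / (4 * \<bar>x\<bar>))\<^sup>2 + 1) - lam / (4 * \<bar>x\<bar>)))"

subsection \<open>Gaussian measures\<close>

definition std_gaussian :: "(real^'n::finite) measure" where
  "std_gaussian = density lborel (\<lambda>x. ennreal (\<Prod>i\<in>UNIV. std_normal_density (x $ i)))"

text \<open>
  \<open>gaussian m \<Sigma>\<close> is the law of \<open>m + C Z\<close> with \<open>Z\<close> standard normal and \<open>C C\<^sup>T = \<Sigma>\<close>.  Such a \<open>C\<close>
  exists exactly when \<open>\<Sigma>\<close> is symmetric positive semidefinite (possibly singular), and the law does
  not depend on which \<open>C\<close> is chosen.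
\<close>

definition gaussian :: "real^'n::finite \<Rightarrow> real^'n^'n \<Rightarrow> (real^'n) measure" where
  "gaussian m \<Sigma> =
     distr std_gaussian borel (\<lambda>z. m + (SOME C :: real^'n^'n. C ** transpose C = \<Sigma>) *v z)"

text \<open>
  Gaussian measures on a product of two copies of \<open>real^'n\<close>, with the covariance matrix indexed by
  \<open>'n + 'n\<close>.
\<close>

definition gaussian_pair ::
  "real^'n::finite \<Rightarrow> real^'n \<Rightarrow> real^('n + 'n)^('n + 'n) \<Rightarrow> ((real^'n) \<times> (real^'n)) measure" where
  "gaussian_pair a b \<Sigma> =
     distr (gaussian (\<chi> k. case k of Inl i \<Rightarrow> a $ i | Inr i \<Rightarrow> b $ i) \<Sigma>) borel
       (\<lambda>z. (\<chi> i. z $ Inl i, \<chi> i. z $ Inr i))"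

definition is_gaussian_pair :: "((real^'n::finite) \<times> (real^'n)) measure \<Rightarrow> bool" where
  "is_gaussian_pair \<pi> \<longleftrightarrow> (\<exists>a b \<Sigma>. pos_semidef \<Sigma> \<and> \<pi> = gaussian_pair a b \<Sigma>)"

definition pi_P ::
  "real^'n::finite \<Rightarrow> real^'n \<Rightarrow> real^'n^'n \<Rightarrow> real^'n^'n \<Rightarrow> real^'n^'n \<Rightarrow>
    ((real^'n) \<times> (real^'n)) measure" where
  "pi_P a b L M P = gaussian_pair a b
     (block_2x2 (L ** transpose L) (L ** P ** transpose M)
                (M ** transpose P ** transpose L) (M ** transpose M))"

subsection \<open>Couplings, conditional laws and bi-causality\<close>

definition Cpl :: "'a measure \<Rightarrow> 'b measure \<Rightarrow> ('a \<times> 'b) measure set" where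
  "Cpl \<mu> \<nu> = {\<pi>. prob_space \<pi> \<and> sets \<pi> = sets (\<mu> \<Otimes>\<^sub>M \<nu>) \<and>
                 distr \<pi> \<mu> fst = \<mu> \<and> distr \<pi> \<nu> snd = \<nu>}"

text \<open>\<open>\<kappa>\<close> is a version of the regular conditional law of \<open>Y\<close> given \<open>X\<close> under \<open>\<mu>\<close>.\<close>

definition reg_cond_law ::
  "'a measure \<Rightarrow> 'b measure \<Rightarrow> 'c measure \<Rightarrow> ('a \<Rightarrow> 'b) \<Rightarrow> ('a \<Rightarrow> 'c) \<Rightarrow> ('b \<Rightarrow> 'c measure) \<Rightarrow> bool" where
  "reg_cond_law \<mu> N K X Y \<kappa> \<longleftrightarrow>
     X \<in> measurable \<mu> N \<and> Y \<in> measurable \<mu> K \<and> \<kappa> \<in> measurable N (prob_algebra K) \<and>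
     (\<forall>A\<in>sets N. \<forall>B\<in>sets K.
        emeasure \<mu> {\<omega>\<in>space \<mu>. X \<omega> \<in> A \<and> Y \<omega> \<in> B} =
        (\<integral>\<^sup>+x\<in>A. emeasure (\<kappa> x) B \<partial>distr \<mu> N X))"

definition seg_space :: "'t set \<Rightarrow> ('t \<Rightarrow> real^'d::finite) measure" where
  "seg_space J = Pi\<^sub>M J (\<lambda>_. borel)"

definition seg :: "'t set \<Rightarrow> real^('t::finite \<times> 'd::finite) \<Rightarrow> 't \<Rightarrow> real^'d" where
  "seg J x = (\<lambda>s\<in>J. \<chi> i. x $ (s, i))"

text \<open>
  Here \<open>seg {..t} x\<close> is \<open>x\<^sub>1\<^sub>:\<^sub>t\<close> and \<open>seg {t<..} x\<close> is \<open>x\<^sub>t\<^sub>+\<^sub>1\<^sub>:\<^sub>T\<close>; the condition \<open>\<exists>s. t < s\<close> below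
  means \<open>t \<le> T - 1\<close>.  Conditional laws are determined up to null sets only, so the kernels are
  arbitrary versions (replacing a version by another one does not matter) and the coupling
  condition is imposed for almost every \<open>(x\<^sub>1\<^sub>:\<^sub>t, y\<^sub>1\<^sub>:\<^sub>t)\<close>.
\<close>

definition Cpl_bc ::
  "(real^('t::{finite,linorder} \<times> 'd::finite)) measure \<Rightarrow> (real^('t \<times> 'd)) measure \<Rightarrow>
    ((real^('t \<times> 'd)) \<times> (real^('t \<times> 'd))) measure set" where
  "Cpl_bc \<mu> \<nu> = {\<pi> \<in> Cpl \<mu> \<nu>. \<forall>t. (\<exists>s. t < s) \<longrightarrow>
     (\<exists>\<kappa>\<mu> \<kappa>\<nu> \<kappa>\<pi>.
        reg_cond_law \<mu> (seg_space {..t}) (seg_space {t<..}) (seg {..t}) (seg {t<..}) \<kappa>\<mu> \<and>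
        reg_cond_law \<nu> (seg_space {..t}) (seg_space {t<..}) (seg {..t}) (seg {t<..}) \<kappa>\<nu> \<and>
        reg_cond_law \<pi> (seg_space {..t} \<Otimes>\<^sub>M seg_space {..t}) (seg_space {t<..} \<Otimes>\<^sub>M seg_space {t<..})
          (map_prod (seg {..t}) (seg {..t})) (map_prod (seg {t<..}) (seg {t<..})) \<kappa>\<pi> \<and>
        (AE p in distr \<pi> (seg_space {..t} \<Otimes>\<^sub>M seg_space {..t}) (map_prod (seg {..t}) (seg {..t})).
           \<kappa>\<pi> p \<in> Cpl (\<kappa>\<mu> (fst p)) (\<kappa>\<nu> (snd p))))}"

subsection \<open>The entropic adapted Wasserstein distance\<close>

text \<open>
  The library's \<open>KL_divergence b N M\<close> is \<open>\<integral> log (dM/dN) dM\<close> as a real number, hence \<open>0\<close> if the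
  integrand is not integrable.  For probability measures with \<open>M \<lless> N\<close> the negative part is always
  integrable, so that the integral is then \<open>\<infinity>\<close>.
\<close>

definition KL :: "'a measure \<Rightarrow> 'a measure \<Rightarrow> ereal" where
  "KL M N =
     (if absolutely_continuous N M \<and> integrable M (entropy_density (exp 1) N M)
      then ereal (KL_divergence (exp 1) N M) else \<infinity>)"

text \<open>For \<open>lam = 0\<close> the entropic term vanishes, since \<open>0 * \<infinity> = 0\<close> in \<open>ereal\<close>.\<close>

definition AW_cost ::
  "real \<Rightarrow> (real^'n::finite) measure \<Rightarrow> (real^'n) measure \<Rightarrow> ((real^'n) \<times> (real^'n)) measure \<Rightarrow> ereal" where
  "AW_cost lam \<mu> \<nu> \<pi> =
     enn2ereal (\<integral>\<^sup>+p. ennreal ((norm (fst p - snd p))\<^sup>2) \<partial>\<pi>) + ereal lam * KL \<pi> (\<mu> \<Otimes>\<^sub>M \<nu>)"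

definition AW_sq ::
  "real \<Rightarrow> (real^('t::{finite,linorder} \<times> 'd::finite)) measure \<Rightarrow> (real^('t \<times> 'd)) measure \<Rightarrow> ereal" where
  "AW_sq lam \<mu> \<nu> = (INF \<pi>\<in>Cpl_bc \<mu> \<nu>. AW_cost lam \<mu> \<nu> \<pi>)"

definition is_optimizer ::
  "real \<Rightarrow> (real^('t::{finite,linorder} \<times> 'd::finite)) measure \<Rightarrow> (real^('t \<times> 'd)) measure \<Rightarrow>
    ((real^('t \<times> 'd)) \<times> (real^('t \<times> 'd))) measure \<Rightarrow> bool" where
  "is_optimizer lam \<mu> \<nu> \<pi> \<longleftrightarrow> \<pi> \<in> Cpl_bc \<mu> \<nu> \<and> AW_cost lam \<mu> \<nu> \<pi> = AW_sq lam \<mu> \<nu>"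

definition is_unique_optimizer ::
  "real \<Rightarrow> (real^('t::{finite,linorder} \<times> 'd::finite)) measure \<Rightarrow> (real^('t \<times> 'd)) measure \<Rightarrow>
    ((real^('t \<times> 'd)) \<times> (real^('t \<times> 'd))) measure \<Rightarrow> bool" where
  "is_unique_optimizer lam \<mu> \<nu> \<pi> \<longleftrightarrow>
     is_optimizer lam \<mu> \<nu> \<pi> \<and> (\<forall>\<rho>. is_optimizer lam \<mu> \<nu> \<rho> \<longrightarrow> \<rho> = \<pi>)"

text \<open>The admissible middle factors \<open>D\<^sub>t\<close> of the optimizers without entropic term.\<close>

definition unit_contraction :: "real^'d::finite^'d \<Rightarrow> real^'d^'d \<Rightarrow> bool" where
  "unit_contraction S D \<longleftrightarrow> contraction D \<and> (\<forall>i. S $ i $ i \<noteq> 0 \<longrightarrow> D $ i $ i = 1)"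

end

theory Submission
  imports Defs
begin

text \<open>
  Put \<open>G = L diag(V\<^sub>t)\<close> and \<open>H = M diag(U\<^sub>t)\<close> and write the paths as \<open>x = a + G \<epsilon>\<close> and
  \<open>y = b + H \<eta>\<close>.  Both factors and their inverses are block lower triangular, so the noise
  \<open>\<epsilon>\<close> up to time \<open>t\<close> and the path \<open>x\<close> up to time \<open>t\<close> determine each other (\<open>innovation\<close>), and
  likewise for \<open>\<eta>\<close> and \<open>y\<close>.  The rotations \<open>U\<^sub>t\<close>, \<open>V\<^sub>t\<close> make the diagonal blocks of \<open>H\<^sup>T G\<close> equal
  to the diagonal matrices \<open>S\<^sub>t\<close>, with entries \<open>s\<^sub>p\<close> for \<open>p = (t, i)\<close>, and turn \<open>P\<^sub>t = V\<^sub>t D\<^sub>t U\<^sub>t\<^sup>T\<close>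
  into the correlation \<open>D\<^sub>t\<close> of \<open>\<epsilon>\<^sub>t\<close> and \<open>\<eta>\<^sub>t\<close>.

  Under a bicausal coupling the later noises \<open>\<eta>\<^sub>t\<close> stay independent of both paths up to an
  earlier time \<open>s\<close>, because their conditional law is read off from \<open>\<nu>\<close> alone; the same holds for
  \<open>\<epsilon>\<^sub>t\<close> and \<open>\<mu>\<close>.  Hence noises of different times are uncorrelated (\<open>Cpl_bc_uncorrelated\<close>), and
  the transport cost of \<open>\<pi>\<close> collapses to a constant minus \<open>2 \<Sum>\<^sub>p s\<^sub>p k\<^sub>p\<close> with
  \<open>k\<^sub>p = E[\<epsilon>\<^sub>p \<eta>\<^sub>p]\<close> (\<open>transport_cost\<close>).

  For \<open>\<lambda> = 0\<close> everything follows from \<open>k\<^sub>p \<le> 1\<close>: a bicausal coupling is optimal exactly if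
  \<open>k\<^sub>p = 1\<close> wherever \<open>s\<^sub>p \<noteq> 0\<close> (\<open>optimizer_iff\<close>).  If no \<open>s\<^sub>p\<close> vanishes, this forces \<open>\<epsilon> = \<eta>\<close>
  almost surely, which pins down the coupling; if some \<open>s\<^sub>p\<close> vanishes, \<open>k\<^sub>p\<close> is free there.

  For \<open>\<lambda> > 0\<close> let \<open>\<pi>\<^sub>0\<close> be the coupling with correlations \<open>c\<^sub>p = f\<^sub>\<lambda>(s\<^sub>p)\<close> and let \<open>r\<close> be its
  density with respect to \<open>\<mu> \<otimes> \<nu>\<close>.  As \<open>ln r\<close> is quadratic in the noises, its integral over a
  bicausal \<open>\<pi>\<close> is a constant plus \<open>\<Sum>\<^sub>p k\<^sub>p c\<^sub>p / (1 - c\<^sub>p\<^sup>2)\<close>.  The number \<open>f\<^sub>\<lambda>(s\<^sub>p)\<close> is the solution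
  in \<open>[0, 1)\<close> of \<open>\<lambda> c\<^sub>p = 2 s\<^sub>p (1 - c\<^sub>p\<^sup>2)\<close>, so \<open>\<lambda>\<close> times this sum equals \<open>2 \<Sum>\<^sub>p s\<^sub>p k\<^sub>p\<close>, the
  correlations cancel and the total cost of \<open>\<pi>\<close> is a constant plus \<open>\<lambda> KL(\<pi> | \<pi>\<^sub>0)\<close> (\<open>KL_tilt\<close>, \<open>entropic_unique_optimizer\<close>).

  It remains to see that the measures \<open>\<pi>\<^sub>P\<close> are bicausal.  With \<open>R R\<^sup>T = I - D\<^sup>T D\<close>, also block
  diagonal, \<open>\<pi>\<^sub>P\<close> is the law obtained from \<open>\<epsilon> = z\<close> and \<open>\<eta> = D\<^sup>T z + R w\<close> for independent standard
  Gaussian \<open>z\<close>, \<open>w\<close>, where past and future are independent (\<open>couple_in_Cpl_bc\<close>).  This uses that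
  the law of \<open>C Z\<close> depends on \<open>C C\<^sup>T\<close> only, even if that matrix is singular (\<open>gaussian_eq_distr\<close>).
\<close>

section \<open>Factors of positive semidefinite matrices\<close>

text \<open>
  Once the vectors with index in \<open>J\<close> are matched, the reflection along the remaining error
  \<open>f (r p) - r' p\<close> matches one more vector: equal inner products make the error orthogonal to
  the vectors already matched, so these stay fixed, and equal norms make the reflection exchange
  \<open>f (r p)\<close> and \<open>r' p\<close>.
\<close>

lemma orthogonal_transformation_of_gram:
  fixes r r' :: "'i \<Rightarrow> 'a::euclidean_space"
  assumes "finite J" and "\<And>i j. i \<in> J \<Longrightarrow> j \<in> J \<Longrightarrow> r i \<bullet> r j = r' i \<bullet> r' j"
  shows "\<exists>f. orthogonal_transformation f \<and> (\<forall>i\<in>J. f (r i) = r' i)"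
  using assms
proof (induction J)
  case empty
  then show ?case by (auto intro: orthogonal_transformation_id)
next
  case (insert p J)
  then obtain f where f: "orthogonal_transformation f" and fr: "\<And>i. i \<in> J \<Longrightarrow> f (r i) = r' i"
    by auto
  define w where "w = f (r p) - r' p"
  define h where "h x = x - (2 * (x \<bullet> w) / (w \<bullet> w)) *\<^sub>R w" for x
  have fi: "f x \<bullet> f y = x \<bullet> y" for x y
    using f by (auto simp: orthogonal_transformation_def)
  have "linear h"
    by (rule linearI) (auto simp: h_def inner_add_left algebra_simps add_divide_distrib)
  moreover have "norm (h x) = norm x" for x
  proof (cases "w = 0")
    case False
    define c where "c = 2 * (x \<bullet> w) / (w \<bullet> w)"
    have cw: "c * (w \<bullet> w) = 2 * (x \<bullet> w)"
      using False by (simp add: c_def)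
    have "h x \<bullet> h x = x \<bullet> x - 2 * c * (x \<bullet> w) + c * (c * (w \<bullet> w))"
      unfolding h_def c_def[symmetric] inner_diff_left inner_diff_right inner_scaleR_left
        inner_scaleR_right inner_commute[of w x] by argo
    then have "h x \<bullet> h x = x \<bullet> x"
      by (simp add: cw)
    then show ?thesis by (simp add: norm_eq_sqrt_inner)
  qed (simp add: h_def)
  ultimately have h: "orthogonal_transformation h"
    by (simp add: orthogonal_transformation)
  have "r' i \<bullet> w = 0" if "i \<in> J" for i
    using insert.prems[of i p] that fi[of "r i" "r p"] by (simp add: w_def inner_diff_right fr)
  then have "h (r' i) = r' i" if "i \<in> J" for i
    using that by (simp add: h_def)
  moreover have "h (f (r p)) = r' p"
  proof (cases "w = 0")
    case False
    have eq: "r' p \<bullet> r' p = f (r p) \<bullet> f (r p)"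
      using insert.prems[of p p] by (simp add: fi)
    have "w \<bullet> w = 2 * (f (r p) \<bullet> w)"
      unfolding w_def inner_diff_left inner_diff_right eq
      by (simp add: inner_commute)
    moreover have "w \<bullet> w \<noteq> 0"
      using False by simp
    ultimately have "2 * (f (r p) \<bullet> w) / (w \<bullet> w) = 1"
      by (metis divide_self)
    then have "h (f (r p)) = f (r p) - w"
      by (simp only: h_def scaleR_one)
    then show ?thesis by (simp add: w_def)
  qed (simp add: h_def w_def)
  ultimately have "orthogonal_transformation (h \<circ> f) \<and> (\<forall>i\<in>insert p J. (h \<circ> f) (r i) = r' i)"
    using orthogonal_transformation_compose[OF h f] by (auto simp: fr)
  then show ?case by blast
qed

text \<open>
  The rows of two factors of the same matrix have the same inner products, so a rotation
  carries one list of rows to the other.  Applied to covariance matrices, singular ones included,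
  this says that two factors differ by a rotation of the noise only.
\<close>

lemma equal_gram_factors:
  fixes C C' :: "real^'m::finite^'n::finite"
  assumes "C ** transpose C = C' ** transpose C'"
  obtains f where "orthogonal_transformation f" "\<And>z. C *v f z = C' *v z"
proof -
  have row: "(K ** transpose K) $ i $ j = K $ i \<bullet> K $ j" for K :: "real^'m^'n" and i j
    by (simp add: matrix_matrix_mult_def transpose_def inner_vec_def)
  have "\<exists>f. orthogonal_transformation f \<and> (\<forall>i\<in>UNIV. f (C' $ i) = C $ i)"
    by (rule orthogonal_transformation_of_gram) (auto simp: row[symmetric] assms)
  then obtain f where f: "orthogonal_transformation f" and fr: "\<And>i. f (C' $ i) = C $ i"
    by auto
  have "C *v f z = C' *v z" for z
  proof (rule vec_eq_iff[THEN iffD2], rule allI)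
    fix i
    have "(C *v f z) $ i = f (C' $ i) \<bullet> f z"
      by (simp add: matrix_vector_mul_component fr)
    also have "\<dots> = (C' *v z) $ i"
      using f by (simp add: matrix_vector_mul_component orthogonal_transformation_def)
    finally show "(C *v f z) $ i = (C' *v z) $ i" .
  qed
  with f show ?thesis by (rule that)
qed

lemma pos_semidef_sym: "pos_semidef K \<Longrightarrow> K $ i $ j = K $ j $ i"
  unfolding pos_semidef_def transpose_def by (metis vec_lambda_beta)

lemma pos_semidef_zero_row:
  fixes K :: "real^'n::finite^'n"
  assumes K: "pos_semidef K" and p: "K $ p $ p = 0"
  shows "K $ p $ i = 0"
proof (rule ccontr)
  assume nz: "K $ p $ i \<noteq> 0"
  have sym: "K $ i $ p = K $ p $ i"
    by (rule pos_semidef_sym[OF K])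
  \<comment> \<open>with this coefficient the quadratic form at \<open>x\<close> takes the value \<open>-1\<close>\<close>
  define c where "c = - (K $ i $ i + 1) / (2 * K $ p $ i)"
  define x where "x = c *\<^sub>R axis p (1::real) + axis i 1"
  have "x \<bullet> (K *v x) = c * c * K $ p $ p + c * K $ p $ i + c * K $ i $ p + K $ i $ i"
    unfolding x_def
    by (simp add: matrix_vector_right_distrib matrix_vector_mult_scaleR inner_add_left inner_add_right
        inner_axis' matrix_vector_mult_basis column_def algebra_simps)
  also have "\<dots> = 2 * c * K $ p $ i + K $ i $ i"
    using p sym by simp
  also have "\<dots> = -1"
    using nz by (simp add: c_def field_simps)
  finally show False
    using K unfolding pos_semidef_def by (metis neg_0_le_iff_le not_one_le_zero)
qed

text \<open>
  Symmetric elimination with pivot \<open>p\<close>: subtracting the rank one matrix built from column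
  \<open>p\<close> leaves a positive semidefinite matrix (a Schur complement) whose row and column \<open>p\<close>
  vanish.  Its factor has a zero column \<open>p\<close> by the support condition of the induction, and the
  scaled column \<open>p\<close> of \<open>K\<close> is stored there.
\<close>

lemma pos_semidef_factor_supported:
  fixes K :: "real^'n::finite^'n"
  assumes "finite J" and "pos_semidef K" and "\<And>i j. K $ i $ j \<noteq> 0 \<Longrightarrow> i \<in> J \<and> j \<in> J"
  shows "\<exists>C :: real^'n^'n. C ** transpose C = K \<and> (\<forall>i j. j \<notin> J \<longrightarrow> C $ i $ j = 0)"
  using assms
proof (induction J arbitrary: K)
  case empty
  then have "(0::real^'n^'n) ** transpose 0 = K"
    by (auto simp: vec_eq_iff matrix_matrix_mult_def)
  then show ?case by (intro exI[of _ 0]) auto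
next
  case (insert p J)
  have sym: "K $ i $ j = K $ j $ i" for i j
    by (rule pos_semidef_sym[OF insert.prems(1)])
  show ?case
  proof (cases "K $ p $ p = 0")
    case True
    have "i \<in> J \<and> j \<in> J" if "K $ i $ j \<noteq> 0" for i j
      using insert.prems(2)[OF that] that sym pos_semidef_zero_row[OF insert.prems(1) True] by fastforce
    from insert.IH[OF insert.prems(1) this] show ?thesis by blast
  next
    case False
    define d where "d = K $ p $ p"
    have "axis p 1 \<bullet> (K *v axis p 1) = d"
      by (simp add: d_def inner_axis' matrix_vector_mult_basis column_def)
    then have d: "d > 0"
      using False insert.prems(1) unfolding pos_semidef_def d_def by (metis less_eq_real_def)
    define K' where "K' = (\<chi> i j. K $ i $ j - K $ i $ p * K $ j $ p / d)"
    define k where "k = column p K"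
    have kn: "k $ i = K $ i $ p" for i
      by (simp add: k_def column_def)
    have kp: "K *v axis p 1 = k"
      by (simp add: k_def matrix_vector_mult_basis)
    have quad: "x \<bullet> (K' *v x) = x \<bullet> (K *v x) - (x \<bullet> k)\<^sup>2 / d" for x
      by (simp add: K'_def inner_vec_def matrix_vector_mult_def kn power2_eq_square sum_distrib_left
          sum_distrib_right sum_subtractf sum_divide_distrib algebra_simps)
    have "0 \<le> x \<bullet> (K' *v x)" for x
    proof -
      define c where "c = (x \<bullet> k) / d"
      \<comment> \<open>the minimizer of the form of \<open>K\<close> on the line through \<open>x\<close> in direction \<open>p\<close>; the minimum is the form of \<open>K'\<close>\<close>
      define y where "y = x - c *\<^sub>R axis p 1"
      have kx: "axis p 1 \<bullet> (K *v x) = x \<bullet> k"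
        by (simp add: inner_axis' matrix_vector_mul_component) (simp add: inner_vec_def kn sym[of p] mult.commute)
      have kk: "axis p 1 \<bullet> k = d"
        by (simp add: inner_axis' kn d_def)
      have "y \<bullet> (K *v y) = x \<bullet> (K *v x) - c * (x \<bullet> k) - c * (x \<bullet> k) + c * c * d"
        unfolding y_def
        by (simp only: matrix_vector_mult_diff_distrib matrix_vector_mult_scaleR inner_diff_left inner_diff_right
            inner_scaleR_left inner_scaleR_right kp kx kk) (simp add: algebra_simps)
      also have "\<dots> = x \<bullet> (K' *v x)"
        using d by (simp add: quad c_def power2_eq_square field_simps)
      finally show ?thesis
        using insert.prems(1) unfolding pos_semidef_def by metis
    qed
    then have "pos_semidef K'"
      by (auto simp: pos_semidef_def vec_eq_iff transpose_def K'_def sym mult.commute)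
    moreover have "i \<in> J \<and> j \<in> J" if ij: "K' $ i $ j \<noteq> 0" for i j
    proof -
      have "K $ i $ j \<noteq> 0 \<or> (K $ i $ p \<noteq> 0 \<and> K $ j $ p \<noteq> 0)"
        using ij unfolding K'_def by auto
      then have "i \<in> insert p J \<and> j \<in> insert p J"
        using insert.prems(2) by blast
      moreover have "K' $ p $ j = 0" "K' $ i $ p = 0" for i j
        using d by (simp_all add: K'_def d_def sym[of p j])
      then have "i \<noteq> p" "j \<noteq> p"
        using ij by auto
      ultimately show ?thesis by auto
    qed
    ultimately obtain C :: "real^'n^'n" where C: "C ** transpose C = K'" and C0: "\<And>i j. j \<notin> J \<Longrightarrow> C $ i $ j = 0"
      using insert.IH by blast
    define C' :: "real^'n^'n" where "C' = (\<chi> i j. if j = p then k $ i / sqrt d else C $ i $ j)"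
    have "(C' ** transpose C') $ i $ j = K $ i $ j" for i j
    proof -
      have CK: "(\<Sum>l\<in>UNIV. C $ i $ l * C $ j $ l) = K' $ i $ j"
        using arg_cong[OF C, of "\<lambda>K. K $ i $ j"] by (simp add: matrix_matrix_mult_def transpose_def)
      have "(C' ** transpose C') $ i $ j = (\<Sum>l\<in>UNIV. C' $ i $ l * C' $ j $ l)"
        by (simp add: matrix_matrix_mult_def transpose_def)
      also have "\<dots> = (\<Sum>l\<in>UNIV. C $ i $ l * C $ j $ l + (if l = p then k $ i * k $ j / d else 0))"
        using C0[of p] insert.hyps(2) d by (intro sum.cong) (auto simp: C'_def)
      also have "\<dots> = K $ i $ j"
        by (simp add: sum.distrib CK) (simp add: K'_def kn)
      finally show ?thesis .
    qed
    then have "C' ** transpose C' = K \<and> (\<forall>i j. j \<notin> insert p J \<longrightarrow> C' $ i $ j = 0)"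
      using C0 by (auto simp: vec_eq_iff C'_def)
    then show ?thesis by blast
  qed
qed

lemma pos_semidef_factor:
  fixes K :: "real^'n::finite^'n"
  assumes "pos_semidef K"
  obtains C :: "real^'n^'n" where "C ** transpose C = K"
  using pos_semidef_factor_supported[OF finite assms] by auto

section \<open>Gaussian measures and their factors\<close>

lemma prob_space_std_normal: "prob_space std_normal_distribution"
  using real_dist_normal_dist by (simp add: real_distribution_def)

lemma sets_std_gaussian [simp, measurable_cong]: "sets (std_gaussian :: (real^'n::finite) measure) = sets borel"
  and space_std_gaussian [simp]: "space (std_gaussian :: (real^'n::finite) measure) = UNIV"
  by (simp_all add: std_gaussian_def)

lemma Basis_vec_real: "(Basis :: (real^'n::finite) set) = range (\<lambda>i. axis i 1)"
  by (auto simp: Basis_vec_def)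

lemma borel_measurable_vec_nth [measurable]: "(\<lambda>x::real^'n::finite. x $ i) \<in> borel_measurable borel"
  by (intro borel_measurable_continuous_onI continuous_intros)

lemma borel_measurable_vec_lambda [measurable (raw)]:
  fixes f :: "'a \<Rightarrow> 'n::finite \<Rightarrow> real"
  assumes "\<And>i. (\<lambda>x. f x i) \<in> borel_measurable M"
  shows "(\<lambda>x. \<chi> i. f x i) \<in> borel_measurable M"
proof (rule borel_measurable_euclidean_space[THEN iffD2, rule_format])
  fix b :: "real^'n" assume "b \<in> Basis"
  then obtain i where "b = axis i 1" by (auto simp: Basis_vec_real)
  then show "(\<lambda>x. (\<chi> i. f x i) \<bullet> b) \<in> borel_measurable M"
    using assms by (simp add: inner_axis)
qed

lemma borel_measurable_matrix_vector_mult [measurable (raw)]: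
  assumes [measurable]: "f \<in> M \<rightarrow>\<^sub>M (borel :: (real^'n::finite) measure)"
  shows "(\<lambda>x. K *v f x) \<in> M \<rightarrow>\<^sub>M (borel :: (real^'m::finite) measure)"
  unfolding matrix_vector_mult_def by measurable

lemma emeasure_std_gaussian_rectangle:
  fixes A :: "'n::finite \<Rightarrow> real set"
  assumes [measurable]: "\<And>i. A i \<in> sets borel"
  shows "emeasure std_gaussian {z :: real^'n. \<forall>i. z $ i \<in> A i} = (\<Prod>i\<in>UNIV. emeasure std_normal_distribution (A i))"
proof -
  define g where "g b x = ennreal (std_normal_density x) * indicator (A (axis_index b)) x" for b :: "real^'n" and x
  have inj: "inj (\<lambda>i::'n. axis i (1::real))"
    by (auto simp: inj_def axis_eq_axis)
  have "emeasure std_gaussian {z :: real^'n. \<forall>i. z $ i \<in> A i}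
      = (\<integral>\<^sup>+z. ennreal (\<Prod>i\<in>UNIV. std_normal_density (z $ i)) * indicator {z. \<forall>i. z $ i \<in> A i} z \<partial>(lborel :: (real^'n) measure))"
    unfolding std_gaussian_def by (subst emeasure_density) simp_all
  also have "\<dots> = (\<integral>\<^sup>+z. (\<Prod>i\<in>UNIV. ennreal (std_normal_density (z $ i)) * indicator (A i) (z $ i)) \<partial>(lborel :: (real^'n) measure))"
    by (intro nn_integral_cong) (auto simp: prod.distrib prod_ennreal indicator_def intro!: prod.neutral)
  also have "\<dots> = (\<integral>\<^sup>+z. (\<Prod>b\<in>Basis. g b (z \<bullet> b)) \<partial>(lborel :: (real^'n) measure))"
    by (intro nn_integral_cong)
       (simp add: Basis_vec_real prod.reindex[OF inj] o_def inner_axis g_def axis_index_axis)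
  also have "\<dots> = (\<Prod>b\<in>Basis. \<integral>\<^sup>+x. g b x \<partial>lborel)"
    by (rule nn_integral_lborel_prod) (auto simp: g_def)
  also have "\<dots> = (\<Prod>i\<in>UNIV. emeasure std_normal_distribution (A i))"
    by (simp add: Basis_vec_real prod.reindex[OF inj] o_def g_def axis_index_axis emeasure_density)
  finally show ?thesis .
qed

text \<open>
  Measures with the same product values on rectangles are both images of the product measure.
\<close>

lemma measure_eqI_rectangles:
  fixes N N' :: "(real^'n::finite) measure"
  assumes "sigma_finite_measure \<alpha>" "sets \<alpha> = sets borel"
    and N: "sets N = sets borel" "\<And>A. (\<And>i. A i \<in> sets borel) \<Longrightarrow>
        emeasure N {z. \<forall>i. z $ i \<in> A i} = (\<Prod>i\<in>UNIV. emeasure \<alpha> (A i))"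
    and N': "sets N' = sets borel" "\<And>A. (\<And>i. A i \<in> sets borel) \<Longrightarrow>
        emeasure N' {z. \<forall>i. z $ i \<in> A i} = (\<Prod>i\<in>UNIV. emeasure \<alpha> (A i))"
  shows "N = N'"
proof -
  interpret sigma_finite_measure \<alpha> by fact
  interpret P: product_sigma_finite "\<lambda>_::'n. \<alpha>" by unfold_locales
  let ?P = "Pi\<^sub>M (UNIV :: 'n set) (\<lambda>_. \<alpha>)"
  have *: "K = distr ?P borel vec_lambda"
    if K: "sets K = sets borel" "\<And>A. (\<And>i. A i \<in> sets borel) \<Longrightarrow>
        emeasure K {z. \<forall>i. z $ i \<in> A i} = (\<Prod>i\<in>UNIV. emeasure \<alpha> (A i))" for K :: "(real^'n) measure"
  proof -
    note [measurable_cong] = K(1) assms(2)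
    have nth: "vec_nth \<in> K \<rightarrow>\<^sub>M ?P"
      using sets_eq_imp_space_eq[OF assms(2)] by (intro measurable_PiM_single') auto
    have lam: "vec_lambda \<in> ?P \<rightarrow>\<^sub>M (borel :: (real^'n) measure)"
      by (rule borel_measurable_vec_lambda) measurable
    have "distr K ?P vec_nth = ?P"
    proof (rule P.PiM_eqI)
      fix A assume A: "\<And>i. i \<in> (UNIV::'n set) \<Longrightarrow> A i \<in> sets \<alpha>"
      have "emeasure (distr K ?P vec_nth) (Pi\<^sub>E UNIV A) = emeasure K (vec_nth -` Pi\<^sub>E UNIV A \<inter> space K)"
        using A by (intro emeasure_distr nth sets_PiM_I_finite) auto
      also have "vec_nth -` Pi\<^sub>E UNIV A \<inter> space K = {z. \<forall>i. z $ i \<in> A i}"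
        using sets_eq_imp_space_eq[OF K(1)] by (auto simp: PiE_iff)
      finally show "emeasure (distr K ?P vec_nth) (Pi\<^sub>E UNIV A) = (\<Prod>i\<in>UNIV. emeasure \<alpha> (A i))"
        using A K(2) assms(2) by simp
    qed auto
    then have "distr ?P borel vec_lambda = distr (distr K ?P vec_nth) borel vec_lambda"
      by simp
    also have "\<dots> = distr K borel (\<lambda>z. z)"
      by (subst distr_distr[OF lam nth]) (simp add: o_def)
    also have "\<dots> = K"
      by (rule distr_id2) (simp add: K)
    finally show ?thesis ..
  qed
  show ?thesis
    using *[OF N] *[OF N'] by simp
qed

lemma std_gaussian_eqI:
  fixes N :: "(real^'n::finite) measure"
  assumes "sets N = sets borel" "\<And>A. (\<And>i. A i \<in> sets borel) \<Longrightarrow>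
        emeasure N {z. \<forall>i. z $ i \<in> A i} = (\<Prod>i\<in>UNIV. emeasure std_normal_distribution (A i))"
  shows "N = std_gaussian"
proof -
  interpret prob_space std_normal_distribution by (rule prob_space_std_normal)
  show ?thesis
    by (rule measure_eqI_rectangles[of std_normal_distribution])
       (use assms sigma_finite_measure_axioms in \<open>auto simp: emeasure_std_gaussian_rectangle\<close>)
qed

lemma prob_space_std_gaussian: "prob_space (std_gaussian :: (real^'n::finite) measure)"
proof
  show "emeasure (std_gaussian :: (real^'n) measure) (space std_gaussian) = 1"
    using emeasure_std_gaussian_rectangle[of "\<lambda>_::'n. UNIV"]
      prob_space.emeasure_space_1[OF prob_space_std_normal] by simp
qed

text \<open>
  Uniqueness of the translation invariant measure, by exchanging integrals: take
  \<open>\<integral>\<integral> 1\<^sub>A(f x) 1\<^sub>B(y) dy dx\<close> with the unit ball \<open>B\<close>, shift \<open>y\<close> by \<open>f x\<close> and then \<open>x\<close> by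
  the preimage of \<open>y\<close>.  Since \<open>f\<close> preserves \<open>B\<close>, the result is the product of the volumes of
  \<open>A\<close> and \<open>B\<close>.
\<close>

lemma distr_lborel_orthogonal:
  fixes f :: "'a::euclidean_space \<Rightarrow> 'a"
  assumes f: "orthogonal_transformation f"
  shows "distr lborel borel f = lborel"
proof (rule measure_eqI)
  obtain g where fg: "\<And>x. f (g x) = x" "\<And>x. g (f x) = x"
    using orthogonal_transformation_bij[OF f] by (metis bij_inv_eq_iff)
  have lin: "linear f"
    using f by (rule orthogonal_transformation_linear)
  have [measurable]: "f \<in> borel_measurable borel"
    by (intro borel_measurable_continuous_onI linear_continuous_on lin[unfolded linear_conv_bounded_linear])
  have "linear g"
    using orthogonal_transformation_linear[OF orthogonal_transformation_inv[OF f]] fg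
    by (metis inv_unique_comp orthogonal_transformation_bij f bij_inv_eq_iff ext)
  then have [measurable]: "g \<in> borel_measurable borel"
    by (intro borel_measurable_continuous_onI linear_continuous_on) (simp add: linear_conv_bounded_linear)
  let ?l = "lborel :: 'a measure"
  define B where "B = ball (0::'a) 1"
  have [measurable]: "B \<in> sets borel" by (simp add: B_def)
  have fB: "f x \<in> B \<longleftrightarrow> x \<in> B" for x
    using f by (simp add: B_def orthogonal_transformation_norm)
  have B: "emeasure ?l B \<noteq> 0" "emeasure ?l B \<noteq> \<infinity>"
    using content_ball_pos[of 1 "0::'a"] emeasure_lborel_ball_finite[of "0::'a" 1]
    by (auto simp: B_def measure_def)
  have trans: "(\<integral>\<^sup>+x. h (c + x) \<partial>?l) = (\<integral>\<^sup>+x. h x \<partial>?l)" if [measurable]: "h \<in> borel_measurable borel" for h :: "'a \<Rightarrow> ennreal" and c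
    by (subst (2) lborel_distr_plus[of c, symmetric]) (simp add: nn_integral_distr)
  have refl: "(\<integral>\<^sup>+x. h (c - x) \<partial>?l) = (\<integral>\<^sup>+x. h x \<partial>?l)" if [measurable]: "h \<in> borel_measurable borel" for h :: "'a \<Rightarrow> ennreal" and c
    by (subst (2) lborel_affine[of "-1" c]) (simp_all add: nn_integral_density nn_integral_distr)
  fix A assume "A \<in> sets (distr ?l borel f)"
  then have [measurable]: "A \<in> sets borel" by simp
  have "(\<integral>\<^sup>+x. indicator A (f x) \<partial>?l) = (\<integral>\<^sup>+x. indicator (f -` A) x \<partial>?l)"
    by (simp add: indicator_def)
  then have fA: "(\<integral>\<^sup>+x. indicator A (f x) \<partial>?l) = emeasure ?l (f -` A)"
    using measurable_sets[of f borel borel A] by simp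
  have "emeasure ?l (f -` A) * emeasure ?l B = (\<integral>\<^sup>+x. \<integral>\<^sup>+y. indicator A (f x) * indicator B y \<partial>?l \<partial>?l)"
    by (simp add: nn_integral_cmult nn_integral_multc fA)
  also have "\<dots> = (\<integral>\<^sup>+x. \<integral>\<^sup>+y. indicator A (f x) * indicator B (f x + y) \<partial>?l \<partial>?l)"
    by (subst trans) simp_all
  also have "\<dots> = (\<integral>\<^sup>+y. \<integral>\<^sup>+x. indicator A (f x) * indicator B (f x + y) \<partial>?l \<partial>?l)"
    by (rule lborel_pair.Fubini'[symmetric]) simp
  also have "\<dots> = (\<integral>\<^sup>+y. \<integral>\<^sup>+x. indicator A (f (- g y + x)) * indicator B (f (- g y + x) + y) \<partial>?l \<partial>?l)"
    by (subst trans) simp_all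
  also have "\<dots> = (\<integral>\<^sup>+y. \<integral>\<^sup>+x. indicator A (f x - y) * indicator B x \<partial>?l \<partial>?l)"
    using fB by (simp add: linear_diff[OF lin] fg indicator_def)
  also have "\<dots> = (\<integral>\<^sup>+x. \<integral>\<^sup>+y. indicator A (f x - y) * indicator B x \<partial>?l \<partial>?l)"
    by (rule lborel_pair.Fubini') simp
  also have "\<dots> = (\<integral>\<^sup>+x. \<integral>\<^sup>+y. indicator A y * indicator B x \<partial>?l \<partial>?l)"
    by (subst refl) simp_all
  also have "\<dots> = emeasure ?l A * emeasure ?l B"
    by (simp add: nn_integral_cmult nn_integral_multc)
  finally have "emeasure ?l (f -` A) * emeasure ?l B = emeasure ?l A * emeasure ?l B" .
  from arg_cong[OF this, of "\<lambda>x. x / emeasure ?l B"]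
  have "emeasure ?l (f -` A) = emeasure ?l A"
    using B by (simp add: ennreal_mult_divide_eq)
  then show "emeasure (distr ?l borel f) A = emeasure ?l A"
    by (simp add: emeasure_distr)
qed simp

text \<open>
  The density depends on the norm only.
\<close>

lemma std_gaussian_orthogonal:
  fixes f :: "real^'n::finite \<Rightarrow> real^'n"
  assumes f: "orthogonal_transformation f"
  shows "distr std_gaussian borel f = std_gaussian"
proof -
  let ?h = "\<lambda>z::real^'n. ennreal (\<Prod>i\<in>UNIV. std_normal_density (z $ i))"
  have [measurable]: "f \<in> borel_measurable borel"
    using orthogonal_transformation_linear[OF f]
    by (intro borel_measurable_continuous_onI linear_continuous_on) (simp add: linear_conv_bounded_linear)
  have "?h z = ennreal ((1 / sqrt (2 * pi)) ^ CARD('n) * exp (- (z \<bullet> z) / 2))" for z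
    unfolding std_normal_density_def prod.distrib exp_sum[OF finite, symmetric]
    by (simp add: inner_vec_def power2_eq_square sum_negf sum_divide_distrib)
  moreover have "f z \<bullet> f z = z \<bullet> z" for z
    using f by (simp add: orthogonal_transformation_def)
  ultimately have inv: "?h (f z) = ?h z" for z
    by simp
  have "distr std_gaussian borel f = distr (density lborel (\<lambda>z. ?h (f z))) borel f"
    by (simp add: inv std_gaussian_def)
  also have "\<dots> = density (distr lborel borel f) ?h"
    by (rule density_distr[symmetric]) auto
  also have "\<dots> = std_gaussian"
    by (simp add: distr_lborel_orthogonal[OF f] std_gaussian_def)
  finally show ?thesis .
qed

text \<open>
  The factor picked in the definition of a Gaussian measure is immaterial: any other one
  differs from it by a rotation, and rotations preserve the standard Gaussian law.
\<close>

lemma gaussian_eq_distr: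
  fixes C K :: "real^'n::finite^'n"
  assumes C: "C ** transpose C = K"
  shows "gaussian m K = distr std_gaussian borel (\<lambda>z. m + C *v z)"
proof -
  let ?C = "SOME C :: real^'n^'n. C ** transpose C = K"
  have "?C ** transpose ?C = K"
    using C by (rule someI)
  then obtain f where f: "orthogonal_transformation f" and Cf: "\<And>z. C *v f z = ?C *v z"
    using equal_gram_factors[of C ?C] C by auto
  have [measurable]: "f \<in> borel_measurable borel"
    using orthogonal_transformation_linear[OF f]
    by (intro borel_measurable_continuous_onI linear_continuous_on) (simp add: linear_conv_bounded_linear)
  have "gaussian m K = distr std_gaussian borel (\<lambda>z. m + C *v f z)"
    by (simp add: gaussian_def Cf)
  also have "\<dots> = distr (distr std_gaussian borel f) borel (\<lambda>z. m + C *v z)"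
    by (subst distr_distr) (simp_all add: o_def)
  finally show ?thesis
    by (simp add: std_gaussian_orthogonal[OF f])
qed

subsection \<open>Moments\<close>

lemma distr_std_gaussian_component: "distr std_gaussian borel (\<lambda>z :: real^'n::finite. z $ i) = std_normal_distribution"
proof (rule measure_eqI)
  fix A assume "A \<in> sets (distr std_gaussian borel (\<lambda>z :: real^'n. z $ i))"
  then have [measurable]: "A \<in> sets borel" by simp
  have "emeasure (distr std_gaussian borel (\<lambda>z :: real^'n. z $ i)) A
      = emeasure std_gaussian {z :: real^'n. \<forall>j. z $ j \<in> (if j = i then A else UNIV)}"
    by (subst emeasure_distr) (auto intro!: arg_cong[where f="emeasure _"])
  also have "\<dots> = (\<Prod>j\<in>UNIV. emeasure std_normal_distribution (if j = i then A else UNIV))"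
    by (subst emeasure_std_gaussian_rectangle) auto
  also have "\<dots> = (\<Prod>j\<in>UNIV. if j = i then emeasure std_normal_distribution A else 1)"
    using prob_space.emeasure_space_1[OF prob_space_std_normal] by (intro prod.cong) auto
  also have "\<dots> = emeasure std_normal_distribution A"
    by simp
  finally show "emeasure (distr std_gaussian borel (\<lambda>z :: real^'n. z $ i)) A = emeasure std_normal_distribution A" .
qed simp

lemma std_gaussian_power_component:
  shows "integrable std_gaussian (\<lambda>z :: real^'n::finite. (z $ i) ^ k)"
    and "integral\<^sup>L std_gaussian (\<lambda>z :: real^'n::finite. (z $ i) ^ k) = (LINT x|std_normal_distribution. x ^ k)"
proof -
  have "integrable (distr std_gaussian borel (\<lambda>z :: real^'n. z $ i)) (\<lambda>x. x ^ k)"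
    unfolding distr_std_gaussian_component by (rule integrable_std_normal_distribution_moment)
  then show "integrable std_gaussian (\<lambda>z :: real^'n::finite. (z $ i) ^ k)"
    by (subst (asm) integrable_distr_eq) auto
  show "integral\<^sup>L std_gaussian (\<lambda>z :: real^'n::finite. (z $ i) ^ k) = (LINT x|std_normal_distribution. x ^ k)"
    unfolding distr_std_gaussian_component[of i, symmetric] by (subst integral_distr) auto
qed

lemma std_gaussian_mean:
  shows "integrable std_gaussian (\<lambda>z :: real^'n::finite. z $ i)"
    and "integral\<^sup>L std_gaussian (\<lambda>z :: real^'n::finite. z $ i) = 0"
  using std_gaussian_power_component[of i 1] integral_std_normal_distribution_moment_odd[of 1] by simp_all

lemma integrable_mult_square_integrable:
  fixes f g :: "'a \<Rightarrow> real"
  assumes [measurable]: "f \<in> borel_measurable M" "g \<in> borel_measurable M"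
    and "integrable M (\<lambda>x. (f x)\<^sup>2)" "integrable M (\<lambda>x. (g x)\<^sup>2)"
  shows "integrable M (\<lambda>x. f x * g x)"
proof (rule Bochner_Integration.integrable_bound)
  show "integrable M (\<lambda>x. (f x)\<^sup>2 + (g x)\<^sup>2)"
    using assms by simp
  have "\<bar>f x * g x\<bar> \<le> (f x)\<^sup>2 + (g x)\<^sup>2" for x
    using sum_squares_bound[of "\<bar>f x\<bar>" "\<bar>g x\<bar>"] abs_ge_zero[of "f x * g x"]
    unfolding abs_mult power2_abs by linarith
  then show "AE x in M. norm (f x * g x) \<le> norm ((f x)\<^sup>2 + (g x)\<^sup>2)"
    by auto
qed simp

text \<open>
  For distinct coordinates, flipping the sign of one of them preserves the law and negates
  the product.
\<close>

lemma std_gaussian_cov: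
  shows "integrable std_gaussian (\<lambda>z :: real^'n::finite. z $ i * z $ j)"
    and "integral\<^sup>L std_gaussian (\<lambda>z :: real^'n::finite. z $ i * z $ j) = (if i = j then 1 else 0)"
proof -
  show int: "integrable std_gaussian (\<lambda>z :: real^'n::finite. z $ i * z $ j)"
    by (rule integrable_mult_square_integrable) (simp_all add: std_gaussian_power_component)
  show "integral\<^sup>L std_gaussian (\<lambda>z :: real^'n::finite. z $ i * z $ j) = (if i = j then 1 else 0)"
  proof (cases "i = j")
    case True
    then show ?thesis
      using std_gaussian_power_component(2)[of j 2] std_normal_distribution_even_moments(1)[of 1]
      by (simp add: power2_eq_square)
  next
    case False
    \<comment> \<open>the sign flip of coordinate \<open>i\<close>\<close>
    define f where "f z = (\<chi> k. if k = i then - z $ k else z $ k)" for z :: "real^'n"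
    have "orthogonal_transformation f"
      unfolding orthogonal_transformation_def
      by (auto simp: f_def inner_vec_def vec_eq_iff intro!: linearI sum.cong)
    then have eq: "std_gaussian = distr std_gaussian borel f"
      by (rule std_gaussian_orthogonal[symmetric])
    have [measurable]: "f \<in> borel_measurable borel"
      unfolding f_def by measurable
    have "integral\<^sup>L std_gaussian (\<lambda>z :: real^'n::finite. z $ i * z $ j) = (LINT z|std_gaussian. f z $ i * f z $ j)"
      by (subst eq, subst integral_distr) simp_all
    also have "\<dots> = - integral\<^sup>L std_gaussian (\<lambda>z :: real^'n::finite. z $ i * z $ j)"
      using False by (simp add: f_def)
    finally show ?thesis
      using False by simp
  qed
qed

subsection \<open>Independent copies\<close>

lemma emeasure_pair_std_gaussian_rectangles:
  fixes A :: "'n::finite \<Rightarrow> real set" and B :: "'m::finite \<Rightarrow> real set"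
  assumes "\<And>i. A i \<in> sets borel" "\<And>i. B i \<in> sets borel"
  shows "emeasure (std_gaussian \<Otimes>\<^sub>M std_gaussian) ({z. \<forall>i. z $ i \<in> A i} \<times> {w. \<forall>i. w $ i \<in> B i})
     = (\<Prod>i\<in>UNIV. emeasure std_normal_distribution (A i)) * (\<Prod>i\<in>UNIV. emeasure std_normal_distribution (B i))"
proof -
  interpret prob_space "std_gaussian :: (real^'m) measure" by (rule prob_space_std_gaussian)
  have [measurable]: "A i \<in> sets borel" "B j \<in> sets borel" for i j by fact+
  show ?thesis
    by (subst emeasure_pair_measure_Times) (simp_all add: emeasure_std_gaussian_rectangle)
qed

definition vec_join :: "real^'n::finite \<Rightarrow> real^'m::finite \<Rightarrow> real^('n + 'm)" where
  "vec_join x y = (\<chi> k. case k of Inl i \<Rightarrow> x $ i | Inr i \<Rightarrow> y $ i)"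

lemma vec_join_nth [simp]: "vec_join x y $ Inl i = x $ i" "vec_join x y $ Inr j = y $ j"
  by (simp_all add: vec_join_def)

lemma measurable_vec_join [measurable]:
  "(\<lambda>p. vec_join (fst p) (snd p)) \<in> borel \<Otimes>\<^sub>M borel \<rightarrow>\<^sub>M (borel :: (real^('n::finite + 'm::finite)) measure)"
  unfolding vec_join_def
proof (rule borel_measurable_vec_lambda)
  fix i :: "'n + 'm"
  show "(\<lambda>p. case i of Inl j \<Rightarrow> fst p $ j | Inr j \<Rightarrow> snd p $ j)
      \<in> borel_measurable ((borel :: (real^'n) measure) \<Otimes>\<^sub>M (borel :: (real^'m) measure))"
    by (cases i) simp_all
qed

lemma std_gaussian_join:
  "distr (std_gaussian \<Otimes>\<^sub>M std_gaussian) borel (\<lambda>p. vec_join (fst p) (snd p))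
    = (std_gaussian :: (real^('n::finite + 'm::finite)) measure)"
proof (rule std_gaussian_eqI)
  fix A :: "'n + 'm \<Rightarrow> real set" assume A: "\<And>i. A i \<in> sets borel"
  have [measurable]: "A i \<in> sets borel" for i by fact
  have "(\<lambda>p. vec_join (fst p) (snd p)) -` {z. \<forall>i. z $ i \<in> A i} = {z. \<forall>i. z $ i \<in> A (Inl i)} \<times> {w. \<forall>i. w $ i \<in> A (Inr i)}"
    by (auto simp: split_sum_all) 
  then have "emeasure (distr (std_gaussian \<Otimes>\<^sub>M std_gaussian) borel (\<lambda>p. vec_join (fst p) (snd p))) {z. \<forall>i. z $ i \<in> A i}
     = emeasure (std_gaussian \<Otimes>\<^sub>M std_gaussian) ({z. \<forall>i. z $ i \<in> A (Inl i)} \<times> {w. \<forall>i. w $ i \<in> A (Inr i)})"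
    by (subst emeasure_distr) (simp_all add: space_pair_measure)
  also have "\<dots> = (\<Prod>i\<in>UNIV. emeasure std_normal_distribution (A i))"
    using A by (simp add: emeasure_pair_std_gaussian_rectangles UNIV_Plus_UNIV[symmetric] prod.Plus
        del: UNIV_Plus_UNIV)
  finally show "emeasure (distr (std_gaussian \<Otimes>\<^sub>M std_gaussian) borel (\<lambda>p. vec_join (fst p) (snd p))) {z. \<forall>i. z $ i \<in> A i}
     = (\<Prod>i\<in>UNIV. emeasure std_normal_distribution (A i))" .
qed simp

definition mask_vec :: "'n::finite set \<Rightarrow> real^'n \<Rightarrow> real^'n" where
  "mask_vec J z = (\<chi> i. if i \<in> J then z $ i else 0)"

lemma mask_nth: "mask_vec J z $ i = (if i \<in> J then z $ i else 0)"
  by (simp add: mask_vec_def)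

lemma measurable_mask [measurable]: "mask_vec J \<in> borel_measurable borel"
  unfolding mask_vec_def by measurable

text \<open>
  Splicing the coordinates in \<open>J\<close> of one copy with the other coordinates of an independent
  copy yields a standard Gaussian vector again.  This reduces the independence of complementary
  coordinates to the independence of the two copies.
\<close>

lemma std_gaussian_mask:
  "distr (std_gaussian \<Otimes>\<^sub>M std_gaussian) borel (\<lambda>p. mask_vec J (fst p) + mask_vec (- J) (snd p))
    = (std_gaussian :: (real^'n::finite) measure)"
proof (rule std_gaussian_eqI)
  fix A :: "'n \<Rightarrow> real set" assume A: "\<And>i. A i \<in> sets borel"
  have [measurable]: "A i \<in> sets borel" for i by fact
  let ?A = "\<lambda>J i. if i \<in> J then A i else UNIV"
  have "(\<lambda>p. mask_vec J (fst p) + mask_vec (- J) (snd p)) -` {z. \<forall>i. z $ i \<in> A i} = {z. \<forall>i. z $ i \<in> ?A J i} \<times> {w. \<forall>i. w $ i \<in> ?A (-J) i}"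
    by (fastforce simp: mask_nth split: if_splits) 
  then have "emeasure (distr (std_gaussian \<Otimes>\<^sub>M std_gaussian) borel (\<lambda>p. mask_vec J (fst p) + mask_vec (- J) (snd p))) {z. \<forall>i. z $ i \<in> A i}
     = emeasure (std_gaussian \<Otimes>\<^sub>M std_gaussian) ({z. \<forall>i. z $ i \<in> ?A J i} \<times> {w. \<forall>i. w $ i \<in> ?A (-J) i})"
    by (subst emeasure_distr) (simp_all add: space_pair_measure)
  also have "\<dots> = (\<Prod>i\<in>UNIV. emeasure std_normal_distribution (?A J i)) * (\<Prod>i\<in>UNIV. emeasure std_normal_distribution (?A (-J) i))"
    using A by (intro emeasure_pair_std_gaussian_rectangles) auto
  also have "\<dots> = (\<Prod>i\<in>UNIV. emeasure std_normal_distribution (A i))"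
    using prob_space.emeasure_space_1[OF prob_space_std_normal]
    unfolding prod.distrib[symmetric] by (intro prod.cong) auto
  finally show "emeasure (distr (std_gaussian \<Otimes>\<^sub>M std_gaussian) borel (\<lambda>p. mask_vec J (fst p) + mask_vec (- J) (snd p))) {z. \<forall>i. z $ i \<in> A i}
     = (\<Prod>i\<in>UNIV. emeasure std_normal_distribution (A i))" .
qed simp

lemma std_gaussian_split:
  fixes J :: "'n::finite set"
  shows "distr std_gaussian (borel \<Otimes>\<^sub>M borel) (\<lambda>z. (mask_vec J z, mask_vec (- J) z))
    = distr std_gaussian borel (mask_vec J) \<Otimes>\<^sub>M distr std_gaussian borel (mask_vec (- J))"
proof -
  interpret prob_space "std_gaussian :: (real^'n) measure" by (rule prob_space_std_gaussian)
  have m: "mask_vec J (mask_vec J z + mask_vec (- J) w) = mask_vec J z" "mask_vec (- J) (mask_vec J z + mask_vec (- J) w) = mask_vec (- J) w" for z w :: "real^'n"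
    by (auto simp: vec_eq_iff mask_nth)
  have sf: "sigma_finite_measure (distr std_gaussian borel (mask_vec (- J)))"
    by (intro prob_space_imp_sigma_finite prob_space_distr) measurable
  have "distr std_gaussian (borel \<Otimes>\<^sub>M borel) (\<lambda>z. (mask_vec J z, mask_vec (- J) z))
     = distr (distr (std_gaussian \<Otimes>\<^sub>M std_gaussian) borel (\<lambda>p. mask_vec J (fst p) + mask_vec (- J) (snd p)))
        (borel \<Otimes>\<^sub>M borel) (\<lambda>z. (mask_vec J z, mask_vec (- J) z))"
    by (simp add: std_gaussian_mask)
  also have "\<dots> = distr (std_gaussian \<Otimes>\<^sub>M std_gaussian) (borel \<Otimes>\<^sub>M borel) (\<lambda>(z, w). (mask_vec J z, mask_vec (- J) w))"
    by (subst distr_distr) (simp_all add: o_def m case_prod_beta')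
  also have "\<dots> = distr std_gaussian borel (mask_vec J) \<Otimes>\<^sub>M distr std_gaussian borel (mask_vec (- J))"
    using sf by (intro pair_measure_distr[symmetric]) simp_all
  finally show ?thesis .
qed

section \<open>Conditional laws\<close>

text \<open>
  Independence of two random variables whose value types may differ.
\<close>

definition indep_rvs :: "'a measure \<Rightarrow> 'b measure \<Rightarrow> ('a \<Rightarrow> 'b) \<Rightarrow> 'c measure \<Rightarrow> ('a \<Rightarrow> 'c) \<Rightarrow> bool" where
  "indep_rvs M S X T Y \<longleftrightarrow> X \<in> M \<rightarrow>\<^sub>M S \<and> Y \<in> M \<rightarrow>\<^sub>M T \<and>
     distr M S X \<Otimes>\<^sub>M distr M T Y = distr M (S \<Otimes>\<^sub>M T) (\<lambda>w. (X w, Y w))"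

lemma (in prob_space) indep_rvs_iff_indep_var: "indep_rvs M S X T Y \<longleftrightarrow> indep_var S X T Y"
  by (simp add: indep_rvs_def indep_var_distribution_eq)

lemma indep_rvs_distr_iff:
  assumes f: "f \<in> M \<rightarrow>\<^sub>M N" and X: "X \<in> N \<rightarrow>\<^sub>M S" and Y: "Y \<in> N \<rightarrow>\<^sub>M T"
  shows "indep_rvs (distr M N f) S X T Y \<longleftrightarrow> indep_rvs M S (\<lambda>w. X (f w)) T (\<lambda>w. Y (f w))"
proof -
  have "distr (distr M N f) S X = distr M S (\<lambda>w. X (f w))" "distr (distr M N f) T Y = distr M T (\<lambda>w. Y (f w))"
    using f X Y by (simp_all add: distr_distr o_def)
  moreover have "distr (distr M N f) (S \<Otimes>\<^sub>M T) (\<lambda>x. (X x, Y x)) = distr M (S \<Otimes>\<^sub>M T) (\<lambda>w. (X (f w), Y (f w)))"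
    using f X Y by (subst distr_distr) (simp_all add: o_def)
  moreover have "(\<lambda>w. X (f w)) \<in> M \<rightarrow>\<^sub>M S" "(\<lambda>w. Y (f w)) \<in> M \<rightarrow>\<^sub>M T"
    using measurable_compose[OF f] X Y by auto
  ultimately show ?thesis
    using X Y by (simp add: indep_rvs_def)
qed

lemma (in prob_space) indep_rvs_compose:
  assumes ind: "indep_rvs M S X T Y" and f [measurable]: "f \<in> S \<rightarrow>\<^sub>M S'" and g [measurable]: "g \<in> T \<rightarrow>\<^sub>M T'"
  shows "indep_rvs M S' (\<lambda>w. f (X w)) T' (\<lambda>w. g (Y w))"
proof -
  have X [measurable]: "X \<in> M \<rightarrow>\<^sub>M S" and Y [measurable]: "Y \<in> M \<rightarrow>\<^sub>M T"
    and eq: "distr M S X \<Otimes>\<^sub>M distr M T Y = distr M (S \<Otimes>\<^sub>M T) (\<lambda>w. (X w, Y w))"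
    using ind by (auto simp: indep_rvs_def)
  have gY: "distr M T' (\<lambda>w. g (Y w)) = distr (distr M T Y) T' g"
    by (simp add: distr_distr o_def)
  have "sigma_finite_measure (distr (distr M T Y) T' g)"
    unfolding gY[symmetric] by (intro prob_space_imp_sigma_finite prob_space_distr) measurable
  then have "distr M S' (\<lambda>w. f (X w)) \<Otimes>\<^sub>M distr M T' (\<lambda>w. g (Y w))
      = distr (distr M S X \<Otimes>\<^sub>M distr M T Y) (S' \<Otimes>\<^sub>M T') (\<lambda>(x, y). (f x, g y))"
    unfolding gY by (subst pair_measure_distr[symmetric]) (simp_all add: distr_distr o_def)
  also have "\<dots> = distr M (S' \<Otimes>\<^sub>M T') (\<lambda>w. (f (X w), g (Y w)))"
    unfolding eq by (subst distr_distr) (simp_all add: o_def)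
  finally show ?thesis
    by (simp add: indep_rvs_def)
qed

text \<open>
  If \<open>Y\<close> is a function of \<open>X\<close> and of a noise \<open>W\<close> independent of \<open>X\<close>, its conditional law is
  obtained by freezing \<open>X\<close> and averaging over \<open>W\<close>.
\<close>

lemma (in prob_space) reg_cond_law_of_indep:
  assumes ind: "indep_rvs M N X R W" and Y: "\<And>w. w \<in> space M \<Longrightarrow> Y w = \<Psi> (X w) (W w)"
    and \<Psi>: "(\<lambda>(x, w). \<Psi> x w) \<in> N \<Otimes>\<^sub>M R \<rightarrow>\<^sub>M K"
  shows "reg_cond_law M N K X Y (\<lambda>x. distr (distr M R W) K (\<Psi> x))"
proof -
  have X [measurable]: "X \<in> M \<rightarrow>\<^sub>M N" and W [measurable]: "W \<in> M \<rightarrow>\<^sub>M R"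
    using ind by (auto simp: indep_rvs_def)
  note [measurable] = \<Psi>
  have YM: "Y \<in> M \<rightarrow>\<^sub>M K"
    by (subst measurable_cong[OF Y]) (use measurable_compose[OF measurable_Pair[OF X W] \<Psi>] in simp)+
  interpret W: prob_space "distr M R W" by (rule prob_space_distr) simp
  have \<kappa>: "(\<lambda>x. distr (distr M R W) K (\<Psi> x)) \<in> N \<rightarrow>\<^sub>M prob_algebra K"
    by (rule measurable_distr_prob_space2[where M = R])
      (use \<Psi> W.prob_space_axioms in \<open>auto simp: space_prob_algebra intro!: measurable_const\<close>)
  have "emeasure M {w\<in>space M. X w \<in> A \<and> Y w \<in> B} =
        (\<integral>\<^sup>+x\<in>A. emeasure (distr (distr M R W) K (\<Psi> x)) B \<partial>distr M N X)"
    if [measurable]: "A \<in> sets N" "B \<in> sets K" for A B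
  proof -
    let ?E = "{p \<in> space (N \<Otimes>\<^sub>M R). fst p \<in> A \<and> \<Psi> (fst p) (snd p) \<in> B}"
    have [measurable]: "(\<lambda>p. \<Psi> (fst p) (snd p)) \<in> N \<Otimes>\<^sub>M R \<rightarrow>\<^sub>M K"
      using \<Psi> by (simp add: case_prod_beta')
    have E: "?E \<in> sets (N \<Otimes>\<^sub>M R)" by measurable
    have "emeasure M {w\<in>space M. X w \<in> A \<and> Y w \<in> B} = emeasure (distr M (N \<Otimes>\<^sub>M R) (\<lambda>w. (X w, W w))) ?E"
      using E measurable_space[OF X] measurable_space[OF W]
      by (subst emeasure_distr) (auto simp: Y space_pair_measure intro!: arg_cong[where f = "emeasure M"])
    also have "\<dots> = emeasure (distr M N X \<Otimes>\<^sub>M distr M R W) ?E"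
      using ind by (simp add: indep_rvs_def)
    also have "\<dots> = (\<integral>\<^sup>+x. emeasure (distr M R W) (Pair x -` ?E) \<partial>distr M N X)"
      using E by (intro W.emeasure_pair_measure_alt) (simp cong: sets_pair_measure_cong)
    also have "\<dots> = (\<integral>\<^sup>+x\<in>A. emeasure (distr (distr M R W) K (\<Psi> x)) B \<partial>distr M N X)"
    proof (rule nn_integral_cong)
      fix x assume "x \<in> space (distr M N X)"
      then have x: "x \<in> space N" by simp
      have "\<Psi> x \<in> R \<rightarrow>\<^sub>M K"
        using measurable_compose[OF measurable_Pair1'[OF x] \<Psi>] by simp
      then show "emeasure (distr M R W) (Pair x -` ?E) = emeasure (distr (distr M R W) K (\<Psi> x)) B * indicator A x"
        using x by (subst (2) emeasure_distr)
          (auto simp: space_pair_measure indicator_def intro!: arg_cong2[where f = emeasure])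
    qed
    finally show ?thesis .
  qed
  with X YM \<kappa> show ?thesis
    unfolding reg_cond_law_def by blast
qed

text \<open>
  Both sides are finite measures in \<open>E\<close> that agree on rectangles by the definition of a
  conditional law.
\<close>

lemma (in prob_space) reg_cond_law_joint:
  assumes rc: "reg_cond_law M N K X Y \<kappa>" and E: "E \<in> sets (N \<Otimes>\<^sub>M K)"
  shows "emeasure M {w\<in>space M. (X w, Y w) \<in> E} =
     (\<integral>\<^sup>+x. emeasure (\<kappa> x) {y\<in>space K. (x, y) \<in> E} \<partial>distr M N X)"
proof -
  have X [measurable]: "X \<in> M \<rightarrow>\<^sub>M N" and Y [measurable]: "Y \<in> M \<rightarrow>\<^sub>M K"
    and \<kappa> [measurable]: "\<kappa> \<in> N \<rightarrow>\<^sub>M prob_algebra K"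
    and eq: "\<And>A B. A \<in> sets N \<Longrightarrow> B \<in> sets K \<Longrightarrow> emeasure M {w\<in>space M. X w \<in> A \<and> Y w \<in> B} =
        (\<integral>\<^sup>+x\<in>A. emeasure (\<kappa> x) B \<partial>distr M N X)"
    using rc by (auto simp: reg_cond_law_def)
  interpret X: prob_space "distr M N X" by (rule prob_space_distr) simp
  have X_in: "distr M N X \<in> space (prob_algebra N)"
    using X.prob_space_axioms by (simp add: space_prob_algebra)
  define k where "k x = distr (\<kappa> x) (N \<Otimes>\<^sub>M K) (Pair x)" for x
  have k [measurable]: "k \<in> N \<rightarrow>\<^sub>M prob_algebra (N \<Otimes>\<^sub>M K)"
    unfolding k_def by (rule measurable_distr_prob_space2[where M = K]) simp_all
  have sk: "sets (\<kappa> x) = sets K" if "x \<in> space N" for x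
    using measurable_space[OF \<kappa> that] by (simp add: space_prob_algebra)
  have ek: "emeasure (k x) F = emeasure (\<kappa> x) {y\<in>space K. (x, y) \<in> F}"
    if x: "x \<in> space N" and F: "F \<in> sets (N \<Otimes>\<^sub>M K)" for x F
  proof -
    have "Pair x \<in> \<kappa> x \<rightarrow>\<^sub>M N \<Otimes>\<^sub>M K"
      using measurable_Pair1'[OF x, of K] measurable_cong_sets[OF sk[OF x] refl] by blast
    then have "emeasure (k x) F = emeasure (\<kappa> x) (Pair x -` F \<inter> space (\<kappa> x))"
      unfolding k_def using F by (rule emeasure_distr)
    also have "Pair x -` F \<inter> space (\<kappa> x) = {y\<in>space K. (x, y) \<in> F}"
      unfolding sets_eq_imp_space_eq[OF sk[OF x]] by auto
    finally show ?thesis .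
  qed
  have joint: "distr M (N \<Otimes>\<^sub>M K) (\<lambda>w. (X w, Y w)) = distr M N X \<bind> k"
  proof (rule measure_eqI_generator_eq[OF Int_stable_pair_measure_generator[of N K], of "space N \<times> space K"])
    show "{a \<times> b |a b. a \<in> sets N \<and> b \<in> sets K} \<subseteq> Pow (space N \<times> space K)"
      by (rule pair_measure_closed)
    show "sets (distr M (N \<Otimes>\<^sub>M K) (\<lambda>w. (X w, Y w))) = sigma_sets (space N \<times> space K) {a \<times> b |a b. a \<in> sets N \<and> b \<in> sets K}"
      by (simp add: sets_pair_measure)
    show "sets (distr M N X \<bind> k) = sigma_sets (space N \<times> space K) {a \<times> b |a b. a \<in> sets N \<and> b \<in> sets K}"
      by (simp add: sets_bind'[OF X_in k] sets_pair_measure)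
    show "range (\<lambda>_::nat. space N \<times> space K) \<subseteq> {a \<times> b |a b. a \<in> sets N \<and> b \<in> sets K}"
      by auto
    show "emeasure (distr M (N \<Otimes>\<^sub>M K) (\<lambda>w. (X w, Y w))) (space N \<times> space K) \<noteq> \<infinity>"
      using prob_space.emeasure_le_1[OF prob_space_distr[of "\<lambda>w. (X w, Y w)" "N \<Otimes>\<^sub>M K"], of "space N \<times> space K"]
      by (auto simp: top_unique)
    fix F assume "F \<in> {a \<times> b |a b. a \<in> sets N \<and> b \<in> sets K}"
    then obtain a b where F: "F = a \<times> b" and [measurable]: "a \<in> sets N" "b \<in> sets K" by blast
    have "emeasure (distr M (N \<Otimes>\<^sub>M K) (\<lambda>w. (X w, Y w))) F = emeasure M {w\<in>space M. X w \<in> a \<and> Y w \<in> b}"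
      unfolding F by (subst emeasure_distr) (auto intro!: arg_cong[where f = "emeasure M"])
    also have "\<dots> = (\<integral>\<^sup>+x. emeasure (k x) F \<partial>distr M N X)"
    proof -
      have "emeasure (k x) (a \<times> b) = emeasure (\<kappa> x) b * indicator a x" if "x \<in> space N" for x
      proof -
        have "{y \<in> space K. (x, y) \<in> a \<times> b} = (if x \<in> a then b else {})"
          using sets.sets_into_space[OF \<open>b \<in> sets K\<close>] by auto
        then show ?thesis
          using that by (simp add: ek)
      qed
      then show ?thesis
        unfolding eq[OF \<open>a \<in> sets N\<close> \<open>b \<in> sets K\<close>] F by (intro nn_integral_cong) simp
    qed
    also have "\<dots> = emeasure (distr M N X \<bind> k) F"
      unfolding F by (subst emeasure_bind_prob_algebra[OF X_in k]) auto
    finally show "emeasure (distr M (N \<Otimes>\<^sub>M K) (\<lambda>w. (X w, Y w))) F = emeasure (distr M N X \<bind> k) F" .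
  qed auto
  have "emeasure M {w\<in>space M. (X w, Y w) \<in> E} = emeasure (distr M (N \<Otimes>\<^sub>M K) (\<lambda>w. (X w, Y w))) E"
    using E by (subst emeasure_distr) (auto intro!: arg_cong[where f = "emeasure M"])
  also have "\<dots> = (\<integral>\<^sup>+x. emeasure (k x) E \<partial>distr M N X)"
    unfolding joint by (rule emeasure_bind_prob_algebra[OF X_in k E])
  also have "\<dots> = (\<integral>\<^sup>+x. emeasure (\<kappa> x) {y\<in>space K. (x, y) \<in> E} \<partial>distr M N X)"
    using E by (intro nn_integral_cong) (simp add: ek)
  finally show ?thesis .
qed

lemma (in prob_space) reg_cond_law_image:
  assumes rc: "reg_cond_law M N K X Y \<kappa>" and r: "r \<in> K \<rightarrow>\<^sub>M K'" and \<kappa>': "\<kappa>' \<in> N \<rightarrow>\<^sub>M prob_algebra K'"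
    and ae: "AE x in distr M N X. distr (\<kappa> x) K' r = \<kappa>' x"
  shows "reg_cond_law M N K' X (\<lambda>w. r (Y w)) \<kappa>'"
proof -
  have X [measurable]: "X \<in> M \<rightarrow>\<^sub>M N" and Y [measurable]: "Y \<in> M \<rightarrow>\<^sub>M K"
    and \<kappa> [measurable]: "\<kappa> \<in> N \<rightarrow>\<^sub>M prob_algebra K"
    and eq: "\<And>A B. A \<in> sets N \<Longrightarrow> B \<in> sets K \<Longrightarrow> emeasure M {w\<in>space M. X w \<in> A \<and> Y w \<in> B} =
        (\<integral>\<^sup>+x\<in>A. emeasure (\<kappa> x) B \<partial>distr M N X)"
    using rc by (auto simp: reg_cond_law_def)
  have "emeasure M {w\<in>space M. X w \<in> A \<and> r (Y w) \<in> B} = (\<integral>\<^sup>+x\<in>A. emeasure (\<kappa>' x) B \<partial>distr M N X)"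
    if A: "A \<in> sets N" and B: "B \<in> sets K'" for A B
  proof -
    have "emeasure M {w\<in>space M. X w \<in> A \<and> r (Y w) \<in> B}
        = emeasure M {w\<in>space M. X w \<in> A \<and> Y w \<in> r -` B \<inter> space K}"
      using measurable_space[OF Y] by (auto intro!: arg_cong[where f = "emeasure M"])
    also have "\<dots> = (\<integral>\<^sup>+x\<in>A. emeasure (\<kappa> x) (r -` B \<inter> space K) \<partial>distr M N X)"
      using A B r by (intro eq) auto
    also have "\<dots> = (\<integral>\<^sup>+x\<in>A. emeasure (\<kappa>' x) B \<partial>distr M N X)"
    proof (rule nn_integral_cong_AE)
      show "AE x in distr M N X. emeasure (\<kappa> x) (r -` B \<inter> space K) * indicator A x = emeasure (\<kappa>' x) B * indicator A x"
        using ae AE_space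
      proof eventually_elim
        fix x assume x: "distr (\<kappa> x) K' r = \<kappa>' x" "x \<in> space (distr M N X)"
        then have s: "sets (\<kappa> x) = sets K"
          using measurable_space[OF \<kappa>, of x] by (simp add: space_prob_algebra)
        have "emeasure (distr (\<kappa> x) K' r) B = emeasure (\<kappa> x) (r -` B \<inter> space K)"
          using r B sets_eq_imp_space_eq[OF s] by (subst emeasure_distr) (auto simp: measurable_cong_sets[OF s refl])
        with x show "emeasure (\<kappa> x) (r -` B \<inter> space K) * indicator A x = emeasure (\<kappa>' x) B * indicator A x"
          by simp
      qed
    qed
    finally show ?thesis .
  qed
  moreover have "(\<lambda>w. r (Y w)) \<in> M \<rightarrow>\<^sub>M K'"
    using Y r by (rule measurable_compose)
  ultimately show ?thesis
    using X \<kappa>' by (auto simp: reg_cond_law_def)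
qed

text \<open>
  This is how causality is exploited.  Under \<open>P\<close> the conditional law of \<open>Y'\<close> given \<open>Z\<close> depends on
  \<open>h Z\<close> only and is the kernel that describes \<open>Y\<close> given \<open>X\<close> under \<open>M\<close>.  If \<open>g (X, Y)\<close> is independent
  of \<open>X\<close> under \<open>M\<close>, then for each fixed \<open>C\<close> the kernel gives \<open>{g \<in> C}\<close> a mass that is almost surely
  constant; integrating this constant over \<open>Z\<close> yields independence of the whole of \<open>Z\<close>.  The null
  set may depend on \<open>C\<close>, since independence is tested on one set \<open>C\<close> at a time.
\<close>

lemma indep_rvs_of_common_kernel:
  fixes g :: "'b \<times> 'c \<Rightarrow> real"
  assumes "prob_space M" "prob_space P"
    and rcM: "reg_cond_law M N K X Y \<kappa>" and rcP: "reg_cond_law P N' K Z Y' (\<lambda>z. \<kappa> (h z))"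
    and h [measurable]: "h \<in> N' \<rightarrow>\<^sub>M N" and g [measurable]: "g \<in> borel_measurable (N \<Otimes>\<^sub>M K)"
    and ind: "indep_rvs M N X borel (\<lambda>w. g (X w, Y w))"
    and law: "distr P N (\<lambda>w. h (Z w)) = distr M N X"
      "distr P borel (\<lambda>w. g (h (Z w), Y' w)) = distr M borel (\<lambda>w. g (X w, Y w))"
  shows "indep_rvs P N' Z borel (\<lambda>w. g (h (Z w), Y' w))"
proof -
  interpret M: prob_space M by fact
  interpret P: prob_space P by fact
  have X [measurable]: "X \<in> M \<rightarrow>\<^sub>M N" and Y [measurable]: "Y \<in> M \<rightarrow>\<^sub>M K"
    and \<kappa> [measurable]: "\<kappa> \<in> N \<rightarrow>\<^sub>M prob_algebra K"
    using rcM by (auto simp: reg_cond_law_def)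
  have Z [measurable]: "Z \<in> P \<rightarrow>\<^sub>M N'" and Y' [measurable]: "Y' \<in> P \<rightarrow>\<^sub>M K"
    using rcP by (auto simp: reg_cond_law_def)
  interpret X: prob_space "distr M N X" by (rule M.prob_space_distr) simp
  interpret Z: prob_space "distr P N' Z" by (rule P.prob_space_distr) simp
  interpret G: prob_space "distr P borel (\<lambda>w. g (h (Z w), Y' w))" by (rule P.prob_space_distr) simp
  define c where "c C x = emeasure (\<kappa> x) {y\<in>space K. g (x, y) \<in> C}" for C x
  have key: "emeasure M {w\<in>space M. X w \<in> A \<and> g (X w, Y w) \<in> C} = (\<integral>\<^sup>+x\<in>A. c C x \<partial>distr M N X)"
    if [measurable]: "A \<in> sets N" "C \<in> sets borel" for A C
  proof -
    let ?E = "{p \<in> space (N \<Otimes>\<^sub>M K). fst p \<in> A \<and> g p \<in> C}"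
    have "emeasure M {w\<in>space M. X w \<in> A \<and> g (X w, Y w) \<in> C} = emeasure M {w\<in>space M. (X w, Y w) \<in> ?E}"
      using measurable_space[OF X] measurable_space[OF Y]
      by (auto simp: space_pair_measure intro!: arg_cong[where f = "emeasure M"])
    also have "\<dots> = (\<integral>\<^sup>+x. emeasure (\<kappa> x) {y\<in>space K. (x, y) \<in> ?E} \<partial>distr M N X)"
      by (rule M.reg_cond_law_joint[OF rcM]) measurable
    also have "\<dots> = (\<integral>\<^sup>+x\<in>A. c C x \<partial>distr M N X)"
      by (intro nn_integral_cong) (auto simp: c_def space_pair_measure indicator_def intro!: arg_cong[where f = "emeasure _"])
    finally show ?thesis .
  qed
  have key': "emeasure P {w\<in>space P. Z w \<in> A \<and> g (h (Z w), Y' w) \<in> C} = (\<integral>\<^sup>+z\<in>A. c C (h z) \<partial>distr P N' Z)"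
    if [measurable]: "A \<in> sets N'" "C \<in> sets borel" for A C
  proof -
    let ?E = "{p \<in> space (N' \<Otimes>\<^sub>M K). fst p \<in> A \<and> g (h (fst p), snd p) \<in> C}"
    have "emeasure P {w\<in>space P. Z w \<in> A \<and> g (h (Z w), Y' w) \<in> C} = emeasure P {w\<in>space P. (Z w, Y' w) \<in> ?E}"
      using measurable_space[OF Z] measurable_space[OF Y']
      by (auto simp: space_pair_measure intro!: arg_cong[where f = "emeasure P"])
    also have "\<dots> = (\<integral>\<^sup>+z. emeasure (\<kappa> (h z)) {y\<in>space K. (z, y) \<in> ?E} \<partial>distr P N' Z)"
      by (rule P.reg_cond_law_joint[OF rcP]) measurable
    also have "\<dots> = (\<integral>\<^sup>+z\<in>A. c C (h z) \<partial>distr P N' Z)"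
      by (intro nn_integral_cong) (auto simp: c_def space_pair_measure indicator_def intro!: arg_cong[where f = "emeasure _"])
    finally show ?thesis .
  qed
  have const: "AE x in distr M N X. c C x = emeasure (distr M borel (\<lambda>w. g (X w, Y w))) C"
    if [measurable]: "C \<in> sets borel" for C
  proof (rule X.density_unique_finite_measure)
    have "(SIGMA x:space N. {y \<in> space K. g (x, y) \<in> C}) = {p \<in> space (N \<Otimes>\<^sub>M K). g p \<in> C}"
      by (auto simp: space_pair_measure)
    also have "\<dots> \<in> sets (N \<Otimes>\<^sub>M K)"
      by measurable
    finally have E: "(SIGMA x:space N. {y \<in> space K. g (x, y) \<in> C}) \<in> sets (N \<Otimes>\<^sub>M K)" .
    show "c C \<in> borel_measurable (distr M N X)"
      unfolding c_def
      by (simp, rule emeasure_measurable_subprob_algebra2[where N = K])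
         (auto simp: measurable_prob_algebraD E)
    fix A assume "A \<in> sets (distr M N X)"
    then have [measurable]: "A \<in> sets N" by simp
    have "(\<integral>\<^sup>+x\<in>A. c C x \<partial>distr M N X) = emeasure (distr M (N \<Otimes>\<^sub>M borel) (\<lambda>w. (X w, g (X w, Y w)))) (A \<times> C)"
      unfolding key[OF \<open>A \<in> sets N\<close> \<open>C \<in> sets borel\<close>, symmetric]
      by (subst emeasure_distr) (auto intro!: arg_cong[where f = "emeasure M"])
    also have "\<dots> = emeasure (distr M N X \<Otimes>\<^sub>M distr M borel (\<lambda>w. g (X w, Y w))) (A \<times> C)"
      using ind by (simp add: indep_rvs_def)
    also have "\<dots> = emeasure (distr M N X) A * emeasure (distr M borel (\<lambda>w. g (X w, Y w))) C"
      using G.sigma_finite_measure_axioms unfolding law(2)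
      by (intro sigma_finite_measure.emeasure_pair_measure_Times) auto
    also have "\<dots> = (\<integral>\<^sup>+x\<in>A. emeasure (distr M borel (\<lambda>w. g (X w, Y w))) C \<partial>distr M N X)"
      by (subst nn_integral_cmult_indicator) (simp_all add: mult.commute)
    finally show "(\<integral>\<^sup>+x\<in>A. c C x \<partial>distr M N X) = (\<integral>\<^sup>+x\<in>A. emeasure (distr M borel (\<lambda>w. g (X w, Y w))) C \<partial>distr M N X)" .
  qed auto
  have "distr P N' Z \<Otimes>\<^sub>M distr P borel (\<lambda>w. g (h (Z w), Y' w)) = distr P (N' \<Otimes>\<^sub>M borel) (\<lambda>w. (Z w, g (h (Z w), Y' w)))"
  proof (rule pair_measure_eqI)
    fix A :: "'e set" and C :: "real set"
    assume "A \<in> sets (distr P N' Z)" "C \<in> sets (distr P borel (\<lambda>w. g (h (Z w), Y' w)))"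
    then have [measurable]: "A \<in> sets N'" "C \<in> sets borel" by auto
    have "AE z in distr P N' Z. c C (h z) = emeasure (distr P borel (\<lambda>w. g (h (Z w), Y' w))) C"
    proof -
      have eq: "distr M N X = distr (distr P N' Z) N h"
        unfolding law(1)[symmetric] by (subst distr_distr) (simp_all add: o_def)
      have "AE x in distr (distr P N' Z) N h. c C x = emeasure (distr M borel (\<lambda>w. g (X w, Y w))) C"
        unfolding eq[symmetric] by (rule const) simp
      then show ?thesis
        unfolding law(2) by (rule AE_distrD[rotated]) simp
    qed
    then have "(\<integral>\<^sup>+z\<in>A. c C (h z) \<partial>distr P N' Z) = (\<integral>\<^sup>+z\<in>A. emeasure (distr P borel (\<lambda>w. g (h (Z w), Y' w))) C \<partial>distr P N' Z)"
      by (intro nn_integral_cong_AE) auto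
    also have "\<dots> = emeasure (distr P N' Z) A * emeasure (distr P borel (\<lambda>w. g (h (Z w), Y' w))) C"
      by (subst nn_integral_cmult_indicator) (simp_all add: mult.commute)
    finally have "emeasure P {w \<in> space P. Z w \<in> A \<and> g (h (Z w), Y' w) \<in> C}
      = emeasure (distr P N' Z) A * emeasure (distr P borel (\<lambda>w. g (h (Z w), Y' w))) C"
      unfolding key'[OF \<open>A \<in> sets N'\<close> \<open>C \<in> sets borel\<close>] .
    moreover have "emeasure (distr P (N' \<Otimes>\<^sub>M borel) (\<lambda>w. (Z w, g (h (Z w), Y' w)))) (A \<times> C)
      = emeasure P {w \<in> space P. Z w \<in> A \<and> g (h (Z w), Y' w) \<in> C}"
      by (subst emeasure_distr) (auto intro!: arg_cong[where f = "emeasure P"])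
    ultimately show "emeasure (distr P N' Z) A * emeasure (distr P borel (\<lambda>w. g (h (Z w), Y' w))) C
        = emeasure (distr P (N' \<Otimes>\<^sub>M borel) (\<lambda>w. (Z w, g (h (Z w), Y' w)))) (A \<times> C)"
      by simp
  qed (simp_all add: Z.sigma_finite_measure_axioms G.sigma_finite_measure_axioms cong: sets_pair_measure_cong)
  then show ?thesis
    by (simp add: indep_rvs_def)
qed

section \<open>Gaussian pairs\<close>

lemma sum_over_sum_type:
  fixes f :: "'n::finite + 'n \<Rightarrow> real"
  shows "(\<Sum>k\<in>UNIV. f k) = (\<Sum>i\<in>UNIV. f (Inl i)) + (\<Sum>i\<in>UNIV. f (Inr i))"
  by (simp add: UNIV_Plus_UNIV[symmetric] sum.Plus del: UNIV_Plus_UNIV)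

lemma block_2x2_mult:
  "block_2x2 A B C D ** block_2x2 A' B' C' D' =
    block_2x2 (A ** A' + B ** C') (A ** B' + B ** D') (C ** A' + D ** C') (C ** B' + D ** D')"
  by (auto simp: vec_eq_iff block_2x2_def matrix_matrix_mult_def sum_over_sum_type split: sum.split)

lemma transpose_block_2x2:
  "transpose (block_2x2 A B C D) = block_2x2 (transpose A) (transpose C) (transpose B) (transpose D)"
  by (auto simp: vec_eq_iff block_2x2_def transpose_def split: sum.split)

lemma block_2x2_mult_join:
  "block_2x2 A B C D *v vec_join x y = vec_join (A *v x + B *v y) (C *v x + D *v y)"
  by (auto simp: vec_eq_iff block_2x2_def matrix_vector_mult_def sum_over_sum_type vec_join_def split: sum.split)

definition vec_halves :: "real^('n::finite + 'n) \<Rightarrow> (real^'n) \<times> (real^'n)" where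
  "vec_halves z = (\<chi> i. z $ Inl i, \<chi> i. z $ Inr i)"

lemma vec_halves_join [simp]: "vec_halves (vec_join x y) = (x, y)"
  by (simp add: vec_halves_def)

lemma vec_join_add: "vec_join x y + vec_join x' y' = vec_join (x + x') (y + y')"
  by (auto simp: vec_eq_iff vec_join_def split: sum.split)

lemma measurable_vec_halves [measurable]: "vec_halves \<in> borel \<rightarrow>\<^sub>M borel \<Otimes>\<^sub>M borel"
  unfolding vec_halves_def by measurable

lemma gaussian_pair_eq_join:
  "gaussian_pair a b K = distr (gaussian (vec_join a b) K) (borel \<Otimes>\<^sub>M borel) vec_halves"
  by (simp add: gaussian_pair_def vec_join_def vec_halves_def[abs_def] borel_prod)

lemma gaussian_pair_factor:
  fixes A B C D :: "real^'n::finite^'n"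
  assumes "block_2x2 A B C D ** transpose (block_2x2 A B C D) = K"
  shows "gaussian_pair a b K = distr (std_gaussian \<Otimes>\<^sub>M std_gaussian) (borel \<Otimes>\<^sub>M borel)
     (\<lambda>p. (a + (A *v fst p + B *v snd p), b + (C *v fst p + D *v snd p)))"
proof -
  have "gaussian_pair a b K = distr (distr std_gaussian borel (\<lambda>z. vec_join a b + block_2x2 A B C D *v z)) (borel \<Otimes>\<^sub>M borel) vec_halves"
    by (simp add: gaussian_pair_eq_join gaussian_eq_distr[OF assms])
  also have "\<dots> = distr std_gaussian (borel \<Otimes>\<^sub>M borel) (\<lambda>z. vec_halves (vec_join a b + block_2x2 A B C D *v z))"
    by (subst distr_distr) (simp_all add: o_def)
  also have "\<dots> = distr (std_gaussian \<Otimes>\<^sub>M std_gaussian) (borel \<Otimes>\<^sub>M borel)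
      (\<lambda>p. vec_halves (vec_join a b + block_2x2 A B C D *v vec_join (fst p) (snd p)))"
    unfolding std_gaussian_join[symmetric] by (subst distr_distr) (simp_all add: o_def)
  finally show ?thesis
    by (simp add: block_2x2_mult_join vec_join_add)
qed

text \<open>
  Padding with zero rows turns \<open>[K R]\<close> into a square factor of \<open>diag(I, 0)\<close>, which has \<open>diag(I, 0)\<close>
  itself as another factor.
\<close>

lemma std_gaussian_combine:
  fixes K R :: "real^'n::finite^'n"
  assumes "K ** transpose K + R ** transpose R = mat 1"
  shows "distr (std_gaussian \<Otimes>\<^sub>M std_gaussian) borel (\<lambda>p. K *v fst p + R *v snd p) = std_gaussian"
proof -
  let ?K = "block_2x2 (mat 1 :: real^'n^'n) 0 0 0"
  have 0: "transpose (0 :: real^'n^'n) = 0" "X ** (0 :: real^'n^'n) = 0" "(0 :: real^'n^'n) ** X = 0" for X :: "real^'n^'n"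
    by (simp_all add: vec_eq_iff transpose_def matrix_matrix_mult_def)
  let ?g = "std_gaussian :: (real^'n) measure" and ?O = "0 :: real^'n^'n"
  have "gaussian_pair 0 0 ?K = distr (?g \<Otimes>\<^sub>M ?g) (borel \<Otimes>\<^sub>M borel)
     (\<lambda>p. (0 + (K *v fst p + R *v snd p), 0 + (?O *v fst p + ?O *v snd p)))"
    by (rule gaussian_pair_factor) (simp add: transpose_block_2x2 block_2x2_mult assms 0)
  moreover have "gaussian_pair 0 0 ?K = distr (?g \<Otimes>\<^sub>M ?g) (borel \<Otimes>\<^sub>M borel)
     (\<lambda>p. (0 + (mat 1 *v fst p + ?O *v snd p), 0 + (?O *v fst p + ?O *v snd p)))"
    by (rule gaussian_pair_factor) (simp add: transpose_block_2x2 block_2x2_mult 0 transpose_mat)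
  ultimately have eq: "distr (?g \<Otimes>\<^sub>M ?g) (borel \<Otimes>\<^sub>M borel) (\<lambda>p. (K *v fst p + R *v snd p, 0 :: real^'n))
    = distr (?g \<Otimes>\<^sub>M ?g) (borel \<Otimes>\<^sub>M borel) (\<lambda>p. (fst p, 0 :: real^'n))"
    by simp
  have "distr (?g \<Otimes>\<^sub>M ?g) borel (\<lambda>p. K *v fst p + R *v snd p)
      = distr (distr (?g \<Otimes>\<^sub>M ?g) (borel \<Otimes>\<^sub>M borel) (\<lambda>p. (K *v fst p + R *v snd p, 0 :: real^'n))) borel fst"
    by (subst distr_distr) (simp_all add: o_def)
  also have "\<dots> = distr (?g \<Otimes>\<^sub>M ?g) borel fst"
    unfolding eq by (subst distr_distr) (simp_all add: o_def)
  also have "\<dots> = distr (?g \<Otimes>\<^sub>M ?g) ?g fst"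
    by (rule distr_cong) simp_all
  also have "\<dots> = std_gaussian"
    by (rule prob_space.distr_pair_fst[OF prob_space_std_gaussian])
  finally show ?thesis .
qed

section \<open>Innovations\<close>

definition block_lower :: "real^('t::{finite,linorder} \<times> 'd::finite)^('t \<times> 'd) \<Rightarrow> bool" where
  "block_lower K \<longleftrightarrow> (\<forall>p q. fst p < fst q \<longrightarrow> K $ p $ q = 0)"

definition past :: "'t::{finite,linorder} \<Rightarrow> ('t \<times> 'd::finite) set" where
  "past t = {p. fst p \<le> t}"

lemma mask_past_block_lower:
  assumes "block_lower K"
  shows "mask_vec (past t) (K *v x) = mask_vec (past t) (K *v mask_vec (past t) x)"
proof -
  have "K $ p $ q * x $ q = K $ p $ q * mask_vec (past t) x $ q" if "p \<in> past t" for p q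
  proof (cases "q \<in> past t")
    case False
    with that have "fst p < fst q"
      by (auto simp: past_def)
    with assms have "K $ p $ q = 0"
      unfolding block_lower_def by blast
    then show ?thesis by simp
  qed (simp add: mask_nth)
  then show ?thesis
    by (auto simp: vec_eq_iff mask_nth matrix_vector_mult_def intro!: sum.cong)
qed

lemma mask_add: "mask_vec J (x + y) = mask_vec J x + mask_vec J y"
  and mask_diff: "mask_vec J (x - y) = mask_vec J x - mask_vec J y"
  and mask_mask [simp]: "mask_vec J (mask_vec J x) = mask_vec J x"
  and mask_compl_add: "mask_vec J x + mask_vec (- J) x = x"
  by (auto simp: vec_eq_iff mask_nth)

text \<open>
  Entries at times outside \<open>J\<close> are filled with zeros, which makes this a measurable left
  inverse of \<open>seg J\<close> on paths supported in \<open>J\<close> and lets segments of complementary times be added.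
\<close>

definition unseg :: "('t::finite) set \<Rightarrow> ('t \<Rightarrow> real^'d::finite) \<Rightarrow> real^('t \<times> 'd)" where
  "unseg J u = (\<chi> p. if fst p \<in> J then u (fst p) $ snd p else 0)"

lemma unseg_seg: "unseg J (seg J x) = mask_vec (J \<times> UNIV) x"
  by (auto simp: vec_eq_iff unseg_def seg_def mask_nth)

lemma unseg_seg_past: "unseg {..t} (seg {..t} x) = mask_vec (past t) x"
  unfolding unseg_seg by (rule arg_cong[where f = "\<lambda>J. mask_vec J x"]) (auto simp: past_def)

lemma unseg_seg_future: "unseg {t<..} (seg {t<..} x) = mask_vec (- past t) x"
  unfolding unseg_seg by (rule arg_cong[where f = "\<lambda>J. mask_vec J x"]) (auto simp: past_def)

lemma seg_past_mask: "seg {..t} (mask_vec (past t) x) = seg {..t} x"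
  by (auto simp: seg_def mask_nth past_def fun_eq_iff restrict_def)

lemma measurable_unseg [measurable]: "unseg J \<in> seg_space J \<rightarrow>\<^sub>M borel"
  unfolding unseg_def
proof (rule borel_measurable_vec_lambda)
  fix p :: "'a \<times> 'b"
  show "(\<lambda>u. if fst p \<in> J then u (fst p) $ snd p else 0) \<in> borel_measurable (seg_space J)"
  proof (cases "fst p \<in> J")
    case True
    then have "(\<lambda>u. u (fst p)) \<in> seg_space J \<rightarrow>\<^sub>M (borel :: (real^'b) measure)"
      unfolding seg_space_def by (rule measurable_component_singleton)
    from measurable_compose[OF this borel_measurable_vec_nth] True show ?thesis
      by simp
  qed simp
qed

lemma measurable_seg [measurable]: "seg J \<in> borel \<rightarrow>\<^sub>M seg_space J"
  unfolding seg_def[abs_def] seg_space_def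
  by (intro measurable_restrict borel_measurable_vec_lambda) simp

text \<open>
  Paths \<open>m + G z\<close> driven by a noise \<open>z\<close>.  Triangularity of \<open>G\<close> and of its inverse makes
  path and noise generate the same filtration.
\<close>

locale innovation =
  fixes m :: "real^('t::{finite,linorder} \<times> 'd::finite)" and G G' :: "real^('t \<times> 'd)^('t \<times> 'd)"
  assumes GG': "G ** G' = mat 1" and G'G: "G' ** G = mat 1"
    and lower: "block_lower G" and lower': "block_lower G'"
begin

definition law :: "(real^('t \<times> 'd)) measure" where
  "law = distr std_gaussian borel (\<lambda>z. m + G *v z)"

definition noise :: "real^('t \<times> 'd) \<Rightarrow> real^('t \<times> 'd)" where
  "noise x = G' *v (x - m)"

lemma noise_path [simp]: "noise (m + G *v z) = z"
  by (simp add: noise_def matrix_vector_mul_assoc G'G)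

lemma path_noise [simp]: "m + G *v noise x = x"
  by (simp add: noise_def matrix_vector_mul_assoc GG')

lemma measurable_noise [measurable]: "noise \<in> borel_measurable borel"
  unfolding noise_def[abs_def] by measurable

lemma sets_law [simp, measurable_cong]: "sets law = sets borel" and space_law [simp]: "space law = UNIV"
  by (simp_all add: law_def)

lemma prob_space_law: "prob_space law"
  unfolding law_def by (rule prob_space.prob_space_distr[OF prob_space_std_gaussian]) simp

lemma distr_law_noise: "distr law borel noise = std_gaussian"
  unfolding law_def by (subst distr_distr) (simp_all add: o_def distr_id2)

definition past_noise :: "'t \<Rightarrow> ('t \<Rightarrow> real^'d) \<Rightarrow> real^('t \<times> 'd)" where
  "past_noise t u = mask_vec (past t) (noise (unseg {..t} u))"

text \<open>
  The path after time \<open>t\<close> as a function of the path up to time \<open>t\<close> and of the later noise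
  \<open>w\<close>, which has zero entries up to time \<open>t\<close>.
\<close>

definition future :: "'t \<Rightarrow> ('t \<Rightarrow> real^'d) \<Rightarrow> real^('t \<times> 'd) \<Rightarrow> 't \<Rightarrow> real^'d" where
  "future t u w = seg {t<..} (m + G *v (past_noise t u + w))"

definition noise_of_segs :: "'t \<Rightarrow> ('t \<Rightarrow> real^'d) \<times> ('t \<Rightarrow> real^'d) \<Rightarrow> real^('t \<times> 'd)" where
  "noise_of_segs t u = noise (unseg {..t} (fst u) + unseg {t<..} (snd u))"

lemma measurable_past_noise [measurable]: "past_noise t \<in> seg_space {..t} \<rightarrow>\<^sub>M borel"
  unfolding past_noise_def[abs_def] by measurable

lemma measurable_future: "(\<lambda>(u, w). future t u w) \<in> seg_space {..t} \<Otimes>\<^sub>M borel \<rightarrow>\<^sub>M seg_space {t<..}"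
  unfolding future_def case_prod_beta' by measurable

lemma measurable_noise_of_segs [measurable]:
  "noise_of_segs t \<in> seg_space {..t} \<Otimes>\<^sub>M seg_space {t<..} \<rightarrow>\<^sub>M borel"
  unfolding noise_of_segs_def[abs_def] by measurable

text \<open>
  The two triangularity assumptions give the two directions: the path up to time \<open>t\<close>
  determines the noise up to time \<open>t\<close> here, and is determined by it in \<open>seg_past_noise\<close> below.
\<close>

lemma past_noise_seg: "past_noise t (seg {..t} x) = mask_vec (past t) (noise x)"
proof -
  have "mask_vec (past t) (G' *v (mask_vec (past t) x - m)) = mask_vec (past t) (G' *v (x - m))"
    using mask_past_block_lower[OF lower', of t "mask_vec (past t) x - m"] mask_past_block_lower[OF lower', of t "x - m"]
    by (simp add: mask_diff)
  then show ?thesis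
    by (simp add: past_noise_def unseg_seg_past noise_def)
qed

lemma future_noise: "seg {t<..} x = future t (seg {..t} x) (mask_vec (- past t) (noise x))"
  by (simp add: future_def past_noise_seg mask_compl_add)

lemma noise_of_segs_seg: "noise_of_segs t (seg {..t} x, seg {t<..} x) = noise x"
  by (simp add: noise_of_segs_def unseg_seg_past unseg_seg_future mask_compl_add)

lemma seg_past_noise: "seg {..t} x = seg {..t} (m + G *v mask_vec (past t) (noise x))"
proof -
  have "mask_vec (past t) (m + G *v mask_vec (past t) (noise x)) = mask_vec (past t) (m + G *v noise x)"
    unfolding mask_add using mask_past_block_lower[OF lower, of t "noise x"] by simp
  then show ?thesis
    by (metis path_noise seg_past_mask)
qed

lemma indep_past_future_noise:
  "indep_rvs law borel (\<lambda>x. mask_vec (past t) (noise x)) borel (\<lambda>x. mask_vec (- past t) (noise x))"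
proof -
  have "indep_rvs std_gaussian borel (mask_vec (past t)) borel (mask_vec (- past t) :: real^('t \<times> 'd) \<Rightarrow> _)"
    unfolding indep_rvs_def std_gaussian_split by simp
  then have "indep_rvs (distr law borel noise) borel (mask_vec (past t)) borel (mask_vec (- past t))"
    by (simp add: distr_law_noise)
  then show ?thesis
    by (subst (asm) indep_rvs_distr_iff) simp_all
qed

lemma indep_seg_future_noise:
  "indep_rvs law (seg_space {..t}) (seg {..t}) borel (\<lambda>x. mask_vec (- past t) (noise x))"
proof -
  have "indep_rvs law (seg_space {..t}) (\<lambda>x. seg {..t} (m + G *v mask_vec (past t) (noise x)))
      borel (\<lambda>x. mask_vec (- past t) (noise x))"
    by (rule prob_space.indep_rvs_compose[OF prob_space_law indep_past_future_noise, of _ _ "\<lambda>x. x"]) measurable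
  then show ?thesis
    by (simp add: seg_past_noise[symmetric])
qed

lemma indep_seg_noise_component:
  assumes "t < fst q"
  shows "indep_rvs law (seg_space {..t}) (seg {..t}) borel (\<lambda>x. noise x $ q)"
proof -
  have "indep_rvs law (seg_space {..t}) (seg {..t}) borel (\<lambda>x. mask_vec (- past t) (noise x) $ q)"
    by (rule prob_space.indep_rvs_compose[OF prob_space_law indep_seg_future_noise, of "\<lambda>x. x"]) measurable
  then show ?thesis
    using assms by (simp add: mask_nth past_def not_le)
qed

lemma reg_cond_law_future:
  "reg_cond_law law (seg_space {..t}) (seg_space {t<..}) (seg {..t}) (seg {t<..})
     (\<lambda>u. distr (distr law borel (\<lambda>x. mask_vec (- past t) (noise x))) (seg_space {t<..}) (future t u))"
  by (rule prob_space.reg_cond_law_of_indep[OF prob_space_law indep_seg_future_noise future_noise measurable_future])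

lemma law_moments:
  shows "integrable law (\<lambda>x. noise x $ p * noise x $ q)"
    and "(LINT x|law. noise x $ p * noise x $ q) = (if p = q then 1 else 0)"
    and "integrable law (\<lambda>x. noise x $ p)"
    and "(LINT x|law. noise x $ p) = 0"
proof -
  have i: "integrable (distr law borel noise) (\<lambda>z. z $ p * z $ q)" "integrable (distr law borel noise) (\<lambda>z. z $ p)"
    unfolding distr_law_noise by (rule std_gaussian_cov std_gaussian_mean)+
  show "integrable law (\<lambda>x. noise x $ p * noise x $ q)"
    using i(1) by (subst (asm) integrable_distr_eq) auto
  show "integrable law (\<lambda>x. noise x $ p)"
    using i(2) by (subst (asm) integrable_distr_eq) auto
  show "(LINT x|law. noise x $ p * noise x $ q) = (if p = q then 1 else 0)"
    unfolding std_gaussian_cov(2)[symmetric] distr_law_noise[symmetric] by (subst integral_distr) auto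
  show "(LINT x|law. noise x $ p) = 0"
    unfolding std_gaussian_mean(2)[of p, symmetric] distr_law_noise[symmetric] by (subst integral_distr) auto
qed

end

section \<open>Bicausal couplings\<close>

locale innovation_pair = X: innovation a G G' + Y: innovation b H H'
  for a b :: "real^('t::{finite,linorder} \<times> 'd::finite)" and G G' H H' :: "real^('t \<times> 'd)^('t \<times> 'd)"
begin

lemma Cpl_lawsD:
  assumes "\<pi> \<in> Cpl X.law Y.law"
  shows "prob_space \<pi>" "sets \<pi> = sets (borel \<Otimes>\<^sub>M borel)" "space \<pi> = UNIV"
    "distr \<pi> borel fst = X.law" "distr \<pi> borel snd = Y.law"
proof -
  show "prob_space \<pi>" using assms by (simp add: Cpl_def)
  have "sets (X.law \<Otimes>\<^sub>M Y.law) = sets (borel \<Otimes>\<^sub>M borel)"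
    by (rule sets_pair_measure_cong) simp_all
  with assms show s: "sets \<pi> = sets (borel \<Otimes>\<^sub>M borel)" by (simp add: Cpl_def)
  show "space \<pi> = UNIV" using sets_eq_imp_space_eq[OF s] by (simp add: space_pair_measure)
  have "distr \<pi> borel fst = distr \<pi> X.law fst" "distr \<pi> borel snd = distr \<pi> Y.law snd"
    by (rule distr_cong; simp)+
  with assms show "distr \<pi> borel fst = X.law" "distr \<pi> borel snd = Y.law"
    by (simp_all add: Cpl_def)
qed

text \<open>
  The conditional coupling of the futures has the conditional laws of \<open>\<mu>\<close> and of \<open>\<nu>\<close> as
  marginals.  So each future alone, given both pasts, has a law that depends on its own past only,
  and \<open>indep_rvs_of_common_kernel\<close> applies to it.
\<close>

lemma Cpl_bc_indep:
  assumes \<pi>: "\<pi> \<in> Cpl_bc X.law Y.law" and t: "t < fst q"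
  shows "indep_rvs \<pi> (seg_space {..t} \<Otimes>\<^sub>M seg_space {..t}) (map_prod (seg {..t}) (seg {..t}))
      borel (\<lambda>w. Y.noise (snd w) $ q)"
    and "indep_rvs \<pi> (seg_space {..t} \<Otimes>\<^sub>M seg_space {..t}) (map_prod (seg {..t}) (seg {..t}))
      borel (\<lambda>w. X.noise (fst w) $ q)"
proof -
  have "\<pi> \<in> Cpl X.law Y.law" using \<pi> by (simp add: Cpl_bc_def)
  note C = Cpl_lawsD[OF this]
  note [measurable_cong] = C(2)
  let ?P = "seg_space {..t} :: ('t \<Rightarrow> real^'d) measure" and ?F = "seg_space {t<..} :: ('t \<Rightarrow> real^'d) measure"
  let ?Z = "map_prod (seg {..t}) (seg {..t}) :: (real^('t \<times> 'd)) \<times> (real^('t \<times> 'd)) \<Rightarrow> _"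
  have [measurable]: "?Z \<in> \<pi> \<rightarrow>\<^sub>M ?P \<Otimes>\<^sub>M ?P"
    unfolding map_prod_def by measurable
  obtain \<kappa>\<mu> \<kappa>\<nu> \<kappa>\<pi> where
      r\<mu>: "reg_cond_law X.law ?P ?F (seg {..t}) (seg {t<..}) \<kappa>\<mu>"
    and r\<nu>: "reg_cond_law Y.law ?P ?F (seg {..t}) (seg {t<..}) \<kappa>\<nu>"
    and r\<pi>: "reg_cond_law \<pi> (?P \<Otimes>\<^sub>M ?P) (?F \<Otimes>\<^sub>M ?F) ?Z (map_prod (seg {t<..}) (seg {t<..})) \<kappa>\<pi>"
    and ae: "AE p in distr \<pi> (?P \<Otimes>\<^sub>M ?P) ?Z. \<kappa>\<pi> p \<in> Cpl (\<kappa>\<mu> (fst p)) (\<kappa>\<nu> (snd p))"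
    using \<pi> t unfolding Cpl_bc_def by blast
  have m\<mu>: "\<kappa>\<mu> \<in> ?P \<rightarrow>\<^sub>M prob_algebra ?F" and m\<nu>: "\<kappa>\<nu> \<in> ?P \<rightarrow>\<^sub>M prob_algebra ?F"
    using r\<mu> r\<nu> by (auto simp: reg_cond_law_def)
  have s\<mu>: "sets (\<kappa>\<mu> u) = sets ?F" and s\<nu>: "sets (\<kappa>\<nu> u) = sets ?F" if "u \<in> space ?P" for u
    using measurable_space[OF m\<mu> that] measurable_space[OF m\<nu> that] by (auto simp: space_prob_algebra)
  have "AE p in distr \<pi> (?P \<Otimes>\<^sub>M ?P) ?Z. distr (\<kappa>\<pi> p) ?F fst = \<kappa>\<mu> (fst p) \<and> distr (\<kappa>\<pi> p) ?F snd = \<kappa>\<nu> (snd p)"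
    using ae AE_space
  proof eventually_elim
    fix p assume p: "\<kappa>\<pi> p \<in> Cpl (\<kappa>\<mu> (fst p)) (\<kappa>\<nu> (snd p))" "p \<in> space (distr \<pi> (?P \<Otimes>\<^sub>M ?P) ?Z)"
    then have "fst p \<in> space ?P" "snd p \<in> space ?P"
      by (auto simp: space_pair_measure)
    then have "distr (\<kappa>\<pi> p) ?F fst = distr (\<kappa>\<pi> p) (\<kappa>\<mu> (fst p)) fst" "distr (\<kappa>\<pi> p) ?F snd = distr (\<kappa>\<pi> p) (\<kappa>\<nu> (snd p)) snd"
      using s\<mu> s\<nu> by (auto intro!: distr_cong)
    with p(1) show "distr (\<kappa>\<pi> p) ?F fst = \<kappa>\<mu> (fst p) \<and> distr (\<kappa>\<pi> p) ?F snd = \<kappa>\<nu> (snd p)"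
      by (simp add: Cpl_def)
  qed
  then have ae\<mu>: "AE p in distr \<pi> (?P \<Otimes>\<^sub>M ?P) ?Z. distr (\<kappa>\<pi> p) ?F fst = \<kappa>\<mu> (fst p)"
    and ae\<nu>: "AE p in distr \<pi> (?P \<Otimes>\<^sub>M ?P) ?Z. distr (\<kappa>\<pi> p) ?F snd = \<kappa>\<nu> (snd p)"
    by auto
  have m\<mu>': "(\<lambda>p. \<kappa>\<mu> (fst p)) \<in> ?P \<Otimes>\<^sub>M ?P \<rightarrow>\<^sub>M prob_algebra ?F" and m\<nu>': "(\<lambda>p. \<kappa>\<nu> (snd p)) \<in> ?P \<Otimes>\<^sub>M ?P \<rightarrow>\<^sub>M prob_algebra ?F"
    using measurable_compose[OF measurable_fst m\<mu>] measurable_compose[OF measurable_snd m\<nu>] by auto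
  have r1: "reg_cond_law \<pi> (?P \<Otimes>\<^sub>M ?P) ?F ?Z (\<lambda>w. seg {t<..} (fst w)) (\<lambda>p. \<kappa>\<mu> (fst p))"
    using prob_space.reg_cond_law_image[OF C(1) r\<pi> measurable_fst m\<mu>' ae\<mu>] by simp
  have r2: "reg_cond_law \<pi> (?P \<Otimes>\<^sub>M ?P) ?F ?Z (\<lambda>w. seg {t<..} (snd w)) (\<lambda>p. \<kappa>\<nu> (snd p))"
    using prob_space.reg_cond_law_image[OF C(1) r\<pi> measurable_snd m\<nu>' ae\<nu>] by simp
  have "indep_rvs \<pi> (?P \<Otimes>\<^sub>M ?P) ?Z borel (\<lambda>w. (\<lambda>u. Y.noise_of_segs t u $ q) (snd (?Z w), seg {t<..} (snd w)))"
  proof (rule indep_rvs_of_common_kernel[where h = snd and g = "\<lambda>u. Y.noise_of_segs t u $ q", OF Y.prob_space_law C(1) r\<nu> r2])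
    show "indep_rvs Y.law ?P (seg {..t}) borel (\<lambda>w. Y.noise_of_segs t (seg {..t} w, seg {t<..} w) $ q)"
      using Y.indep_seg_noise_component[OF t] by (simp add: Y.noise_of_segs_seg)
    show "distr \<pi> ?P (\<lambda>w. snd (?Z w)) = distr Y.law ?P (seg {..t})"
      unfolding C(5)[symmetric] by (subst distr_distr) (simp_all add: o_def)
    show "distr \<pi> borel (\<lambda>w. Y.noise_of_segs t (snd (?Z w), seg {t<..} (snd w)) $ q)
        = distr Y.law borel (\<lambda>w. Y.noise_of_segs t (seg {..t} w, seg {t<..} w) $ q)"
      unfolding C(5)[symmetric] by (subst distr_distr) (simp_all add: o_def Y.noise_of_segs_seg)
  qed measurable
  then show "indep_rvs \<pi> (?P \<Otimes>\<^sub>M ?P) ?Z borel (\<lambda>w. Y.noise (snd w) $ q)"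
    by (simp add: Y.noise_of_segs_seg)
  have "indep_rvs \<pi> (?P \<Otimes>\<^sub>M ?P) ?Z borel (\<lambda>w. (\<lambda>u. X.noise_of_segs t u $ q) (fst (?Z w), seg {t<..} (fst w)))"
  proof (rule indep_rvs_of_common_kernel[where h = fst and g = "\<lambda>u. X.noise_of_segs t u $ q", OF X.prob_space_law C(1) r\<mu> r1])
    show "indep_rvs X.law ?P (seg {..t}) borel (\<lambda>w. X.noise_of_segs t (seg {..t} w, seg {t<..} w) $ q)"
      using X.indep_seg_noise_component[OF t] by (simp add: X.noise_of_segs_seg)
    show "distr \<pi> ?P (\<lambda>w. fst (?Z w)) = distr X.law ?P (seg {..t})"
      unfolding C(4)[symmetric] by (subst distr_distr) (simp_all add: o_def)
    show "distr \<pi> borel (\<lambda>w. X.noise_of_segs t (fst (?Z w), seg {t<..} (fst w)) $ q)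
        = distr X.law borel (\<lambda>w. X.noise_of_segs t (seg {..t} w, seg {t<..} w) $ q)"
      unfolding C(4)[symmetric] by (subst distr_distr) (simp_all add: o_def X.noise_of_segs_seg)
  qed measurable
  then show "indep_rvs \<pi> (?P \<Otimes>\<^sub>M ?P) ?Z borel (\<lambda>w. X.noise (fst w) $ q)"
    by (simp add: X.noise_of_segs_seg)
qed

lemma Cpl_moments:
  assumes \<pi>: "\<pi> \<in> Cpl X.law Y.law"
  shows "integrable \<pi> (\<lambda>w. X.noise (fst w) $ p * X.noise (fst w) $ q)"
    and "integrable \<pi> (\<lambda>w. Y.noise (snd w) $ p * Y.noise (snd w) $ q)"
    and "integrable \<pi> (\<lambda>w. X.noise (fst w) $ p * Y.noise (snd w) $ q)"
    and "(LINT w|\<pi>. X.noise (fst w) $ p * X.noise (fst w) $ q) = (if p = q then 1 else 0)"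
    and "(LINT w|\<pi>. Y.noise (snd w) $ p * Y.noise (snd w) $ q) = (if p = q then 1 else 0)"
    and "integrable \<pi> (\<lambda>w. X.noise (fst w) $ p)" "(LINT w|\<pi>. X.noise (fst w) $ p) = 0"
    and "integrable \<pi> (\<lambda>w. Y.noise (snd w) $ p)" "(LINT w|\<pi>. Y.noise (snd w) $ p) = 0"
proof -
  note C = Cpl_lawsD[OF \<pi>]
  note [measurable_cong] = C(2)
  have f: "fst \<in> \<pi> \<rightarrow>\<^sub>M borel" and s: "snd \<in> \<pi> \<rightarrow>\<^sub>M borel" by simp_all
  note X = X.law_moments[unfolded C(4)[symmetric]] and Y = Y.law_moments[unfolded C(5)[symmetric]]
  show xx: "integrable \<pi> (\<lambda>w. X.noise (fst w) $ p * X.noise (fst w) $ q)" for p q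
    using X(1)[of p q] f by (subst (asm) integrable_distr_eq) auto
  show yy: "integrable \<pi> (\<lambda>w. Y.noise (snd w) $ p * Y.noise (snd w) $ q)" for p q
    using Y(1)[of p q] s by (subst (asm) integrable_distr_eq) auto
  show "integrable \<pi> (\<lambda>w. X.noise (fst w) $ p * Y.noise (snd w) $ q)"
    using xx[of p p] yy[of q q] by (intro integrable_mult_square_integrable) (simp_all add: power2_eq_square)
  show "(LINT w|\<pi>. X.noise (fst w) $ p * X.noise (fst w) $ q) = (if p = q then 1 else 0)"
    using X(2)[of p q] f by (subst (asm) integral_distr) auto
  show "(LINT w|\<pi>. Y.noise (snd w) $ p * Y.noise (snd w) $ q) = (if p = q then 1 else 0)"
    using Y(2)[of p q] s by (subst (asm) integral_distr) auto
  show "integrable \<pi> (\<lambda>w. X.noise (fst w) $ p)"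
    using X(3)[of p] f by (subst (asm) integrable_distr_eq) auto
  show "integrable \<pi> (\<lambda>w. Y.noise (snd w) $ p)"
    using Y(3)[of p] s by (subst (asm) integrable_distr_eq) auto
  show "(LINT w|\<pi>. X.noise (fst w) $ p) = 0"
    using X(4)[of p] f by (subst (asm) integral_distr) auto
  show "(LINT w|\<pi>. Y.noise (snd w) $ p) = 0"
    using Y(4)[of p] s by (subst (asm) integral_distr) auto
qed

lemma Cpl_bc_uncorrelated:
  assumes \<pi>: "\<pi> \<in> Cpl_bc X.law Y.law" and pq: "fst p \<noteq> fst q"
  shows "(LINT w|\<pi>. X.noise (fst w) $ p * Y.noise (snd w) $ q) = 0"
proof -
  have \<pi>': "\<pi> \<in> Cpl X.law Y.law" using \<pi> by (simp add: Cpl_bc_def)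
  interpret prob_space \<pi> using Cpl_lawsD(1)[OF \<pi>'] .
  note mom = Cpl_moments[OF \<pi>']
  consider "fst p < fst q" | "fst q < fst p" using pq by force
  then show ?thesis
  proof cases
    case 1
    let ?P = "seg_space {..fst p} :: ('t \<Rightarrow> real^'d) measure"
    have "indep_rvs \<pi> borel (\<lambda>w. X.past_noise (fst p) (fst (map_prod (seg {..fst p}) (seg {..fst p}) w)) $ p) borel (\<lambda>w. Y.noise (snd w) $ q)"
      by (rule indep_rvs_compose[OF Cpl_bc_indep(1)[OF \<pi> 1], of _ _ "\<lambda>x. x"]) measurable
    then have "indep_var borel (\<lambda>w. X.noise (fst w) $ p) borel (\<lambda>w. Y.noise (snd w) $ q)"
      by (simp add: indep_rvs_iff_indep_var X.past_noise_seg mask_nth past_def)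
    from indep_var_lebesgue_integral[OF this] show ?thesis
      by (simp add: mom)
  next
    case 2
    have "indep_rvs \<pi> borel (\<lambda>w. Y.past_noise (fst q) (snd (map_prod (seg {..fst q}) (seg {..fst q}) w)) $ q) borel (\<lambda>w. X.noise (fst w) $ p)"
      by (rule indep_rvs_compose[OF Cpl_bc_indep(2)[OF \<pi> 2], of _ _ "\<lambda>x. x"]) measurable
    then have "indep_var borel (\<lambda>w. Y.noise (snd w) $ q) borel (\<lambda>w. X.noise (fst w) $ p)"
      by (simp add: indep_rvs_iff_indep_var Y.past_noise_seg mask_nth past_def)
    from indep_var_lebesgue_integral[OF this] show ?thesis
      by (simp add: mom mult.commute)
  qed
qed

text \<open>
  Freezing the pasts and averaging over the pair of future noises gives a conditional law of
  the coupling whose marginals are the conditional laws of \<open>\<mu>\<close> and \<open>\<nu>\<close> obtained in the same way.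
\<close>

lemma Cpl_bcI:
  assumes \<pi>: "\<pi> \<in> Cpl X.law Y.law"
    and ind: "\<And>t. indep_rvs \<pi>
        (borel \<Otimes>\<^sub>M borel) (\<lambda>w. (mask_vec (past t) (X.noise (fst w)), mask_vec (past t) (Y.noise (snd w))))
        (borel \<Otimes>\<^sub>M borel) (\<lambda>w. (mask_vec (- past t) (X.noise (fst w)), mask_vec (- past t) (Y.noise (snd w))))"
  shows "\<pi> \<in> Cpl_bc X.law Y.law"
proof -
  note C = Cpl_lawsD[OF \<pi>]
  note [measurable_cong] = C(2)
  interpret prob_space \<pi> by fact
  show ?thesis
    unfolding Cpl_bc_def
  proof (intro CollectI conjI allI impI \<pi>)
    fix t :: 't
    let ?P = "seg_space {..t} :: ('t \<Rightarrow> real^'d) measure" and ?F = "seg_space {t<..} :: ('t \<Rightarrow> real^'d) measure"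
    let ?Z = "map_prod (seg {..t}) (seg {..t}) :: (real^('t \<times> 'd)) \<times> (real^('t \<times> 'd)) \<Rightarrow> _"
    let ?WX = "\<lambda>x. mask_vec (- past t) (X.noise x)" and ?WY = "\<lambda>y. mask_vec (- past t) (Y.noise y)"
    let ?W = "\<lambda>w. (?WX (fst w), ?WY (snd w))"
    let ?\<Psi> = "\<lambda>p w. (X.future t (fst p) (fst w), Y.future t (snd p) (snd w))"
    have [measurable]: "(\<lambda>p. X.future t (fst p) (snd p)) \<in> ?P \<Otimes>\<^sub>M borel \<rightarrow>\<^sub>M ?F"
      "(\<lambda>p. Y.future t (fst p) (snd p)) \<in> ?P \<Otimes>\<^sub>M borel \<rightarrow>\<^sub>M ?F"
      using X.measurable_future Y.measurable_future by (simp_all add: case_prod_beta')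
    have fX: "(\<lambda>p. X.future t (fst (fst p)) (fst (snd p))) \<in> (?P \<Otimes>\<^sub>M ?P) \<Otimes>\<^sub>M (borel \<Otimes>\<^sub>M borel) \<rightarrow>\<^sub>M ?F"
      by (rule measurable_compose[of "\<lambda>p. (fst (fst p), fst (snd p))" _ "?P \<Otimes>\<^sub>M borel" "\<lambda>p. X.future t (fst p) (snd p)", simplified]) measurable
    have fY: "(\<lambda>p. Y.future t (snd (fst p)) (snd (snd p))) \<in> (?P \<Otimes>\<^sub>M ?P) \<Otimes>\<^sub>M (borel \<Otimes>\<^sub>M borel) \<rightarrow>\<^sub>M ?F"
      by (rule measurable_compose[of "\<lambda>p. (snd (fst p), snd (snd p))" _ "?P \<Otimes>\<^sub>M borel" "\<lambda>p. Y.future t (fst p) (snd p)", simplified]) measurable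
    have m\<Psi>: "(\<lambda>(p, w). ?\<Psi> p w) \<in> (?P \<Otimes>\<^sub>M ?P) \<Otimes>\<^sub>M (borel \<Otimes>\<^sub>M borel) \<rightarrow>\<^sub>M ?F \<Otimes>\<^sub>M ?F"
      unfolding case_prod_beta' by (intro measurable_Pair fX fY)
    have "indep_rvs \<pi> (?P \<Otimes>\<^sub>M ?P) (\<lambda>w. (\<lambda>w. (seg {..t} (a + G *v fst w), seg {..t} (b + H *v snd w)))
           (mask_vec (past t) (X.noise (fst w)), mask_vec (past t) (Y.noise (snd w)))) (borel \<Otimes>\<^sub>M borel) ?W"
      by (rule indep_rvs_compose[OF ind, of _ _ "\<lambda>x. x"]) measurable
    then have indZ: "indep_rvs \<pi> (?P \<Otimes>\<^sub>M ?P) ?Z (borel \<Otimes>\<^sub>M borel) ?W"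
      by (simp add: X.seg_past_noise[symmetric] Y.seg_past_noise[symmetric] map_prod_def case_prod_beta')
    let ?k = "\<lambda>p. distr (distr \<pi> (borel \<Otimes>\<^sub>M borel) ?W) (?F \<Otimes>\<^sub>M ?F) (?\<Psi> p)"
    let ?kX = "\<lambda>u. distr (distr X.law borel ?WX) ?F (X.future t u)" and ?kY = "\<lambda>u. distr (distr Y.law borel ?WY) ?F (Y.future t u)"
    have rc: "reg_cond_law \<pi> (?P \<Otimes>\<^sub>M ?P) (?F \<Otimes>\<^sub>M ?F) ?Z (map_prod (seg {t<..}) (seg {t<..})) ?k"
      by (rule reg_cond_law_of_indep[OF indZ _ m\<Psi>])
        (simp add: X.future_noise[symmetric] Y.future_noise[symmetric] map_prod_def case_prod_beta')
    have "?k p \<in> Cpl (?kX (fst p)) (?kY (snd p))" if p: "p \<in> space (?P \<Otimes>\<^sub>M ?P)" for p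
    proof -
      have p': "fst p \<in> space ?P" "snd p \<in> space ?P" using p by (auto simp: space_pair_measure)
      have [measurable]: "X.future t (fst p) \<in> borel \<rightarrow>\<^sub>M ?F" "Y.future t (snd p) \<in> borel \<rightarrow>\<^sub>M ?F"
        using measurable_compose[OF measurable_Pair1'[OF p'(1)] X.measurable_future]
          measurable_compose[OF measurable_Pair1'[OF p'(2)] Y.measurable_future] by simp_all
      have k: "?k p = distr \<pi> (?F \<Otimes>\<^sub>M ?F) (\<lambda>w. ?\<Psi> p (?W w))"
        by (subst distr_distr) (simp_all add: o_def)
      have kX: "?kX (fst p) = distr \<pi> ?F (\<lambda>w. X.future t (fst p) (?WX (fst w)))"
        unfolding C(4)[symmetric] by (subst distr_distr, simp, simp)+ (simp add: o_def)
      have kY: "?kY (snd p) = distr \<pi> ?F (\<lambda>w. Y.future t (snd p) (?WY (snd w)))"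
        unfolding C(5)[symmetric] by (subst distr_distr, simp, simp)+ (simp add: o_def)
      have "prob_space (?k p)"
        unfolding k by (rule prob_space_distr) measurable
      moreover have "sets (?k p) = sets (?kX (fst p) \<Otimes>\<^sub>M ?kY (snd p))"
        by (simp cong: sets_pair_measure_cong)
      moreover have "distr (?k p) (?kX (fst p)) fst = ?kX (fst p)"
      proof -
        have "distr (?k p) (?kX (fst p)) fst = distr (?k p) ?F fst"
          by (rule distr_cong) simp_all
        also have "\<dots> = ?kX (fst p)"
          unfolding k kX by (subst distr_distr) (simp_all add: o_def)
        finally show ?thesis .
      qed
      moreover have "distr (?k p) (?kY (snd p)) snd = ?kY (snd p)"
      proof -
        have "distr (?k p) (?kY (snd p)) snd = distr (?k p) ?F snd"
          by (rule distr_cong) simp_all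
        also have "\<dots> = ?kY (snd p)"
          unfolding k kY by (subst distr_distr) (simp_all add: o_def)
        finally show ?thesis .
      qed
      ultimately show ?thesis
        by (simp add: Cpl_def)
    qed
    then have "AE p in distr \<pi> (?P \<Otimes>\<^sub>M ?P) ?Z. ?k p \<in> Cpl (?kX (fst p)) (?kY (snd p))"
      by (intro AE_I2) simp
    with rc X.reg_cond_law_future[of t] Y.reg_cond_law_future[of t]
    show "\<exists>\<kappa>\<mu> \<kappa>\<nu> \<kappa>\<pi>. reg_cond_law X.law ?P ?F (seg {..t}) (seg {t<..}) \<kappa>\<mu> \<and>
        reg_cond_law Y.law ?P ?F (seg {..t}) (seg {t<..}) \<kappa>\<nu> \<and>
        reg_cond_law \<pi> (?P \<Otimes>\<^sub>M ?P) (?F \<Otimes>\<^sub>M ?F) ?Z (map_prod (seg {t<..}) (seg {t<..})) \<kappa>\<pi> \<and>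
        (AE p in distr \<pi> (?P \<Otimes>\<^sub>M ?P) ?Z. \<kappa>\<pi> p \<in> Cpl (\<kappa>\<mu> (fst p)) (\<kappa>\<nu> (snd p)))"
      by blast
  qed
qed

end

section \<open>Relative entropy with respect to a tilted measure\<close>

lemma KL_density_eq:
  fixes r :: "'a \<Rightarrow> real"
  assumes Q: "prob_space Q" and r [measurable]: "r \<in> borel_measurable Q" and pos: "\<And>x. 0 < r x"
    and int: "integrable (density Q r) (\<lambda>x. ln (r x))"
  shows "KL (density Q r) Q = ereal (integral\<^sup>L (density Q r) (\<lambda>x. ln (r x)))"
proof -
  interpret Q: prob_space Q by fact
  have "AE x in Q. ennreal (r x) = RN_deriv Q (density Q r) x"
    by (rule Q.RN_deriv_unique) auto
  then have "AE x in density Q r. ennreal (r x) = RN_deriv Q (density Q r) x"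
    by (subst AE_density) auto
  then have ae: "AE x in density Q r. entropy_density (exp 1) Q (density Q r) x = ln (r x)"
  proof eventually_elim
    fix x assume "ennreal (r x) = RN_deriv Q (density Q r) x"
    then show "entropy_density (exp 1) Q (density Q r) x = ln (r x)"
      using pos[of x] by (simp add: entropy_density_def log_def flip: \<open>ennreal (r x) = _\<close>)
  qed
  have [measurable]: "entropy_density (exp 1) Q (density Q r) \<in> borel_measurable (density Q r)"
    by simp
  have "integrable (density Q r) (entropy_density (exp 1) Q (density Q r))"
    by (rule integrable_cong_AE[THEN iffD2, OF _ _ ae int]) simp_all
  moreover have "integral\<^sup>L (density Q r) (entropy_density (exp 1) Q (density Q r)) = integral\<^sup>L (density Q r) (\<lambda>x. ln (r x))"
    by (rule integral_cong_AE[OF _ _ ae]) simp_all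
  moreover have "absolutely_continuous Q (density Q r)"
    by (rule absolutely_continuousI_density) simp
  ultimately show ?thesis
    by (simp add: KL_def KL_divergence_def)
qed

text \<open>
  With \<open>R\<close> the measure of density \<open>r\<close>, the chain rule reads
  \<open>KL(P | Q) = KL(P | R) + \<integral> ln r dP\<close>, and \<open>KL(P | R)\<close> is nonnegative and vanishes only for
  \<open>P = R\<close>.
\<close>

lemma KL_tilt:
  fixes r :: "'a \<Rightarrow> real"
  assumes Q: "prob_space Q" and r [measurable]: "r \<in> borel_measurable Q" and pos: "\<And>x. 0 < r x"
    and tilt: "prob_space (density Q r)"
    and P: "prob_space P" "sets P = sets Q" and int: "integrable P (\<lambda>x. ln (r x))"
  shows "ereal ((LINT x|P. ln (r x))) \<le> KL P Q"
    and "KL P Q = ereal ((LINT x|P. ln (r x))) \<Longrightarrow> P = density Q r"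
proof -
  interpret Q: prob_space Q by fact
  interpret P: prob_space P by fact
  interpret R: prob_space "density Q r" by fact
  interpret R: information_space "density Q r" "exp 1" by standard simp
  have "ereal ((LINT x|P. ln (r x))) \<le> KL P Q \<and>
    (KL P Q = ereal ((LINT x|P. ln (r x))) \<longrightarrow> P = density Q r)"
  proof (cases "absolutely_continuous Q P \<and> integrable P (entropy_density (exp 1) Q P)")
    case True
    then have ac: "absolutely_continuous Q P" and ie: "integrable P (entropy_density (exp 1) Q P)" by auto
    note [measurable_cong] = P(2)
    have "finite_measure P" by unfold_locales
    from Q.real_RN_deriv[OF this ac P(2)] obtain D where D [measurable]: "D \<in> borel_measurable Q"
      and DRN: "AE x in Q. RN_deriv Q P x = ennreal (D x)" and Dpos: "AE x in P. 0 < D x" and Dnn: "\<And>x. 0 \<le> D x"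
      by this auto
    have "P = density Q (RN_deriv Q P)"
      using ac P(2) by (rule Q.density_RN_deriv[symmetric])
    also have "\<dots> = density Q D"
      using DRN by (intro density_cong) auto
    finally have PD: "P = density Q D" .
    have "density (density Q r) (\<lambda>x. D x / r x) = density Q D"
      using pos Dnn by (intro density_density_divide) (auto simp: less_imp_le less_imp_neq[symmetric])
    then have PR: "P = density (density Q r) (\<lambda>x. D x / r x)"
      by (simp add: PD)
    have acR: "absolutely_continuous (density Q r) P"
      unfolding PR by (rule absolutely_continuousI_density) simp
    have "AE x in density Q r. ennreal (D x / r x) = RN_deriv (density Q r) P x"
      by (rule R.RN_deriv_unique) (simp_all add: PR[symmetric])
    from absolutely_continuous_AE[OF _ acR this]
    have aeR: "AE x in P. ennreal (D x / r x) = RN_deriv (density Q r) P x"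
      by (simp add: P)
    have aeQ: "AE x in P. RN_deriv Q P x = ennreal (D x)"
      using absolutely_continuous_AE[OF _ ac DRN] by (simp add: P)
    have ae: "AE x in P. entropy_density (exp 1) (density Q r) P x = entropy_density (exp 1) Q P x - ln (r x)"
      using aeR aeQ Dpos
    proof eventually_elim
      fix x assume 1: "ennreal (D x / r x) = RN_deriv (density Q r) P x" and 2: "RN_deriv Q P x = ennreal (D x)" and 3: "0 < D x"
      show "entropy_density (exp 1) (density Q r) P x = entropy_density (exp 1) Q P x - ln (r x)"
        using 3 pos[of x] by (simp add: entropy_density_def log_def 2 1[symmetric] ln_div)
    qed
    have mQ: "entropy_density (exp 1) Q P \<in> borel_measurable P"
      using measurable_entropy_density[of "exp 1" Q P] measurable_cong_sets[OF P(2) refl] by blast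
    have "sets P = sets (density Q r)" by (simp add: P)
    then have mR: "entropy_density (exp 1) (density Q r) P \<in> borel_measurable P"
      using measurable_entropy_density[of "exp 1" "density Q r" P] measurable_cong_sets[OF _ refl] by blast
    have iR: "integrable P (entropy_density (exp 1) (density Q r) P)"
      by (rule integrable_cong_AE[THEN iffD2, OF mR _ ae]) (use mQ ie int in auto)
    have KLR: "KL_divergence (exp 1) (density Q r) P = KL_divergence (exp 1) Q P - (LINT x|P. ln (r x))"
      unfolding KL_divergence_def
      by (subst integral_cong_AE[OF mR _ ae]) (use mQ ie int in auto)
    have "AE x in P. ln (D x / r x) = entropy_density (exp 1) (density Q r) P x"
      using aeR Dpos
    proof eventually_elim
      fix x assume "ennreal (D x / r x) = RN_deriv (density Q r) P x" "0 < D x"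
      then show "ln (D x / r x) = entropy_density (exp 1) (density Q r) P x"
        using pos[of x] by (simp add: entropy_density_def log_def flip: \<open>ennreal (D x / r x) = _\<close>)
    qed
    then have "integrable P (\<lambda>x. ln (D x / r x))"
      by (rule integrable_cong_AE[THEN iffD2, rotated 2]) (use iR mR in auto)
    then have "integrable (density Q r) (\<lambda>x. D x / r x * log (exp 1) (D x / r x))"
      unfolding PR using pos Dnn
      by (subst (asm) integrable_real_density) (auto simp: log_def less_imp_le)
    then have "0 \<le> KL_divergence (exp 1) (density Q r) P"
      unfolding PR using pos Dnn P(1)[unfolded PR] by (intro R.KL_nonneg) (auto simp: less_imp_le)
    moreover have "KL_divergence (exp 1) (density Q r) P = 0 \<Longrightarrow> P = density Q r"
      using R.KL_eq_0_iff_eq_ac[OF P(1) acR _ iR] P(2) by simp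
    ultimately show ?thesis
      using True KLR by (auto simp: KL_def)
  qed (auto simp: KL_def)
  then show "ereal ((LINT x|P. ln (r x))) \<le> KL P Q"
    and "KL P Q = ereal ((LINT x|P. ln (r x))) \<Longrightarrow> P = density Q r"
    by auto
qed

section \<open>Correlated standard Gaussian vectors\<close>

text \<open>
  The density of the bivariate normal law with standard marginals and correlation \<open>c\<close>, relative to
  the product of the marginals.
\<close>

definition corr_density :: "real \<Rightarrow> real \<Rightarrow> real \<Rightarrow> real" where
  "corr_density c x y = exp (- (c\<^sup>2 * x\<^sup>2 - 2 * c * x * y + c\<^sup>2 * y\<^sup>2) / (2 * (1 - c\<^sup>2))) / sqrt (1 - c\<^sup>2)"

lemma corr_density_pos: "\<bar>c\<bar> < 1 \<Longrightarrow> 0 < corr_density c x y"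
  by (simp add: corr_density_def abs_square_less_1)

text \<open>
  Completing the square; the factor \<open>sqrt (1 - c\<^sup>2)\<close> is the Jacobian of the substitution
  \<open>y = c x + sqrt (1 - c\<^sup>2) w\<close> for fixed \<open>x\<close>.
\<close>

lemma corr_density_std_normal:
  assumes "\<bar>c\<bar> < 1"
  shows "sqrt (1 - c\<^sup>2) * (corr_density c x (c * x + sqrt (1 - c\<^sup>2) * w) * std_normal_density (c * x + sqrt (1 - c\<^sup>2) * w))
    = std_normal_density w"
proof -
  define y where "y = c * x + sqrt (1 - c\<^sup>2) * w"
  define v where "v = 1 - c\<^sup>2"
  have v: "0 < v" using assms by (simp add: v_def abs_square_less_1)
  have w: "(y - c * x)\<^sup>2 = v * w\<^sup>2"
    using v by (simp add: y_def v_def power_mult_distrib)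
  have "- (c\<^sup>2 * x\<^sup>2 - 2 * c * x * y + c\<^sup>2 * y\<^sup>2) / (2 * v) + - y\<^sup>2 / 2 = - (y - c * x)\<^sup>2 / (2 * v)"
    using v by (simp add: field_simps) (simp add: v_def power2_eq_square algebra_simps)
  also have "\<dots> = - w\<^sup>2 / 2"
    using v by (simp add: w)
  finally have "exp (- (c\<^sup>2 * x\<^sup>2 - 2 * c * x * y + c\<^sup>2 * y\<^sup>2) / (2 * v)) * exp (- y\<^sup>2 / 2) = exp (- w\<^sup>2 / 2)"
    by (simp add: exp_add[symmetric])
  then show ?thesis
    using v unfolding y_def[symmetric] corr_density_def std_normal_density_def unfolding v_def[symmetric]
    by simp
qed

lemma nn_integral_lborel_affine_vec:
  fixes F :: "real^'n::finite \<Rightarrow> ennreal"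
  assumes F [measurable]: "F \<in> borel_measurable borel" and s: "\<And>i. 0 < s i"
  shows "(\<integral>\<^sup>+y. F y \<partial>lborel) = (\<integral>\<^sup>+w. ennreal (\<Prod>i\<in>UNIV. s i) * F (\<chi> i. t i + s i * w $ i) \<partial>lborel)"
proof -
  define T where "T x = (\<chi> i. t i) + (\<Sum>j\<in>Basis. (s (axis_index j) * (x \<bullet> j)) *\<^sub>R j)" for x :: "real^'n"
  have inj: "inj (\<lambda>i::'n. axis i (1::real))"
    by (auto simp: inj_def axis_eq_axis)
  have T: "T x = (\<chi> i. t i + s i * x $ i)" for x
    by (simp add: T_def Basis_vec_real sum.reindex[OF inj] o_def axis_index_axis inner_axis)
      (simp add: vec_eq_iff axis_def if_distrib cong: if_cong)
  have "lborel = density (distr lborel borel T) (\<lambda>_. \<Prod>j\<in>(Basis :: (real^'n) set). \<bar>s (axis_index j)\<bar>)"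
    unfolding T_def by (rule lborel_affine_euclidean)
      (use s in \<open>auto simp: less_imp_neq[symmetric]\<close>)
  also have "(\<Prod>j\<in>(Basis :: (real^'n) set). \<bar>s (axis_index j)\<bar>) = (\<Prod>i\<in>UNIV. s i)"
    using s by (simp add: Basis_vec_real prod.reindex[OF inj] o_def axis_index_axis less_imp_le abs_of_pos)
  finally have "lborel = density (distr lborel borel T) (\<lambda>_. \<Prod>i\<in>UNIV. s i)" .
  then have "(\<integral>\<^sup>+y. F y \<partial>lborel) = (\<integral>\<^sup>+y. F y \<partial>density (distr lborel borel T) (\<lambda>_. \<Prod>i\<in>UNIV. s i))"
    by simp
  also have "\<dots> = (\<integral>\<^sup>+w. ennreal (\<Prod>i\<in>UNIV. s i) * F (T w) \<partial>lborel)"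
    unfolding T[abs_def] by (subst nn_integral_density, simp, simp, subst nn_integral_distr) simp_all
  finally show ?thesis
    by (simp add: T)
qed

text \<open>
  For fixed first vector the second one is an affine image of standard noise, and
  substituting it coordinatewise turns the standard density into the product of the correlation
  densities with the standard one.
\<close>

lemma distr_correlated_std_gaussian:
  fixes c :: "'n::finite \<Rightarrow> real"
  assumes c: "\<And>i. \<bar>c i\<bar> < 1"
  shows "distr (std_gaussian \<Otimes>\<^sub>M std_gaussian) (borel \<Otimes>\<^sub>M borel)
      (\<lambda>p :: (real^'n) \<times> (real^'n). (fst p, \<chi> i. c i * fst p $ i + sqrt (1 - (c i)\<^sup>2) * snd p $ i))
    = density (std_gaussian \<Otimes>\<^sub>M std_gaussian) (\<lambda>p. \<Prod>i\<in>UNIV. corr_density (c i) (fst p $ i) (snd p $ i))"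
    (is "?L = ?R")
proof (rule measure_eqI)
  let ?g = "std_gaussian :: (real^'n) measure"
  interpret g: prob_space ?g by (rule prob_space_std_gaussian)
  have s: "sets (?g \<Otimes>\<^sub>M ?g) = sets (borel \<Otimes>\<^sub>M borel)"
    by (rule sets_pair_measure_cong) simp_all
  note [measurable_cong] = s
  show "sets ?L = sets ?R" by (simp add: s)
  fix E assume "E \<in> sets ?L"
  then have [measurable]: "E \<in> sets (borel \<Otimes>\<^sub>M borel)" by simp
  let ?\<phi> = "\<lambda>z :: real^'n. \<Prod>i\<in>UNIV. std_normal_density (z $ i)"
  let ?r = "\<lambda>z y :: real^'n. \<Prod>i\<in>UNIV. corr_density (c i) (z $ i) (y $ i)"
  let ?T = "\<lambda>z w :: real^'n. \<chi> i. c i * z $ i + sqrt (1 - (c i)\<^sup>2) * w $ i"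
  have [measurable]: "(\<lambda>p. corr_density (c i) (fst p $ i) (snd p $ i)) \<in> borel_measurable (borel \<Otimes>\<^sub>M borel)" for i :: 'n
    unfolding corr_density_def by measurable
  have [measurable]: "(\<lambda>y. corr_density (c i) x (y $ i)) \<in> borel_measurable borel" for i :: 'n and x
    unfolding corr_density_def by measurable
  have nonneg: "0 \<le> corr_density (c i) x y" for i x y
    using corr_density_pos[OF c] by (rule less_imp_le)
  have spos: "0 < sqrt (1 - (c i)\<^sup>2)" for i
    using c[of i] by (simp add: abs_square_less_1)
  have inner: "(\<integral>\<^sup>+w. indicator E (z, ?T z w) \<partial>?g) = (\<integral>\<^sup>+y. ennreal (?r z y) * indicator E (z, y) \<partial>?g)" for z
  proof -
    have "(\<integral>\<^sup>+y. ennreal (?r z y) * indicator E (z, y) \<partial>?g)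
        = (\<integral>\<^sup>+y. ennreal (?\<phi> y) * (ennreal (?r z y) * indicator E (z, y)) \<partial>lborel)"
      unfolding std_gaussian_def by (rule nn_integral_density) measurable
    also have "\<dots> = (\<integral>\<^sup>+w. ennreal (\<Prod>i\<in>UNIV. sqrt (1 - (c i)\<^sup>2)) *
        (ennreal (?\<phi> (?T z w)) * (ennreal (?r z (?T z w)) * indicator E (z, ?T z w))) \<partial>lborel)"
      using spos by (intro nn_integral_lborel_affine_vec) measurable
    also have "\<dots> = (\<integral>\<^sup>+w. ennreal (?\<phi> w) * indicator E (z, ?T z w) \<partial>lborel)"
    proof (rule nn_integral_cong)
      fix w
      define \<sigma> \<rho> \<psi> where "\<sigma> = (\<Prod>i\<in>UNIV. sqrt (1 - (c i)\<^sup>2))" and "\<rho> = ?r z (?T z w)" and "\<psi> = ?\<phi> (?T z w)"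
      have "\<sigma> * (\<rho> * \<psi>) = ?\<phi> w"
        unfolding \<sigma>_def \<rho>_def \<psi>_def prod.distrib[symmetric]
        by (rule prod.cong) (simp_all add: corr_density_std_normal[OF c])
      moreover have "0 \<le> \<sigma>" "0 \<le> \<rho>" "0 \<le> \<psi>"
        unfolding \<sigma>_def \<rho>_def \<psi>_def by (intro prod_nonneg ballI nonneg normal_density_nonneg less_imp_le[OF spos])+
      ultimately have eq: "ennreal \<sigma> * (ennreal \<psi> * ennreal \<rho>) = ennreal (?\<phi> w)"
        by (simp add: ennreal_mult[symmetric] mult.commute[of \<psi>])
      then show "ennreal (\<Prod>i\<in>UNIV. sqrt (1 - (c i)\<^sup>2)) *
        (ennreal (?\<phi> (?T z w)) * (ennreal (?r z (?T z w)) * indicator E (z, ?T z w))) = ennreal (?\<phi> w) * indicator E (z, ?T z w)"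
        unfolding \<sigma>_def[symmetric] \<rho>_def[symmetric] \<psi>_def[symmetric] eq[symmetric] by (simp only: mult.assoc)
    qed
    also have "\<dots> = (\<integral>\<^sup>+w. indicator E (z, ?T z w) \<partial>?g)"
      unfolding std_gaussian_def by (rule nn_integral_density[symmetric]) measurable
    finally show ?thesis ..
  qed
  have "emeasure ?L E = (\<integral>\<^sup>+p. indicator E p \<partial>?L)"
    by simp
  also have "\<dots> = (\<integral>\<^sup>+p. indicator E (fst p, ?T (fst p) (snd p)) \<partial>(?g \<Otimes>\<^sub>M ?g))"
    by (subst nn_integral_distr) simp_all
  also have "\<dots> = (\<integral>\<^sup>+z. \<integral>\<^sup>+w. indicator E (z, ?T z w) \<partial>?g \<partial>?g)"
    by (subst g.nn_integral_fst[symmetric]) simp_all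
  also have "\<dots> = (\<integral>\<^sup>+z. \<integral>\<^sup>+y. ennreal (?r z y) * indicator E (z, y) \<partial>?g \<partial>?g)"
    by (simp only: inner)
  also have "\<dots> = (\<integral>\<^sup>+p. ennreal (?r (fst p) (snd p)) * indicator E p \<partial>(?g \<Otimes>\<^sub>M ?g))"
    by (subst g.nn_integral_fst[symmetric]) simp_all
  also have "\<dots> = emeasure ?R E"
    by (subst emeasure_density) simp_all
  finally show "emeasure ?L E = emeasure ?R E" .
qed

lemma pair_std_gaussian_cov:
  shows "integrable (std_gaussian \<Otimes>\<^sub>M std_gaussian) (\<lambda>p :: (real^'n::finite) \<times> (real^'m::finite). fst p $ i * fst p $ j)"
    and "integral\<^sup>L (std_gaussian \<Otimes>\<^sub>M std_gaussian) (\<lambda>p :: (real^'n::finite) \<times> (real^'m::finite). fst p $ i * fst p $ j) = (if i = j then 1 else 0)"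
    and "integrable (std_gaussian \<Otimes>\<^sub>M std_gaussian) (\<lambda>p :: (real^'n::finite) \<times> (real^'m::finite). fst p $ i * snd p $ k)"
    and "integral\<^sup>L (std_gaussian \<Otimes>\<^sub>M std_gaussian) (\<lambda>p :: (real^'n::finite) \<times> (real^'m::finite). fst p $ i * snd p $ k) = 0"
proof -
  let ?gg = "(std_gaussian :: (real^'n) measure) \<Otimes>\<^sub>M (std_gaussian :: (real^'m) measure)"
  let ?J = "\<lambda>p :: (real^'n) \<times> (real^'m). vec_join (fst p) (snd p)"
  have J: "?J \<in> ?gg \<rightarrow>\<^sub>M borel" by measurable
  have *: "integrable ?gg (\<lambda>p. ?J p $ u * ?J p $ v)" "(LINT p|?gg. ?J p $ u * ?J p $ v) = (if u = v then 1 else 0)" for u v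
  proof -
    have i: "integrable (distr ?gg borel ?J) (\<lambda>z. z $ u * z $ v)"
      unfolding std_gaussian_join by (rule std_gaussian_cov)
    show "integrable ?gg (\<lambda>p. ?J p $ u * ?J p $ v)"
      using i J by (subst (asm) integrable_distr_eq) auto
    have "(LINT p|?gg. ?J p $ u * ?J p $ v) = integral\<^sup>L (distr ?gg borel ?J) (\<lambda>z. z $ u * z $ v)"
      using J by (subst integral_distr) auto
    then show "(LINT p|?gg. ?J p $ u * ?J p $ v) = (if u = v then 1 else 0)"
      unfolding std_gaussian_join std_gaussian_cov .
  qed
  show "integrable ?gg (\<lambda>p. fst p $ i * fst p $ j)" "(LINT p|?gg. fst p $ i * fst p $ j) = (if i = j then 1 else 0)"
    using *[of "Inl i" "Inl j"] by simp_all
  show "integrable ?gg (\<lambda>p. fst p $ i * snd p $ k)" "(LINT p|?gg. fst p $ i * snd p $ k) = 0"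
    using *[of "Inl i" "Inr k"] by simp_all
qed

section \<open>Couplings with block diagonal correlation\<close>

\<comment> \<open>keeps transposes in the form in which the factorizations are stated\<close>
declare transpose_matrix_vector [simp del]

lemma matrix_add_rdistrib: "(A + B) ** C = A ** C + B ** (C :: real^'k^'m::finite)"
  by (simp add: vec_eq_iff matrix_matrix_mult_def distrib_right sum.distrib)

definition same_time :: "real^('t \<times> 'd)^('t::finite \<times> 'd::finite) \<Rightarrow> bool" where
  "same_time K \<longleftrightarrow> (\<forall>p q. fst p \<noteq> fst q \<longrightarrow> K $ p $ q = 0)"

lemma same_time_transpose: "same_time K \<Longrightarrow> same_time (transpose K)"
  by (auto simp: same_time_def transpose_def)

lemma mask_same_time:
  assumes "same_time K" and "J = past t \<or> J = - past t"
  shows "mask_vec J (K *v x) = mask_vec J (K *v mask_vec J x)"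
proof -
  have "K $ p $ q * x $ q = K $ p $ q * mask_vec J x $ q" if "p \<in> J" for p q
  proof (cases "q \<in> J")
    case False
    with that assms(2) have "fst p \<noteq> fst q"
      by (auto simp: past_def)
    with assms(1) have "K $ p $ q = 0"
      unfolding same_time_def by blast
    then show ?thesis by simp
  qed (simp add: mask_nth)
  then show ?thesis
    by (auto simp: vec_eq_iff mask_nth matrix_vector_mult_def intro!: sum.cong)
qed

text \<open>
  A pair of independent standard vectors is one standard vector indexed by the sum type, in
  which the coordinates in both copies of \<open>J\<close> and the remaining ones are complementary.
\<close>

lemma indep_past_future_pair_std_gaussian:
  "indep_rvs (std_gaussian \<Otimes>\<^sub>M std_gaussian)
      (borel \<Otimes>\<^sub>M borel) (\<lambda>p. (mask_vec J (fst p), mask_vec J (snd p :: real^'n::finite)))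
      (borel \<Otimes>\<^sub>M borel) (\<lambda>p. (mask_vec (- J) (fst p :: real^'n), mask_vec (- J) (snd p)))"
proof -
  let ?J = "Inl ` J \<union> Inr ` J :: ('n + 'n) set"
  let ?gg = "(std_gaussian :: (real^'n) measure) \<Otimes>\<^sub>M (std_gaussian :: (real^'n) measure)"
  have "indep_rvs (std_gaussian :: (real^('n + 'n)) measure) borel (mask_vec ?J) borel (mask_vec (- ?J))"
    unfolding indep_rvs_def std_gaussian_split by simp
  then have "indep_rvs ?gg borel (\<lambda>p. mask_vec ?J (vec_join (fst p) (snd p))) borel (\<lambda>p. mask_vec (- ?J) (vec_join (fst p) (snd p)))"
    unfolding std_gaussian_join[symmetric] by (subst (asm) indep_rvs_distr_iff) simp_all
  from prob_space.indep_rvs_compose[OF prob_space_pair[OF prob_space_std_gaussian prob_space_std_gaussian]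
      this measurable_vec_halves measurable_vec_halves]
  have "indep_rvs ?gg (borel \<Otimes>\<^sub>M borel) (\<lambda>p. vec_halves (mask_vec ?J (vec_join (fst p) (snd p))))
      (borel \<Otimes>\<^sub>M borel) (\<lambda>p. vec_halves (mask_vec (- ?J) (vec_join (fst p) (snd p))))" .
  moreover have "vec_halves (mask_vec ?J (vec_join x y)) = (mask_vec J x, mask_vec J y)"
    "vec_halves (mask_vec (- ?J) (vec_join x y)) = (mask_vec (- J) x, mask_vec (- J) y)" for x y :: "real^'n"
    by (auto simp: vec_halves_def vec_eq_iff mask_nth)
  ultimately show ?thesis by simp
qed

context innovation_pair
begin

text \<open>
  The two noises of this coupling have covariance \<open>D\<close>, and the second one is standard if
  \<open>R R\<^sup>T = I - D\<^sup>T D\<close>.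
\<close>

definition couple :: "real^('t \<times> 'd)^('t \<times> 'd) \<Rightarrow> real^('t \<times> 'd)^('t \<times> 'd) \<Rightarrow> ((real^('t \<times> 'd)) \<times> (real^('t \<times> 'd))) measure" where
  "couple D R = distr (std_gaussian \<Otimes>\<^sub>M std_gaussian) (borel \<Otimes>\<^sub>M borel)
     (\<lambda>p. (a + G *v fst p, b + H *v (transpose D *v fst p + R *v snd p)))"

text \<open>
  The block matrix with rows \<open>(G, 0)\<close> and \<open>(H D\<^sup>T, H R)\<close> is a factor of the covariance matrix.
\<close>

lemma gaussian_pair_eq_couple:
  assumes "R ** transpose R + transpose D ** D = mat 1"
  shows "gaussian_pair a b (block_2x2 (G ** transpose G) (G ** D ** transpose H)
      (H ** transpose D ** transpose G) (H ** transpose H)) = couple D R"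
proof -
  have 0: "transpose (0 :: real^('t \<times> 'd)^('t \<times> 'd)) = 0" "K ** (0 :: real^('t \<times> 'd)^('t \<times> 'd)) = 0"
    "(0 :: real^('t \<times> 'd)^('t \<times> 'd)) ** K = 0" for K :: "real^('t \<times> 'd)^('t \<times> 'd)"
    by (simp_all add: vec_eq_iff transpose_def matrix_matrix_mult_def)
  have "H ** transpose D ** (D ** transpose H) + H ** R ** (transpose R ** transpose H) = H ** (R ** transpose R + transpose D ** D) ** transpose H"
    by (simp add: matrix_mul_assoc matrix_add_ldistrib matrix_add_rdistrib add.commute)
  then have "H ** transpose D ** (D ** transpose H) + H ** R ** (transpose R ** transpose H) = H ** transpose H"
    by (simp add: assms)
  then have "block_2x2 G 0 (H ** transpose D) (H ** R) ** transpose (block_2x2 G 0 (H ** transpose D) (H ** R))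
    = block_2x2 (G ** transpose G) (G ** D ** transpose H) (H ** transpose D ** transpose G) (H ** transpose H)"
    by (simp add: transpose_block_2x2 block_2x2_mult 0 matrix_transpose_mul matrix_mul_assoc)
  from gaussian_pair_factor[OF this] show ?thesis
    by (simp add: couple_def matrix_vector_right_distrib matrix_vector_mul_assoc matrix_vector_mult_0)
qed

text \<open>
  As \<open>D\<close> and \<open>R\<close> do not mix times, past and future noises of the pair are functions of
  complementary coordinates of the driving vectors.
\<close>

lemma couple_in_Cpl_bc:
  assumes D: "same_time D" and R: "same_time R" and eq: "R ** transpose R + transpose D ** D = mat 1"
  shows "couple D R \<in> Cpl_bc X.law Y.law"
proof (rule Cpl_bcI)
  let ?gg = "(std_gaussian :: (real^('t \<times> 'd)) measure) \<Otimes>\<^sub>M (std_gaussian :: (real^('t \<times> 'd)) measure)"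
  let ?T = "\<lambda>p. (a + G *v fst p, b + H *v (transpose D *v fst p + R *v snd p))"
  have [measurable]: "?T \<in> ?gg \<rightarrow>\<^sub>M borel \<Otimes>\<^sub>M borel" by measurable
  interpret gg: prob_space ?gg by (intro prob_space_pair prob_space_std_gaussian)
  show "couple D R \<in> Cpl X.law Y.law"
  proof -
    have "prob_space (couple D R)"
      unfolding couple_def by (rule gg.prob_space_distr) simp
    moreover have "sets (couple D R) = sets (X.law \<Otimes>\<^sub>M Y.law)"
      unfolding couple_def by (simp cong: sets_pair_measure_cong)
    moreover have "distr (couple D R) X.law fst = X.law"
    proof -
      have "distr (couple D R) X.law fst = distr ?gg borel (\<lambda>p. a + G *v fst p)"
        unfolding couple_def by (subst distr_distr) (auto simp: o_def cong: distr_cong)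
      also have "\<dots> = distr (distr ?gg std_gaussian fst) borel (\<lambda>z. a + G *v z)"
        by (subst distr_distr) (simp_all add: o_def)
      also have "\<dots> = X.law"
        by (simp add: prob_space.distr_pair_fst[OF prob_space_std_gaussian] X.law_def)
      finally show ?thesis .
    qed
    moreover have "distr (couple D R) Y.law snd = Y.law"
    proof -
      have "distr (couple D R) Y.law snd = distr ?gg borel (\<lambda>p. b + H *v (transpose D *v fst p + R *v snd p))"
        unfolding couple_def by (subst distr_distr) (auto simp: o_def cong: distr_cong)
      also have "\<dots> = distr (distr ?gg borel (\<lambda>p. transpose D *v fst p + R *v snd p)) borel (\<lambda>z. b + H *v z)"
        by (subst distr_distr) (simp_all add: o_def)
      also have "\<dots> = Y.law"
        using eq by (subst std_gaussian_combine) (simp_all add: add.commute Y.law_def)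
      finally show ?thesis .
    qed
    ultimately show ?thesis by (simp add: Cpl_def)
  qed
  fix t
  let ?u = "\<lambda>J w. (mask_vec J (fst w), mask_vec J (transpose D *v fst w + R *v snd w))"
  have u: "?u J (mask_vec J (fst p), mask_vec J (snd p)) = (mask_vec J (fst p), mask_vec J (transpose D *v fst p + R *v snd p))"
    if "J = past t \<or> J = - past t" for J and p :: "(real^('t \<times> 'd)) \<times> (real^('t \<times> 'd))"
    using mask_same_time[OF same_time_transpose[OF D] that] mask_same_time[OF R that]
    by (simp add: mask_add)
  have "indep_rvs ?gg (borel \<Otimes>\<^sub>M borel) (\<lambda>p. ?u (past t) (mask_vec (past t) (fst p), mask_vec (past t) (snd p)))
      (borel \<Otimes>\<^sub>M borel) (\<lambda>p. ?u (- past t) (mask_vec (- past t) (fst p), mask_vec (- past t) (snd p)))"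
    by (rule gg.indep_rvs_compose[OF indep_past_future_pair_std_gaussian]) measurable
  then have "indep_rvs ?gg (borel \<Otimes>\<^sub>M borel) (\<lambda>p. (mask_vec (past t) (fst p), mask_vec (past t) (transpose D *v fst p + R *v snd p)))
      (borel \<Otimes>\<^sub>M borel) (\<lambda>p. (mask_vec (- past t) (fst p), mask_vec (- past t) (transpose D *v fst p + R *v snd p)))"
    by (simp only: u simp_thms)
  then show "indep_rvs (couple D R)
        (borel \<Otimes>\<^sub>M borel) (\<lambda>w. (mask_vec (past t) (X.noise (fst w)), mask_vec (past t) (Y.noise (snd w))))
        (borel \<Otimes>\<^sub>M borel) (\<lambda>w. (mask_vec (- past t) (X.noise (fst w)), mask_vec (- past t) (Y.noise (snd w))))"
    unfolding couple_def by (subst indep_rvs_distr_iff) simp_all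
qed

lemma couple_cov:
  "integral\<^sup>L (couple D R) (\<lambda>w. X.noise (fst w) $ p * Y.noise (snd w) $ q) = D $ p $ q"
proof -
  let ?gg = "(std_gaussian :: (real^('t \<times> 'd)) measure) \<Otimes>\<^sub>M (std_gaussian :: (real^('t \<times> 'd)) measure)"
  note cov = pair_std_gaussian_cov[where 'n = "'t \<times> 'd" and 'm = "'t \<times> 'd"]
  have "integral\<^sup>L (couple D R) (\<lambda>w. X.noise (fst w) $ p * Y.noise (snd w) $ q)
      = (LINT w|?gg. fst w $ p * (transpose D *v fst w + R *v snd w) $ q)"
    unfolding couple_def by (subst integral_distr) simp_all
  also have "\<dots> = integral\<^sup>L ?gg (\<lambda>w. (\<Sum>k\<in>UNIV. D $ k $ q * (fst w $ p * fst w $ k)) + (\<Sum>k\<in>UNIV. R $ q $ k * (fst w $ p * snd w $ k)))"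
    by (intro Bochner_Integration.integral_cong refl)
      (simp add: matrix_vector_mult_def transpose_def distrib_left sum_distrib_left mult.left_commute)
  also have "\<dots> = (\<Sum>k\<in>UNIV. D $ k $ q * (if p = k then 1 else 0)) + (\<Sum>k\<in>UNIV. R $ q $ k * 0)"
    by (subst Bochner_Integration.integral_add) (auto simp: cov intro!: Bochner_Integration.integrable_sum)
  also have "\<dots> = D $ p $ q"
    by (simp add: if_distrib cong: if_cong)
  finally show ?thesis .
qed

end

definition diag_matrix :: "('n::finite \<Rightarrow> real) \<Rightarrow> real^'n^'n" where
  "diag_matrix c = (\<chi> p q. if p = q then c p else 0)"

lemma diag_matrix_mult_vec: "diag_matrix c *v x = (\<chi> i. c i * x $ i)"
  by (simp add: diag_matrix_def matrix_vector_mult_def if_distrib[of "\<lambda>z. z * _"] vec_eq_iff cong: if_cong)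

lemma transpose_diag_matrix: "transpose (diag_matrix c) = diag_matrix c"
  by (auto simp: vec_eq_iff transpose_def diag_matrix_def)

lemma diag_matrix_mult: "diag_matrix c ** diag_matrix d = diag_matrix (\<lambda>p. c p * d p)"
  by (simp add: diag_matrix_def matrix_matrix_mult_def if_distrib[of "\<lambda>z. z * _"] vec_eq_iff cong: if_cong)

lemma diag_matrix_complement:
  assumes c: "\<And>p. \<bar>c p\<bar> \<le> 1"
  shows "diag_matrix (\<lambda>p. sqrt (1 - (c p)\<^sup>2)) ** transpose (diag_matrix (\<lambda>p. sqrt (1 - (c p)\<^sup>2)))
    + transpose (diag_matrix c) ** diag_matrix c = mat 1"
proof -
  have "(c p)\<^sup>2 \<le> 1" for p using c[of p] by (simp add: abs_square_le_1)
  then show ?thesis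
    by (simp add: transpose_diag_matrix diag_matrix_mult)
      (simp add: vec_eq_iff diag_matrix_def mat_def power2_eq_square[symmetric])
qed

lemma vec_plus_lambda: "(\<chi> i. f i) + (\<chi> i. g i) = (\<chi> i. f i + g i)"
  by (simp add: vec_eq_iff)

section \<open>Transport cost of bicausal couplings\<close>

lemma inner_matrix_sum:
  fixes K :: "real^'n::finite^'k::finite" and L :: "real^'m::finite^'k"
  shows "(K *v x) \<bullet> (L *v y) = (\<Sum>p\<in>UNIV. \<Sum>q\<in>UNIV. (transpose L ** K) $ q $ p * (x $ p * y $ q))"
proof -
  have "(K *v x) \<bullet> (L *v y) = (transpose L *v (K *v x)) \<bullet> y"
    by (simp add: transpose_matrix_vector dot_lmul_matrix)
  also have "\<dots> = (\<Sum>q\<in>UNIV. \<Sum>p\<in>UNIV. (transpose L ** K) $ q $ p * (x $ p * y $ q))"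
    unfolding matrix_vector_mul_assoc
    by (simp add: inner_vec_def matrix_vector_mult_def sum_distrib_right mult.assoc)
  finally show ?thesis by (subst sum.swap)
qed

lemma inner_matrix_sum1:
  fixes K :: "real^'n::finite^'k::finite"
  shows "v \<bullet> (K *v x) = (\<Sum>p\<in>UNIV. (transpose K *v v) $ p * x $ p)"
  unfolding transpose_matrix_vector dot_lmul_matrix[symmetric] by (simp add: inner_vec_def)

lemma (in innovation) integrable_norm_squared: "integrable law (\<lambda>x. x \<bullet> x)"
proof -
  have "x \<bullet> x = m \<bullet> m + 2 * (\<Sum>p\<in>UNIV. (transpose G *v m) $ p * noise x $ p)
      + (\<Sum>p\<in>UNIV. \<Sum>q\<in>UNIV. (transpose G ** G) $ q $ p * (noise x $ p * noise x $ q))" for x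
  proof -
    have "x \<bullet> x = (m + G *v noise x) \<bullet> (m + G *v noise x)" by simp
    also have "\<dots> = m \<bullet> m + 2 * (m \<bullet> (G *v noise x)) + (G *v noise x) \<bullet> (G *v noise x)"
      unfolding inner_add_left inner_add_right inner_commute[of "G *v noise x" m] by simp
    finally show ?thesis unfolding inner_matrix_sum unfolding inner_matrix_sum1 .
  qed
  then have *: "(\<lambda>x. x \<bullet> x) = (\<lambda>x. m \<bullet> m + 2 * (\<Sum>p\<in>UNIV. (transpose G *v m) $ p * noise x $ p)
      + (\<Sum>p\<in>UNIV. \<Sum>q\<in>UNIV. (transpose G ** G) $ q $ p * (noise x $ p * noise x $ q)))"
    by (rule ext)
  interpret prob_space law by (rule prob_space_law)
  show ?thesis
    unfolding * by (intro Bochner_Integration.integrable_add integrable_const integrable_mult_right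
        Bochner_Integration.integrable_sum law_moments)
qed

lemma Cpl_bc_imp_Cpl: "\<pi> \<in> Cpl_bc \<mu> \<nu> \<Longrightarrow> \<pi> \<in> Cpl \<mu> \<nu>"
  by (simp add: Cpl_bc_def)

text \<open>
  The situation after the rotations of the singular value decompositions have been absorbed into
  \<open>G\<close> and \<open>H\<close>: the singular values are listed by \<open>s\<close>.
\<close>

locale correlated_innovations = innovation_pair a b G G' H H'
  for a b :: "real^('t::{finite,linorder} \<times> 'd::finite)" and G G' H H' :: "real^('t \<times> 'd)^('t \<times> 'd)" +
  fixes s :: "'t \<times> 'd \<Rightarrow> real"
  assumes s_nonneg: "0 \<le> s p"
    and cross: "fst p = fst q \<Longrightarrow> (transpose H ** G) $ q $ p = (if p = q then s p else 0)"
begin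

definition corr :: "((real^('t \<times> 'd)) \<times> (real^('t \<times> 'd))) measure \<Rightarrow> 't \<times> 'd \<Rightarrow> real" where
  "corr \<pi> p = (LINT w|\<pi>. X.noise (fst w) $ p * Y.noise (snd w) $ p)"

definition base_cost :: real where
  "base_cost = (LINT x|X.law. x \<bullet> x) + (LINT y|Y.law. y \<bullet> y) - 2 * (a \<bullet> b)"

text \<open>
  Up to terms fixed by the marginals the cost is minus twice the expectation of
  \<open>(G \<epsilon>) \<bullet> (H \<eta>)\<close>, a bilinear form in the noises with matrix \<open>H\<^sup>T G\<close>.  Its entries at different
  times meet uncorrelated noises, and its diagonal blocks are diagonal with entries \<open>s\<close>.
\<close>

lemma transport_cost:
  assumes \<pi>: "\<pi> \<in> Cpl_bc X.law Y.law"
  shows "integrable \<pi> (\<lambda>w. (norm (fst w - snd w))\<^sup>2)"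
    and "(LINT w|\<pi>. (norm (fst w - snd w))\<^sup>2) = base_cost - 2 * (\<Sum>p\<in>UNIV. s p * corr \<pi> p)"
proof -
  have \<pi>': "\<pi> \<in> Cpl X.law Y.law" using \<pi> by (rule Cpl_bc_imp_Cpl)
  note C = Cpl_lawsD[OF \<pi>'] and mom = Cpl_moments[OF \<pi>']
  note [measurable_cong] = C(2)
  interpret prob_space \<pi> by fact
  let ?\<epsilon> = "\<lambda>w. X.noise (fst w)" and ?\<eta> = "\<lambda>w. Y.noise (snd w)"
  let ?lin = "\<lambda>w. a \<bullet> b + (\<Sum>q\<in>UNIV. (transpose H *v a) $ q * ?\<eta> w $ q) + (\<Sum>p\<in>UNIV. (transpose G *v b) $ p * ?\<epsilon> w $ p)"
  let ?bil = "\<lambda>w. \<Sum>p\<in>UNIV. \<Sum>q\<in>UNIV. (transpose H ** G) $ q $ p * (?\<epsilon> w $ p * ?\<eta> w $ q)"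
  have expand: "(norm (fst w - snd w))\<^sup>2 = fst w \<bullet> fst w + snd w \<bullet> snd w - 2 * (?lin w + ?bil w)" for w
  proof -
    have "(norm (fst w - snd w))\<^sup>2 = fst w \<bullet> fst w + snd w \<bullet> snd w - 2 * (fst w \<bullet> snd w)"
      by (simp add: power2_norm_eq_inner inner_diff_left inner_diff_right inner_commute)
    also have "fst w \<bullet> snd w = (a + G *v ?\<epsilon> w) \<bullet> (b + H *v ?\<eta> w)"
      by simp
    also have "\<dots> = a \<bullet> b + a \<bullet> (H *v ?\<eta> w) + b \<bullet> (G *v ?\<epsilon> w) + (G *v ?\<epsilon> w) \<bullet> (H *v ?\<eta> w)"
      by (simp only: inner_add_left inner_add_right inner_commute[of _ b])
    finally show ?thesis unfolding inner_matrix_sum unfolding inner_matrix_sum1 .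
  qed
  have xx: "integrable \<pi> (\<lambda>w. fst w \<bullet> fst w)" "(LINT w|\<pi>. fst w \<bullet> fst w) = (LINT x|X.law. x \<bullet> x)"
    using X.integrable_norm_squared unfolding C(4)[symmetric]
    by (subst (asm) integrable_distr_eq, simp_all, subst integral_distr, simp_all)
  have yy: "integrable \<pi> (\<lambda>w. snd w \<bullet> snd w)" "(LINT w|\<pi>. snd w \<bullet> snd w) = (LINT y|Y.law. y \<bullet> y)"
    using Y.integrable_norm_squared unfolding C(5)[symmetric]
    by (subst (asm) integrable_distr_eq, simp_all, subst integral_distr, simp_all)
  have lin: "integrable \<pi> ?lin" "integral\<^sup>L \<pi> ?lin = a \<bullet> b"
  proof -
    have 1: "integrable \<pi> (\<lambda>w. \<Sum>q\<in>UNIV. (transpose H *v a) $ q * ?\<eta> w $ q)"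
      and 2: "integrable \<pi> (\<lambda>w. \<Sum>p\<in>UNIV. (transpose G *v b) $ p * ?\<epsilon> w $ p)"
      by (intro Bochner_Integration.integrable_sum integrable_mult_right mom)+
    then show "integrable \<pi> ?lin" by simp
    have "integral\<^sup>L \<pi> ?lin = a \<bullet> b + integral\<^sup>L \<pi> (\<lambda>w. \<Sum>q\<in>UNIV. (transpose H *v a) $ q * ?\<eta> w $ q)
        + integral\<^sup>L \<pi> (\<lambda>w. \<Sum>p\<in>UNIV. (transpose G *v b) $ p * ?\<epsilon> w $ p)"
      using 1 2 by (simp add: prob_space)
    also have "\<dots> = a \<bullet> b"
      by (simp add: mom)
    finally show "integral\<^sup>L \<pi> ?lin = a \<bullet> b" .
  qed
  have bil: "integrable \<pi> ?bil" "integral\<^sup>L \<pi> ?bil = (\<Sum>p\<in>UNIV. s p * corr \<pi> p)"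
  proof -
    show "integrable \<pi> ?bil"
      by (intro Bochner_Integration.integrable_sum integrable_mult_right mom)
    have "integral\<^sup>L \<pi> ?bil = (\<Sum>p\<in>UNIV. \<Sum>q\<in>UNIV. (transpose H ** G) $ q $ p * (LINT w|\<pi>. ?\<epsilon> w $ p * ?\<eta> w $ q))"
      by (simp add: mom Bochner_Integration.integral_sum)
    also have "\<dots> = (\<Sum>p\<in>UNIV. \<Sum>q\<in>UNIV. if p = q then s p * corr \<pi> p else 0)"
    proof (intro sum.cong refl)
      fix p q
      show "(transpose H ** G) $ q $ p * (LINT w|\<pi>. ?\<epsilon> w $ p * ?\<eta> w $ q) = (if p = q then s p * corr \<pi> p else 0)"
      proof (cases "fst p = fst q")
        case True
        then show ?thesis by (simp add: cross corr_def)
      next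
        case False
        then show ?thesis by (auto simp: Cpl_bc_uncorrelated[OF \<pi>])
      qed
    qed
    finally show "integral\<^sup>L \<pi> ?bil = (\<Sum>p\<in>UNIV. s p * corr \<pi> p)" by simp
  qed
  define q where "q w = ?lin w + ?bil w" for w
  have q: "integrable \<pi> q" "integral\<^sup>L \<pi> q = a \<bullet> b + (\<Sum>p\<in>UNIV. s p * corr \<pi> p)"
    unfolding q_def using Bochner_Integration.integrable_add[OF lin(1) bil(1)]
      Bochner_Integration.integral_add[OF lin(1) bil(1)] lin(2) bil(2) by simp_all
  show "integrable \<pi> (\<lambda>w. (norm (fst w - snd w))\<^sup>2)"
    and "(LINT w|\<pi>. (norm (fst w - snd w))\<^sup>2) = base_cost - 2 * (\<Sum>p\<in>UNIV. s p * corr \<pi> p)"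
    unfolding expand q_def[symmetric] using xx yy q by (simp_all add: base_cost_def)
qed

lemma AW_cost_eq:
  assumes \<pi>: "\<pi> \<in> Cpl_bc X.law Y.law"
  shows "AW_cost lam X.law Y.law \<pi> =
    ereal (base_cost - 2 * (\<Sum>p\<in>UNIV. s p * corr \<pi> p)) + ereal lam * KL \<pi> (X.law \<Otimes>\<^sub>M Y.law)"
proof -
  have "(\<integral>\<^sup>+p. ennreal ((norm (fst p - snd p))\<^sup>2) \<partial>\<pi>) = ennreal ((LINT w|\<pi>. (norm (fst w - snd w))\<^sup>2))"
    by (rule nn_integral_eq_integral[OF transport_cost(1)[OF \<pi>]]) simp
  then have "enn2ereal (\<integral>\<^sup>+p. ennreal ((norm (fst p - snd p))\<^sup>2) \<partial>\<pi>) = ereal ((LINT w|\<pi>. (norm (fst w - snd w))\<^sup>2))"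
    by (simp add: enn2ereal_ennreal)
  then show ?thesis
    by (simp add: AW_cost_def transport_cost(2)[OF \<pi>])
qed

section \<open>The entropic problem\<close>

lemma pair_law_eq: "X.law \<Otimes>\<^sub>M Y.law = distr (std_gaussian \<Otimes>\<^sub>M std_gaussian) (borel \<Otimes>\<^sub>M borel)
    (\<lambda>p. (a + G *v fst p, b + H *v snd p))"
proof -
  have "sigma_finite_measure (distr std_gaussian borel (\<lambda>z. b + H *v z))"
    using prob_space_imp_sigma_finite[OF Y.prob_space_law] by (simp add: Y.law_def)
  then show ?thesis
    unfolding X.law_def Y.law_def by (subst pair_measure_distr) (simp_all add: case_prod_beta')
qed

definition tilt :: "('t \<times> 'd \<Rightarrow> real) \<Rightarrow> (real^('t \<times> 'd)) \<times> (real^('t \<times> 'd)) \<Rightarrow> real" where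
  "tilt c w = (\<Prod>p\<in>UNIV. corr_density (c p) (X.noise (fst w) $ p) (Y.noise (snd w) $ p))"

definition diag_couple :: "('t \<times> 'd \<Rightarrow> real) \<Rightarrow> ((real^('t \<times> 'd)) \<times> (real^('t \<times> 'd))) measure" where
  "diag_couple c = couple (diag_matrix c) (diag_matrix (\<lambda>p. sqrt (1 - (c p)\<^sup>2)))"

lemma measurable_tilt [measurable]: "tilt c \<in> borel_measurable (borel \<Otimes>\<^sub>M borel)"
  unfolding tilt_def corr_density_def by measurable

lemma diag_couple_eq_density:
  assumes c: "\<And>p. \<bar>c p\<bar> < 1"
  shows "diag_couple c = density (X.law \<Otimes>\<^sub>M Y.law) (tilt c)"
proof -
  let ?gg = "(std_gaussian :: (real^('t \<times> 'd)) measure) \<Otimes>\<^sub>M (std_gaussian :: (real^('t \<times> 'd)) measure)"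
  let ?\<Phi> = "\<lambda>p. (a + G *v fst p, b + H *v snd p)"
  let ?T = "\<lambda>p :: (real^('t \<times> 'd)) \<times> (real^('t \<times> 'd)). (fst p, \<chi> i. c i * fst p $ i + sqrt (1 - (c i)\<^sup>2) * snd p $ i)"
  have s: "sets ?gg = sets (borel \<Otimes>\<^sub>M borel)"
    by (rule sets_pair_measure_cong) simp_all
  have T: "?T \<in> ?gg \<rightarrow>\<^sub>M borel \<Otimes>\<^sub>M borel" by measurable
  have "diag_couple c = distr (distr ?gg (borel \<Otimes>\<^sub>M borel) ?T) (borel \<Otimes>\<^sub>M borel) ?\<Phi>"
    unfolding diag_couple_def couple_def transpose_diag_matrix diag_matrix_mult_vec
    by (subst distr_distr[OF _ T]) (simp_all add: o_def vec_plus_lambda)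
  also have "distr ?gg (borel \<Otimes>\<^sub>M borel) ?T = density ?gg (\<lambda>p. tilt c (?\<Phi> p))"
    unfolding tilt_def by (simp add: distr_correlated_std_gaussian[OF c])
  also have "distr (density ?gg (\<lambda>p. tilt c (?\<Phi> p))) (borel \<Otimes>\<^sub>M borel) ?\<Phi>
      = density (distr ?gg (borel \<Otimes>\<^sub>M borel) ?\<Phi>) (tilt c)"
    by (rule density_distr[symmetric]) simp_all
  finally show ?thesis
    by (simp only: pair_law_eq)
qed

lemma diag_couple_bc:
  assumes c: "\<And>p. \<bar>c p\<bar> \<le> 1"
  shows "diag_couple c \<in> Cpl_bc X.law Y.law"
  unfolding diag_couple_def
  by (rule couple_in_Cpl_bc[OF _ _ diag_matrix_complement[OF c]]) (auto simp: same_time_def diag_matrix_def)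

lemma diag_couple_corr: "corr (diag_couple c) p = c p"
  by (simp add: corr_def diag_couple_def couple_cov diag_matrix_def)

text \<open>
  The part of the expectation of \<open>ln (tilt c)\<close> that is the same for all couplings.
\<close>

definition tilt_entropy :: "('t \<times> 'd \<Rightarrow> real) \<Rightarrow> real" where
  "tilt_entropy c = (\<Sum>p\<in>UNIV. - (c p)\<^sup>2 / (1 - (c p)\<^sup>2) - ln (1 - (c p)\<^sup>2) / 2)"

lemma expectation_ln_tilt:
  assumes c: "\<And>p. \<bar>c p\<bar> < 1" and \<pi>: "\<pi> \<in> Cpl X.law Y.law"
  shows "integrable \<pi> (\<lambda>w. ln (tilt c w))"
    and "(LINT w|\<pi>. ln (tilt c w)) = tilt_entropy c + (\<Sum>p\<in>UNIV. c p / (1 - (c p)\<^sup>2) * corr \<pi> p)"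
proof -
  note C = Cpl_lawsD[OF \<pi>] and mom = Cpl_moments[OF \<pi>]
  interpret prob_space \<pi> by fact
  let ?\<epsilon> = "\<lambda>w. X.noise (fst w)" and ?\<eta> = "\<lambda>w. Y.noise (snd w)"
  define v where "v p = 1 - (c p)\<^sup>2" for p
  have v: "0 < v p" for p using c[of p] by (simp add: v_def abs_square_less_1)
  define f where "f p w = - ((c p)\<^sup>2 / (2 * v p)) * (?\<epsilon> w $ p * ?\<epsilon> w $ p) + c p / v p * (?\<epsilon> w $ p * ?\<eta> w $ p)
      + (- ((c p)\<^sup>2 / (2 * v p))) * (?\<eta> w $ p * ?\<eta> w $ p) + (- ln (v p) / 2)" for p w
  have lnc: "ln (corr_density (c p) (?\<epsilon> w $ p) (?\<eta> w $ p)) = f p w" for p w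
    unfolding corr_density_def f_def v_def[symmetric] using v[of p]
    by (simp add: ln_div ln_sqrt) (simp add: field_simps power2_eq_square)
  have ln: "ln (tilt c w) = (\<Sum>p\<in>UNIV. f p w)" for w
    unfolding tilt_def lnc[symmetric]
    by (intro ln_prod finite) (metis corr_density_pos[OF c] less_irrefl)
  have int: "integrable \<pi> (f p)" for p
    unfolding f_def by (intro Bochner_Integration.integrable_add integrable_mult_right integrable_const mom)
  have "integral\<^sup>L \<pi> (f p) = - ((c p)\<^sup>2 / (2 * v p)) * 1 + c p / v p * corr \<pi> p + (- ((c p)\<^sup>2 / (2 * v p))) * 1 + (- ln (v p) / 2)" for p
  proof -
    have lin: "(LINT w|\<pi>. k1 * f1 w + k2 * f2 w + k3 * f3 w + k4)
        = k1 * integral\<^sup>L \<pi> f1 + k2 * integral\<^sup>L \<pi> f2 + k3 * integral\<^sup>L \<pi> f3 + k4"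
      if "integrable \<pi> f1" "integrable \<pi> f2" "integrable \<pi> f3" for f1 f2 f3 and k1 k2 k3 k4 :: real
      using that by (simp add: prob_space)
    show ?thesis
      unfolding f_def by (subst lin) (simp_all add: mom corr_def)
  qed
  note I = this
  have E: "integral\<^sup>L \<pi> (f p) = (- (c p)\<^sup>2 / (1 - (c p)\<^sup>2) - ln (1 - (c p)\<^sup>2) / 2) + c p / (1 - (c p)\<^sup>2) * corr \<pi> p" for p
  proof -
    have "(c p)\<^sup>2 / (2 * v p) + (c p)\<^sup>2 / (2 * v p) = (c p)\<^sup>2 / v p"
      by (simp add: field_simps)
    then show ?thesis
      unfolding I v_def[symmetric] by simp
  qed
  show "integrable \<pi> (\<lambda>w. ln (tilt c w))"
    unfolding ln using int by (rule Bochner_Integration.integrable_sum)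
  show "(LINT w|\<pi>. ln (tilt c w)) = tilt_entropy c + (\<Sum>p\<in>UNIV. c p / (1 - (c p)\<^sup>2) * corr \<pi> p)"
    unfolding ln by (subst Bochner_Integration.integral_sum[OF int]) (simp add: E sum.distrib tilt_entropy_def)
qed

text \<open>
  The equation for \<open>c\<close> says that \<open>lam\<close> times the coefficient of \<open>corr \<pi> p\<close> in the expectation
  of \<open>ln (tilt c)\<close> equals \<open>2 s p\<close>.  The correlations therefore drop out of the cost of a bicausal
  coupling, which becomes a constant plus \<open>lam\<close> times the excess of the relative entropy over
  that expectation.
\<close>

theorem entropic_unique_optimizer:
  assumes lam: "0 < lam" and c: "\<And>p. \<bar>c p\<bar> < 1" and crit: "\<And>p. lam * c p = 2 * s p * (1 - (c p)\<^sup>2)"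
  shows "is_unique_optimizer lam X.law Y.law (diag_couple c)"
proof -
  let ?Q = "X.law \<Otimes>\<^sub>M Y.law"
  define v where "v = base_cost + lam * tilt_entropy c"
  have Q: "prob_space ?Q"
    by (intro prob_space_pair X.prob_space_law Y.prob_space_law)
  have sQ: "sets ?Q = sets (borel \<Otimes>\<^sub>M borel)"
    by (rule sets_pair_measure_cong) simp_all
  have mt: "tilt c \<in> borel_measurable ?Q"
    using measurable_tilt measurable_cong_sets[OF sQ refl] by blast
  have pos: "0 < tilt c w" for w
    unfolding tilt_def using corr_density_pos[OF c] by (intro prod_pos) auto
  have opt: "diag_couple c \<in> Cpl_bc X.law Y.law"
    using c by (intro diag_couple_bc less_imp_le)
  have E: "lam * (LINT w|\<pi>. ln (tilt c w)) = lam * tilt_entropy c + 2 * (\<Sum>p\<in>UNIV. s p * corr \<pi> p)"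
    if "\<pi> \<in> Cpl_bc X.law Y.law" for \<pi>
  proof -
    have "\<pi> \<in> Cpl X.law Y.law" using that by (rule Cpl_bc_imp_Cpl)
    note E = expectation_ln_tilt(2)[OF c this]
    have "lam * (c p / (1 - (c p)\<^sup>2) * corr \<pi> p) = 2 * (s p * corr \<pi> p)" for p
    proof -
      have "1 - (c p)\<^sup>2 \<noteq> 0" using c[of p] by (metis abs_square_less_1 diff_gt_0_iff_gt less_irrefl)
      then have "lam * c p / (1 - (c p)\<^sup>2) = 2 * s p" by (simp add: crit)
      then show ?thesis by (metis (no_types, lifting) mult.assoc times_divide_eq_right)
    qed
    then show ?thesis
      unfolding E by (simp add: distrib_left sum_distrib_left)
  qed
  have cost: "AW_cost lam X.law Y.law \<pi> = ereal (v - lam * (LINT w|\<pi>. ln (tilt c w))) + ereal lam * KL \<pi> ?Q"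
    if "\<pi> \<in> Cpl_bc X.law Y.law" for \<pi>
    using E[OF that] by (simp add: AW_cost_eq[OF that] v_def)
  have P\<pi>: "prob_space \<pi>" "sets \<pi> = sets ?Q" "integrable \<pi> (\<lambda>w. ln (tilt c w))" if "\<pi> \<in> Cpl_bc X.law Y.law" for \<pi>
    using Cpl_bc_imp_Cpl[OF that] expectation_ln_tilt(1)[OF c, of \<pi>] by (auto simp: Cpl_def)
  have tiltp: "prob_space (density ?Q (tilt c))"
    using P\<pi>(1)[OF opt] by (simp add: diag_couple_eq_density[OF c])
  have "KL (diag_couple c) ?Q = ereal (integral\<^sup>L (diag_couple c) (\<lambda>w. ln (tilt c w)))"
    using KL_density_eq[OF Q mt pos] P\<pi>(3)[OF opt] by (simp add: diag_couple_eq_density[OF c])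
  then have val: "AW_cost lam X.law Y.law (diag_couple c) = ereal v"
    by (simp add: cost[OF opt])
  have lower: "ereal v \<le> AW_cost lam X.law Y.law \<pi> \<and> (AW_cost lam X.law Y.law \<pi> = ereal v \<longrightarrow> \<pi> = diag_couple c)"
    if \<pi>: "\<pi> \<in> Cpl_bc X.law Y.law" for \<pi>
  proof -
    note T = KL_tilt[OF Q mt pos tiltp P\<pi>[OF \<pi>]]
    show ?thesis
    proof (cases "KL \<pi> ?Q")
      case (real k)
      have k: "(LINT w|\<pi>. ln (tilt c w)) \<le> k" using T(1) real by simp
      have "\<pi> = diag_couple c" if "lam * k = lam * (LINT w|\<pi>. ln (tilt c w))"
        using that lam T(2) real by (simp add: diag_couple_eq_density[OF c])
      then show ?thesis
        using k lam by (auto simp: cost[OF \<pi>] real mult_left_mono)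
    next
      case PInf
      then show ?thesis using lam by (simp add: cost[OF \<pi>])
    next
      case MInf
      then show ?thesis using T(1) by simp
    qed
  qed
  have "AW_sq lam X.law Y.law = ereal v"
    unfolding AW_sq_def
  proof (rule antisym)
    show "(INF \<pi>\<in>Cpl_bc X.law Y.law. AW_cost lam X.law Y.law \<pi>) \<le> ereal v"
      by (rule INF_lower2[OF opt]) (simp add: val)
    show "ereal v \<le> (INF \<pi>\<in>Cpl_bc X.law Y.law. AW_cost lam X.law Y.law \<pi>)"
      using lower by (intro INF_greatest) blast
  qed
  then show ?thesis
    unfolding is_unique_optimizer_def is_optimizer_def using opt val lower by metis
qed

section \<open>The problem without entropy\<close>

lemma Cpl_square_distance:
  assumes \<pi>: "\<pi> \<in> Cpl X.law Y.law"
  shows "integrable \<pi> (\<lambda>w. (X.noise (fst w) $ p - Y.noise (snd w) $ p)\<^sup>2)"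
    and "(LINT w|\<pi>. (X.noise (fst w) $ p - Y.noise (snd w) $ p)\<^sup>2) = 2 - 2 * corr \<pi> p"
proof -
  note mom = Cpl_moments[OF \<pi>]
  have eq: "(x - y)\<^sup>2 = x * x + y * y - 2 * (x * y)" for x y :: real
    by (simp add: power2_eq_square algebra_simps)
  show "integrable \<pi> (\<lambda>w. (X.noise (fst w) $ p - Y.noise (snd w) $ p)\<^sup>2)"
    "(LINT w|\<pi>. (X.noise (fst w) $ p - Y.noise (snd w) $ p)\<^sup>2) = 2 - 2 * corr \<pi> p"
    unfolding eq using mom(1,2,3)[of p p] by (simp_all add: mom corr_def)
qed

lemma corr_le_1:
  assumes "\<pi> \<in> Cpl X.law Y.law"
  shows "corr \<pi> p \<le> 1"
proof -
  have "0 \<le> (LINT w|\<pi>. (X.noise (fst w) $ p - Y.noise (snd w) $ p)\<^sup>2)"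
    by (rule integral_nonneg_AE) simp
  then show ?thesis
    by (simp add: Cpl_square_distance(2)[OF assms])
qed

text \<open>
  Each term \<open>s p * corr \<pi> p\<close> is at most \<open>s p\<close>, and the synchronous coupling attains all these
  bounds at once.
\<close>

theorem optimizer_iff:
  "is_optimizer 0 X.law Y.law \<pi> \<longleftrightarrow> \<pi> \<in> Cpl_bc X.law Y.law \<and> (\<forall>p. s p \<noteq> 0 \<longrightarrow> corr \<pi> p = 1)"
proof -
  have cost: "AW_cost 0 X.law Y.law \<pi> = ereal (base_cost - 2 * (\<Sum>p\<in>UNIV. s p * corr \<pi> p))"
    if "\<pi> \<in> Cpl_bc X.law Y.law" for \<pi>
    using AW_cost_eq[OF that, of 0] by (simp add: zero_ereal_def[symmetric])
  have le: "s p * corr \<pi> p \<le> s p" if "\<pi> \<in> Cpl_bc X.law Y.law" for \<pi> p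
    using corr_le_1[OF Cpl_bc_imp_Cpl[OF that], of p] s_nonneg[of p] mult_left_mono[of "corr \<pi> p" 1 "s p"] by simp
  have opt: "diag_couple (\<lambda>_. 1) \<in> Cpl_bc X.law Y.law"
    by (rule diag_couple_bc) simp
  have "AW_sq 0 X.law Y.law = ereal (base_cost - 2 * (\<Sum>p\<in>UNIV. s p))"
    unfolding AW_sq_def
  proof (rule antisym)
    show "(INF \<pi>\<in>Cpl_bc X.law Y.law. AW_cost 0 X.law Y.law \<pi>) \<le> ereal (base_cost - 2 * (\<Sum>p\<in>UNIV. s p))"
      by (rule INF_lower2[OF opt]) (simp add: cost[OF opt] diag_couple_corr)
    show "ereal (base_cost - 2 * (\<Sum>p\<in>UNIV. s p)) \<le> (INF \<pi>\<in>Cpl_bc X.law Y.law. AW_cost 0 X.law Y.law \<pi>)"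
      by (rule INF_greatest) (simp add: cost sum_mono le)
  qed
  moreover have "(\<Sum>p\<in>UNIV. s p * corr \<pi> p) = (\<Sum>p\<in>UNIV. s p) \<longleftrightarrow> (\<forall>p. s p \<noteq> 0 \<longrightarrow> corr \<pi> p = 1)"
    if "\<pi> \<in> Cpl_bc X.law Y.law"
  proof -
    have "(\<Sum>p\<in>UNIV. s p * corr \<pi> p) = (\<Sum>p\<in>UNIV. s p) \<longleftrightarrow> (\<Sum>p\<in>UNIV. s p - s p * corr \<pi> p) = 0"
      by (auto simp: sum_subtractf)
    also have "\<dots> \<longleftrightarrow> (\<forall>p\<in>UNIV. s p - s p * corr \<pi> p = 0)"
      by (rule sum_nonneg_eq_0_iff) (simp_all add: le[OF that])
    finally show ?thesis by auto
  qed
  ultimately show ?thesis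
    by (auto simp: is_optimizer_def cost)
qed

text \<open>
  Unit variances and correlation 1 make the expected squared difference of the noises vanish.
\<close>

lemma synchronous_if_corr_1:
  assumes \<pi>: "\<pi> \<in> Cpl X.law Y.law" and 1: "\<And>p. corr \<pi> p = 1"
  shows "\<pi> = distr X.law (borel \<Otimes>\<^sub>M borel) (\<lambda>x. (x, b + H *v X.noise x))"
proof -
  note C = Cpl_lawsD[OF \<pi>]
  note [measurable_cong] = C(2)
  have "AE w in \<pi>. (X.noise (fst w) $ p - Y.noise (snd w) $ p)\<^sup>2 = 0" for p
    using Cpl_square_distance[OF \<pi>, of p] 1
    by (subst integral_nonneg_eq_0_iff_AE[symmetric]) auto
  then have "AE w in \<pi>. \<forall>p. X.noise (fst w) $ p = Y.noise (snd w) $ p"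
    by (subst AE_all_countable) simp
  then have ae: "AE w in \<pi>. w = (fst w, b + H *v X.noise (fst w))"
  proof eventually_elim
    fix w assume "\<forall>p. X.noise (fst w) $ p = Y.noise (snd w) $ p"
    then have "X.noise (fst w) = Y.noise (snd w)" by (simp add: vec_eq_iff)
    then show "w = (fst w, b + H *v X.noise (fst w))" by (simp add: prod_eq_iff)
  qed
  have "\<pi> = distr \<pi> (borel \<Otimes>\<^sub>M borel) (\<lambda>w. w)"
    by (rule distr_id2[symmetric]) (simp add: C)
  also have "\<dots> = distr \<pi> (borel \<Otimes>\<^sub>M borel) (\<lambda>w. (fst w, b + H *v X.noise (fst w)))"
    by (rule distr_cong_AE[OF refl refl ae]) (simp_all add: measurable_ident_sets[OF C(2)])
  also have "\<dots> = distr X.law (borel \<Otimes>\<^sub>M borel) (\<lambda>x. (x, b + H *v X.noise x))"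
    unfolding C(4)[symmetric] by (subst distr_distr) (simp_all add: o_def)
  finally show ?thesis .
qed

theorem unique_optimizer:
  assumes s: "\<And>p. s p \<noteq> 0" and opt: "is_optimizer 0 X.law Y.law \<pi>"
  shows "is_unique_optimizer 0 X.law Y.law \<pi>"
proof -
  have sync: "\<rho> = distr X.law (borel \<Otimes>\<^sub>M borel) (\<lambda>x. (x, b + H *v X.noise x))" if "is_optimizer 0 X.law Y.law \<rho>" for \<rho>
    using that s unfolding optimizer_iff
    by (intro synchronous_if_corr_1) (blast intro: Cpl_bc_imp_Cpl)+
  show ?thesis
    unfolding is_unique_optimizer_def
  proof (intro conjI allI impI opt)
    fix \<rho> assume "is_optimizer 0 X.law Y.law \<rho>"
    then show "\<rho> = \<pi>" using sync[of \<rho>] sync[OF opt] by simp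
  qed
qed

end

section \<open>Block diagonal matrices\<close>

lemma sum_pairs: "(\<Sum>r\<in>(UNIV :: ('a::finite \<times> 'b::finite) set). f r) = (\<Sum>t\<in>UNIV. \<Sum>i\<in>UNIV. f (t, i))"
  by (simp add: sum.cartesian_product)

lemma block_diag_mult_left: "(block_diag K ** X) $ p $ q = (\<Sum>k\<in>UNIV. K (fst p) $ snd p $ k * X $ (fst p, k) $ q)"
proof -
  have "(block_diag K ** X) $ p $ q = (\<Sum>t\<in>UNIV. \<Sum>k\<in>UNIV. (if fst p = t then K (fst p) $ snd p $ k else 0) * X $ (t, k) $ q)"
    unfolding matrix_matrix_mult_def vec_lambda_beta sum_pairs
    by (intro sum.cong refl) (simp add: block_diag_def)
  also have "\<dots> = (\<Sum>t\<in>UNIV. if fst p = t then \<Sum>k\<in>UNIV. K (fst p) $ snd p $ k * X $ (t, k) $ q else 0)"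
    by (intro sum.cong) auto
  finally show ?thesis by simp
qed

lemma transpose_block_diag: "transpose (block_diag K) = block_diag (\<lambda>t. transpose (K t))"
  by (auto simp: vec_eq_iff transpose_def block_diag_def)

lemma block_diag_mult_right: "(X ** block_diag K) $ p $ q = (\<Sum>k\<in>UNIV. X $ p $ (fst q, k) * K (fst q) $ k $ snd q)"
proof -
  have "(X ** block_diag K) $ p $ q = transpose (X ** block_diag K) $ q $ p"
    by (simp add: transpose_def)
  also have "\<dots> = (\<Sum>k\<in>UNIV. X $ p $ (fst q, k) * K (fst q) $ k $ snd q)"
    unfolding matrix_transpose_mul transpose_block_diag block_diag_mult_left
    by (simp add: transpose_def mult.commute)
  finally show ?thesis .
qed

lemma block_diag_mult: "block_diag K ** block_diag K' = block_diag (\<lambda>t. K t ** K' t)"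
proof -
  have "(block_diag K ** block_diag K') $ p $ q = block_diag (\<lambda>t. K t ** K' t) $ p $ q" for p q
    unfolding block_diag_mult_left by (auto simp: block_diag_def matrix_matrix_mult_def)
  then show ?thesis by (simp add: vec_eq_iff)
qed

lemma block_diag_add: "block_diag K + block_diag K' = block_diag (\<lambda>t. K t + K' t)"
  by (auto simp: vec_eq_iff block_diag_def)

lemma block_diag_mat_1: "block_diag (\<lambda>_. mat 1) = mat 1"
  by (auto simp: vec_eq_iff block_diag_def mat_def prod_eq_iff)

lemma block_of_block_diag_mult:
  "block (block_diag U ** X ** block_diag V) t t' = U t ** block X t t' ** V t'"
proof -
  have "block (block_diag U ** X ** block_diag V) t t' $ i $ j = (U t ** block X t t' ** V t') $ i $ j" for i j
    unfolding block_def vec_lambda_beta block_diag_mult_right block_diag_mult_left fst_conv snd_conv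
    by (simp add: matrix_matrix_mult_def)
  then show ?thesis by (simp add: vec_eq_iff)
qed

lemma same_time_block_diag: "same_time (block_diag K)"
  by (simp add: same_time_def block_diag_def)

lemma orthogonal_block_diag:
  assumes "\<And>t. orthogonal_matrix (V t)"
  shows "block_diag V ** transpose (block_diag V) = mat 1" "transpose (block_diag V) ** block_diag V = mat 1"
  using assms by (simp_all add: transpose_block_diag block_diag_mult orthogonal_matrix_def block_diag_mat_1)

lemma contraction_iff: "contraction K \<longleftrightarrow> (\<forall>x. norm (K *v x) \<le> norm x)"
proof
  assume K: "contraction K"
  show "\<forall>x. norm (K *v x) \<le> norm x"
  proof
    fix x
    have "norm (K *v x) \<le> onorm ((*v) K) * norm x"
      by (rule onorm[OF matrix_vector_mul_bounded_linear])
    also have "\<dots> \<le> 1 * norm x"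
      using K by (intro mult_right_mono) (simp_all add: contraction_def)
    finally show "norm (K *v x) \<le> norm x" by simp
  qed
next
  assume "\<forall>x. norm (K *v x) \<le> norm x"
  then show "contraction K"
    unfolding contraction_def by (intro onorm_bound) simp_all
qed

text \<open>
  The matrix \<open>I - K\<^sup>T K\<close> is positive semidefinite because \<open>K\<close> does not increase norms.
\<close>

lemma contraction_complement:
  fixes K :: "real^'n::finite^'n"
  assumes "contraction K"
  obtains R :: "real^'n^'n" where "R ** transpose R + transpose K ** K = mat 1"
proof -
  have "transpose (mat 1 - transpose K ** K) = mat 1 - transpose K ** K"
  proof -
    have "transpose (transpose K ** K) = transpose K ** K"
      by (simp add: matrix_transpose_mul)
    then show ?thesis
      by (simp add: vec_eq_iff transpose_def mat_def)
  qed
  moreover have "0 \<le> x \<bullet> ((mat 1 - transpose K ** K) *v x)" for x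
  proof -
    have "x \<bullet> (transpose K *v (K *v x)) = (K *v x) \<bullet> (K *v x)"
      by (simp add: transpose_matrix_vector dot_lmul_matrix[symmetric] inner_commute)
    moreover have "(norm (K *v x))\<^sup>2 \<le> (norm x)\<^sup>2"
      using assms by (intro power_mono) (auto simp: contraction_iff)
    ultimately show ?thesis
      by (simp add: matrix_vector_mult_diff_rdistrib inner_diff_right matrix_vector_mul_assoc[symmetric] power2_norm_eq_inner)
  qed
  ultimately have "pos_semidef (mat 1 - transpose K ** K)"
    by (simp add: pos_semidef_def)
  then obtain R :: "real^'n^'n" where "R ** transpose R = mat 1 - transpose K ** K"
    by (rule pos_semidef_factor)
  then show ?thesis by (intro that[of R]) simp
qed

lemma block_contraction_complement:
  fixes D :: "'t::finite \<Rightarrow> real^'d::finite^'d"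
  assumes "\<And>t. contraction (D t)"
  obtains R where "same_time R" "R ** transpose R + transpose (block_diag D) ** block_diag D = mat 1"
proof -
  have "\<forall>t. \<exists>R :: real^'d^'d. R ** transpose R + transpose (D t) ** D t = mat 1"
    using contraction_complement[OF assms] by metis
  then obtain R :: "'t \<Rightarrow> real^'d^'d" where R: "\<And>t. R t ** transpose (R t) + transpose (D t) ** D t = mat 1"
    by metis
  show ?thesis
    by (rule that[of "block_diag R"])
      (simp_all add: same_time_block_diag transpose_block_diag block_diag_mult block_diag_add R block_diag_mat_1)
qed

section \<open>Gaussian optimizers\<close>

lemma integral_double_sum:
  fixes f :: "'i::finite \<Rightarrow> 'j::finite \<Rightarrow> 'a \<Rightarrow> real"
  assumes "\<And>i j. integrable M (f i j)"
  shows "(LINT x|M. (\<Sum>i\<in>UNIV. \<Sum>j\<in>UNIV. f i j x)) = (\<Sum>i\<in>UNIV. \<Sum>j\<in>UNIV. (LINT x|M. f i j x))"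
  using assms by (simp add: Bochner_Integration.integral_sum Bochner_Integration.integrable_sum)

lemma affine_std_gaussian_moments:
  fixes m :: "real^'n::finite" and C :: "real^'n^'n"
  defines "N \<equiv> distr std_gaussian borel (\<lambda>z. m + C *v z)"
  shows "(LINT x|N. x $ i) = m $ i"
    and "(LINT x|N. (x $ i - m $ i) * (x $ j - m $ j)) = (C ** transpose C) $ i $ j"
proof -
  interpret prob_space "std_gaussian :: (real^'n) measure" by (rule prob_space_std_gaussian)
  have [simp]: "prob UNIV = 1" using prob_space by simp
  have "(LINT x|N. x $ i) = integral\<^sup>L std_gaussian (\<lambda>z. m $ i + (\<Sum>k\<in>UNIV. C $ i $ k * z $ k))"
    unfolding N_def by (subst integral_distr) (simp_all add: matrix_vector_mult_def)
  also have "\<dots> = m $ i"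
    by (subst Bochner_Integration.integral_add)
      (auto intro!: Bochner_Integration.integrable_sum simp: std_gaussian_mean prob_space)
  finally show "(LINT x|N. x $ i) = m $ i" .
  have "(LINT x|N. (x $ i - m $ i) * (x $ j - m $ j))
      = (LINT z|std_gaussian. (C *v z) $ i * (C *v z) $ j)"
    unfolding N_def by (subst integral_distr) simp_all
  also have "\<dots> = integral\<^sup>L std_gaussian (\<lambda>z. \<Sum>k\<in>UNIV. \<Sum>l\<in>UNIV. C $ i $ k * C $ j $ l * (z $ k * z $ l))"
    by (intro Bochner_Integration.integral_cong refl) (simp add: matrix_vector_mult_def sum_product mult_ac)
  also have "\<dots> = (\<Sum>k\<in>UNIV. \<Sum>l\<in>UNIV. C $ i $ k * C $ j $ l * (if k = l then 1 else 0))"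
    by (subst integral_double_sum) (simp_all add: std_gaussian_cov)
  also have "\<dots> = (C ** transpose C) $ i $ j"
    by (simp add: matrix_matrix_mult_def transpose_def if_distrib cong: if_cong)
  finally show "(LINT x|N. (x $ i - m $ i) * (x $ j - m $ j)) = (C ** transpose C) $ i $ j" .
qed

lemma gaussian_pair_moments:
  fixes a b :: "real^'n::finite"
  assumes K: "pos_semidef K"
  shows "integral\<^sup>L (gaussian_pair a b K) (\<lambda>w. fst w $ i) = a $ i"
    and "integral\<^sup>L (gaussian_pair a b K) (\<lambda>w. snd w $ i) = b $ i"
    and "integral\<^sup>L (gaussian_pair a b K) (\<lambda>w. (fst w $ i - a $ i) * (fst w $ j - a $ j)) = K $ Inl i $ Inl j"
    and "integral\<^sup>L (gaussian_pair a b K) (\<lambda>w. (snd w $ i - b $ i) * (snd w $ j - b $ j)) = K $ Inr i $ Inr j"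
    and "integral\<^sup>L (gaussian_pair a b K) (\<lambda>w. (fst w $ i - a $ i) * (snd w $ j - b $ j)) = K $ Inl i $ Inr j"
proof -
  obtain C :: "real^('n + 'n)^('n + 'n)" where C: "C ** transpose C = K"
    using K by (rule pos_semidef_factor)
  have G: "gaussian_pair a b K = distr (distr std_gaussian borel (\<lambda>z. vec_join a b + C *v z)) (borel \<Otimes>\<^sub>M borel) vec_halves"
    by (simp add: gaussian_pair_eq_join gaussian_eq_distr[OF C])
  note mom = affine_std_gaussian_moments[of "vec_join a b" C, unfolded C]
  have h: "fst (vec_halves z) $ i = z $ Inl i" "snd (vec_halves z) $ i = z $ Inr i" for z :: "real^('n + 'n)" and i
    by (simp_all add: vec_halves_def)
  have I: "integral\<^sup>L (gaussian_pair a b K) f = integral\<^sup>L (distr std_gaussian borel (\<lambda>z. vec_join a b + C *v z)) (\<lambda>z. f (vec_halves z))"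
    if "f \<in> borel_measurable (borel \<Otimes>\<^sub>M borel)" for f :: "_ \<Rightarrow> real"
    unfolding G using that by (intro integral_distr) simp_all
  show "integral\<^sup>L (gaussian_pair a b K) (\<lambda>w. fst w $ i) = a $ i"
    using mom(1)[of "Inl i"] by (subst I) (simp_all add: h)
  show "integral\<^sup>L (gaussian_pair a b K) (\<lambda>w. snd w $ i) = b $ i"
    using mom(1)[of "Inr i"] by (subst I) (simp_all add: h)
  show "integral\<^sup>L (gaussian_pair a b K) (\<lambda>w. (fst w $ i - a $ i) * (fst w $ j - a $ j)) = K $ Inl i $ Inl j"
    using mom(2)[of "Inl i" "Inl j"] by (subst I) (simp_all add: h)
  show "integral\<^sup>L (gaussian_pair a b K) (\<lambda>w. (snd w $ i - b $ i) * (snd w $ j - b $ j)) = K $ Inr i $ Inr j"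
    using mom(2)[of "Inr i" "Inr j"] by (subst I) (simp_all add: h)
  show "integral\<^sup>L (gaussian_pair a b K) (\<lambda>w. (fst w $ i - a $ i) * (snd w $ j - b $ j)) = K $ Inl i $ Inr j"
    using mom(2)[of "Inl i" "Inr j"] by (subst I) (simp_all add: h)
qed

context innovation_pair
begin

definition noise_cov :: "((real^('t \<times> 'd)) \<times> (real^('t \<times> 'd))) measure \<Rightarrow> real^('t \<times> 'd)^('t \<times> 'd)" where
  "noise_cov \<pi> = (\<chi> p q. (LINT w|\<pi>. X.noise (fst w) $ p * Y.noise (snd w) $ q))"

text \<open>
  A Gaussian law is determined by its mean and covariance; the marginals fix everything but
  the cross covariance, which is \<open>G\<close> times the noise covariance times \<open>H\<^sup>T\<close>.
\<close>

lemma gaussian_coupling_eq_pi_P: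
  assumes \<pi>: "\<pi> \<in> Cpl X.law Y.law" and g: "is_gaussian_pair \<pi>"
  shows "\<pi> = pi_P a b G H (noise_cov \<pi>)"
proof -
  note C = Cpl_lawsD[OF \<pi>] and mom = Cpl_moments[OF \<pi>]
  note [measurable_cong] = C(2)
  obtain a' b' K where K: "pos_semidef K" and \<pi>_eq: "\<pi> = gaussian_pair a' b' K"
    using g unfolding is_gaussian_pair_def by blast
  note gm = gaussian_pair_moments[OF K, of a' b', folded \<pi>_eq]
  note X = affine_std_gaussian_moments[of a G, folded X.law_def] and Y = affine_std_gaussian_moments[of b H, folded Y.law_def]
  have F: "(LINT w|\<pi>. f (fst w)) = integral\<^sup>L X.law f" "(LINT w|\<pi>. f (snd w)) = integral\<^sup>L Y.law f"
    if "f \<in> borel_measurable borel" for f :: "_ \<Rightarrow> real"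
    unfolding C(4,5)[symmetric] using that by (simp_all add: integral_distr)
  have "a' $ i = a $ i" "b' $ i = b $ i" for i
    using gm(1,2)[of i] F[of "\<lambda>x. x $ i"] X(1)[of i] Y(1)[of i] by simp_all
  then have ab: "a' = a" "b' = b" by (simp_all add: vec_eq_iff)
  have xx: "K $ Inl i $ Inl j = (G ** transpose G) $ i $ j" for i j
    using gm(3)[of i j] F(1)[of "\<lambda>x. (x $ i - a $ i) * (x $ j - a $ j)"] X(2)[of i j] by (simp add: ab)
  have yy: "K $ Inr i $ Inr j = (H ** transpose H) $ i $ j" for i j
    using gm(4)[of i j] F(2)[of "\<lambda>x. (x $ i - b $ i) * (x $ j - b $ j)"] Y(2)[of i j] by (simp add: ab)
  have xy: "K $ Inl i $ Inr j = (G ** noise_cov \<pi> ** transpose H) $ i $ j" for i j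
  proof -
    have x: "x $ i - a $ i = (G *v X.noise x) $ i" for x
      using arg_cong[OF X.path_noise[of x], of "\<lambda>v. v $ i"] by (simp del: X.path_noise)
    have y: "y $ j - b $ j = (H *v Y.noise y) $ j" for y
      using arg_cong[OF Y.path_noise[of y], of "\<lambda>v. v $ j"] by (simp del: Y.path_noise)
    have "K $ Inl i $ Inr j = (LINT w|\<pi>. (G *v X.noise (fst w)) $ i * (H *v Y.noise (snd w)) $ j)"
      using gm(5)[of i j] by (simp only: ab x y)
    also have "\<dots> = integral\<^sup>L \<pi> (\<lambda>w. \<Sum>p\<in>UNIV. \<Sum>q\<in>UNIV. G $ i $ p * H $ j $ q * (X.noise (fst w) $ p * Y.noise (snd w) $ q))"
      by (intro Bochner_Integration.integral_cong refl) (simp add: matrix_vector_mult_def sum_product mult_ac)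
    also have "\<dots> = (\<Sum>p\<in>UNIV. \<Sum>q\<in>UNIV. G $ i $ p * H $ j $ q * noise_cov \<pi> $ p $ q)"
      by (subst integral_double_sum) (simp_all add: mom noise_cov_def)
    also have "\<dots> = (\<Sum>q\<in>UNIV. \<Sum>p\<in>UNIV. G $ i $ p * H $ j $ q * noise_cov \<pi> $ p $ q)"
      by (rule sum.swap)
    also have "\<dots> = (G ** noise_cov \<pi> ** transpose H) $ i $ j"
      by (simp add: matrix_matrix_mult_def transpose_def sum_distrib_left sum_distrib_right mult_ac)
    finally show ?thesis .
  qed
  have yx: "K $ Inr i $ Inl j = (H ** transpose (noise_cov \<pi>) ** transpose G) $ i $ j" for i j
  proof -
    have "K $ Inr i $ Inl j = transpose (G ** noise_cov \<pi> ** transpose H) $ i $ j"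
      using pos_semidef_sym[OF K, of "Inr i" "Inl j"] xy[of j i] by (simp add: transpose_def)
    then show ?thesis by (simp add: matrix_transpose_mul matrix_mul_assoc)
  qed
  have "K = block_2x2 (G ** transpose G) (G ** noise_cov \<pi> ** transpose H)
      (H ** transpose (noise_cov \<pi>) ** transpose G) (H ** transpose H)"
    by (auto simp: vec_eq_iff block_2x2_def xx yy xy yx split: sum.split)
  then show ?thesis
    using \<pi>_eq by (simp add: pi_P_def ab)
qed

text \<open>
  With \<open>u = D v\<close>, expanding \<open>0 \<le> E (u \<bullet> \<epsilon>\<^sub>t - v \<bullet> \<eta>\<^sub>t)\<^sup>2\<close> gives
  \<open>0 \<le> u \<bullet> u + v \<bullet> v - 2 (u \<bullet> D v) = v \<bullet> v - u \<bullet> u\<close>.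
\<close>

lemma noise_cov_contraction:
  assumes \<pi>: "\<pi> \<in> Cpl X.law Y.law"
  shows "contraction (block (noise_cov \<pi>) t t)"
  unfolding contraction_iff
proof
  fix v :: "real^'d"
  note mom = Cpl_moments[OF \<pi>]
  let ?D = "block (noise_cov \<pi>) t t"
  let ?\<epsilon> = "\<lambda>w i. X.noise (fst w) $ (t, i)" and ?\<eta> = "\<lambda>w i. Y.noise (snd w) $ (t, i)"
  define u where "u = ?D *v v"
  let ?f = "\<lambda>w. (\<Sum>i\<in>UNIV. \<Sum>j\<in>UNIV. u $ i * u $ j * (?\<epsilon> w i * ?\<epsilon> w j))"
  let ?g = "\<lambda>w. (\<Sum>i\<in>UNIV. \<Sum>j\<in>UNIV. v $ i * v $ j * (?\<eta> w i * ?\<eta> w j))"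
  let ?h = "\<lambda>w. (\<Sum>i\<in>UNIV. \<Sum>j\<in>UNIV. u $ i * v $ j * (?\<epsilon> w i * ?\<eta> w j))"
  have sq: "((\<Sum>i\<in>UNIV. u $ i * ?\<epsilon> w i) - (\<Sum>i\<in>UNIV. v $ i * ?\<eta> w i))\<^sup>2 = ?f w + ?g w - 2 * ?h w" for w
  proof -
    have "(\<Sum>i\<in>UNIV. u $ i * ?\<epsilon> w i) * (\<Sum>i\<in>UNIV. u $ i * ?\<epsilon> w i) = ?f w"
      "(\<Sum>i\<in>UNIV. v $ i * ?\<eta> w i) * (\<Sum>i\<in>UNIV. v $ i * ?\<eta> w i) = ?g w"
      "(\<Sum>i\<in>UNIV. u $ i * ?\<epsilon> w i) * (\<Sum>i\<in>UNIV. v $ i * ?\<eta> w i) = ?h w"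
      by (simp_all add: sum_product mult_ac)
    moreover have "(x - y)\<^sup>2 = x * x + y * y - 2 * (x * y)" for x y :: real
      by (simp add: power2_eq_square algebra_simps)
    ultimately show ?thesis by (simp only:)
  qed
  have int: "integrable \<pi> ?f" "integrable \<pi> ?g" "integrable \<pi> ?h"
    by (intro Bochner_Integration.integrable_sum integrable_mult_right mom)+
  have "integral\<^sup>L \<pi> ?f = (\<Sum>i\<in>UNIV. \<Sum>j\<in>UNIV. u $ i * u $ j * (if i = j then 1 else 0))"
    by (subst integral_double_sum) (simp_all add: mom)
  then have f: "integral\<^sup>L \<pi> ?f = u \<bullet> u"
    by (simp add: inner_vec_def if_distrib cong: if_cong)
  have "integral\<^sup>L \<pi> ?g = (\<Sum>i\<in>UNIV. \<Sum>j\<in>UNIV. v $ i * v $ j * (if i = j then 1 else 0))"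
    by (subst integral_double_sum) (simp_all add: mom)
  then have g: "integral\<^sup>L \<pi> ?g = v \<bullet> v"
    by (simp add: inner_vec_def if_distrib cong: if_cong)
  have "integral\<^sup>L \<pi> ?h = (\<Sum>i\<in>UNIV. \<Sum>j\<in>UNIV. u $ i * v $ j * ?D $ i $ j)"
    by (subst integral_double_sum) (simp_all add: mom block_def noise_cov_def)
  also have "\<dots> = u \<bullet> (?D *v v)"
    by (simp add: inner_vec_def matrix_vector_mult_def sum_distrib_left mult_ac)
  finally have h: "integral\<^sup>L \<pi> ?h = u \<bullet> u"
    by (simp only: u_def)
  have "0 \<le> integral\<^sup>L \<pi> (\<lambda>w. ((\<Sum>i\<in>UNIV. u $ i * ?\<epsilon> w i) - (\<Sum>i\<in>UNIV. v $ i * ?\<eta> w i))\<^sup>2)"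
    by (rule integral_nonneg_AE) simp
  also have "\<dots> = integral\<^sup>L \<pi> ?f + integral\<^sup>L \<pi> ?g - 2 * integral\<^sup>L \<pi> ?h"
  proof -
    have "(LINT w|\<pi>. f1 w + f2 w - 2 * f3 w) = integral\<^sup>L \<pi> f1 + integral\<^sup>L \<pi> f2 - 2 * integral\<^sup>L \<pi> f3"
      if "integrable \<pi> f1" "integrable \<pi> f2" "integrable \<pi> f3" for f1 f2 f3 :: "_ \<Rightarrow> real"
      using that by simp
    from this[OF int] show ?thesis unfolding sq .
  qed
  finally have "u \<bullet> u \<le> v \<bullet> v"
    unfolding f g h by simp
  then show "norm (?D *v v) \<le> norm v"
    by (simp add: norm_eq_sqrt_inner u_def)
qed

end

context correlated_innovations
begin

lemma gaussian_optimizer_block_diag: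
  assumes g: "is_gaussian_pair \<pi>" and opt: "is_optimizer 0 X.law Y.law \<pi>"
  obtains D where "\<And>t. contraction (D t)" "\<And>p. s p \<noteq> 0 \<Longrightarrow> D (fst p) $ snd p $ snd p = 1"
    "\<pi> = pi_P a b G H (block_diag D)"
proof -
  have bc: "\<pi> \<in> Cpl_bc X.law Y.law" and one: "\<And>p. s p \<noteq> 0 \<Longrightarrow> corr \<pi> p = 1"
    using opt by (auto simp: optimizer_iff)
  have cpl: "\<pi> \<in> Cpl X.law Y.law" using bc by (rule Cpl_bc_imp_Cpl)
  define D where "D t = block (noise_cov \<pi>) t t" for t
  have "noise_cov \<pi> $ p $ q = block_diag D $ p $ q" for p q
  proof (cases "fst p = fst q")
    case True
    then show ?thesis by (simp add: block_diag_def D_def block_def) (metis prod.collapse)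
  next
    case False
    then show ?thesis by (simp add: block_diag_def noise_cov_def Cpl_bc_uncorrelated[OF bc])
  qed
  then have eq: "noise_cov \<pi> = block_diag D" by (simp add: vec_eq_iff)
  show ?thesis
  proof (rule that[of D])
    show "contraction (D t)" for t
      unfolding D_def by (rule noise_cov_contraction[OF cpl])
    show "D (fst p) $ snd p $ snd p = 1" if "s p \<noteq> 0" for p
      using one[OF that] by (simp add: D_def block_def noise_cov_def corr_def)
    show "\<pi> = pi_P a b G H (block_diag D)"
      using gaussian_coupling_eq_pi_P[OF cpl g] by (simp add: eq)
  qed
qed

lemma pi_P_block_diag_optimizer:
  assumes D: "\<And>t. contraction (D t)" and one: "\<And>p. s p \<noteq> 0 \<Longrightarrow> D (fst p) $ snd p $ snd p = 1"
  shows "is_optimizer 0 X.law Y.law (pi_P a b G H (block_diag D))"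
proof -
  obtain R where R: "same_time R" "R ** transpose R + transpose (block_diag D) ** block_diag D = mat 1"
    by (rule block_contraction_complement[OF D])
  have "pi_P a b G H (block_diag D) = couple (block_diag D) R"
    unfolding pi_P_def by (rule gaussian_pair_eq_couple[OF R(2)])
  moreover have "corr (couple (block_diag D) R) p = D (fst p) $ snd p $ snd p" for p
    by (simp add: corr_def couple_cov block_diag_def)
  ultimately show ?thesis
    using couple_in_Cpl_bc[OF same_time_block_diag R] one by (simp add: optimizer_iff)
qed

text \<open>
  Where the weight vanishes, the correlations 0 and 1 are equally good.
\<close>

lemma not_unique_optimizer:
  assumes "s p\<^sub>0 = 0"
  shows "\<not> is_unique_optimizer 0 X.law Y.law \<pi>"
proof
  assume u: "is_unique_optimizer 0 X.law Y.law \<pi>"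
  let ?c = "\<lambda>p. if p = p\<^sub>0 then 0 else 1"
  have "is_optimizer 0 X.law Y.law (diag_couple (\<lambda>_. 1))" "is_optimizer 0 X.law Y.law (diag_couple ?c)"
    using assms by (auto simp: optimizer_iff diag_couple_corr intro!: diag_couple_bc)
  then have "diag_couple (\<lambda>_. 1) = diag_couple ?c"
    using u by (metis is_unique_optimizer_def)
  then have "corr (diag_couple (\<lambda>_. 1)) p\<^sub>0 = corr (diag_couple ?c) p\<^sub>0" by simp
  then show False by (simp add: diag_couple_corr)
qed

lemma pi_P_diag_matrix:
  assumes c: "\<And>p. \<bar>c p\<bar> \<le> 1"
  shows "pi_P a b G H (diag_matrix c) = diag_couple c"
  unfolding pi_P_def diag_couple_def
  by (rule gaussian_pair_eq_couple[OF diag_matrix_complement[OF c]])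

end

section \<open>Adapted transport between Gaussian laws\<close>

text \<open>
  A block lower triangular matrix maps the vectors vanishing up to a given time into
  themselves.  An injective map of a finite dimensional space into itself is onto, so the inverse
  preserves these subspaces as well, and they characterize triangularity.
\<close>

lemma block_lower_inverse:
  fixes K K' :: "real^('t::{finite,linorder} \<times> 'd::finite)^('t \<times> 'd)"
  assumes K: "block_lower K" and KK': "K ** K' = mat 1" and K'K: "K' ** K = mat 1"
  shows "block_lower K'"
  unfolding block_lower_def
proof (intro allI impI)
  fix p q :: "'t \<times> 'd" assume pq: "fst p < fst q"
  \<comment> \<open>the vectors that vanish up to the time of \<open>p\<close>; column \<open>q\<close> of the identity is one of them\<close>
  define E where "E = {v :: real^('t \<times> 'd). \<forall>r. fst r \<le> fst p \<longrightarrow> v $ r = 0}"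
  have E: "subspace E" by (auto simp: E_def subspace_def)
  have KE: "(*v) K ` E \<subseteq> E"
  proof
    fix w assume "w \<in> (*v) K ` E"
    then obtain v where v: "v \<in> E" and w: "w = K *v v" by auto
    have "K $ r $ k * v $ k = 0" if "fst r \<le> fst p" for r k
    proof (cases "fst k \<le> fst p")
      case True
      then have "v $ k = 0" using v unfolding E_def by blast
      then show ?thesis by simp
    next
      case False
      then have "fst r < fst k" using that by simp
      then have "K $ r $ k = 0" using K unfolding block_lower_def by blast
      then show ?thesis by simp
    qed
    then show "w \<in> E"
      unfolding E_def w matrix_vector_mult_def by (auto simp del: split_paired_All intro!: sum.neutral)
  qed
  have inv: "K' *v (K *v x) = x" "K *v (K' *v x) = x" for x
    by (simp_all add: matrix_vector_mul_assoc KK' K'K)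
  have "inj ((*v) K)" by (rule injI) (metis inv(1))
  then have "dim ((*v) K ` E) = dim E"
    by (intro dim_image_eq) (auto intro: inj_on_subset)
  then have KE': "(*v) K ` E = E"
    using KE E by (intro subspace_dim_equal) (auto intro: linear_subspace_image)
  have "axis q 1 \<in> E"
    using pq by (auto simp: E_def axis_def)
  with KE' obtain e where e: "e \<in> E" "axis q 1 = K *v e" by auto
  then have "column q K' = e" by (simp add: inv matrix_vector_mult_basis[symmetric])
  then have "K' $ p $ q = e $ p" by (auto simp: column_def)
  moreover have "e $ p = 0" using e(1) unfolding E_def by blast
  ultimately show "K' $ p $ q = 0" by simp
qed

lemma innovation_of_factor:
  fixes A L :: "real^('t::{finite,linorder} \<times> 'd::{finite,linorder})^('t \<times> 'd)" and V :: "'t \<Rightarrow> real^'d::{finite,linorder}^'d::{finite,linorder}"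
  assumes A: "pos_def A" and L: "cholesky A L" and V: "\<And>t. orthogonal_matrix (V t)"
  obtains G' where "innovation (L ** block_diag V) G'"
    and "(L ** block_diag V) ** transpose (L ** block_diag V) = A"
proof -
  have AL: "A = L ** transpose L" and tri: "lower_triangular L"
    using L by (auto simp: cholesky_def)
  let ?G = "L ** block_diag V"
  have GG: "?G ** transpose ?G = A"
    by (simp add: matrix_transpose_mul AL matrix_mul_assoc[symmetric])
      (simp add: matrix_mul_assoc[of "block_diag V"] orthogonal_block_diag[OF V])
  have "x = 0" if x: "transpose ?G *v x = 0" for x
  proof -
    have "A *v x = ?G *v (transpose ?G *v x)" by (simp add: matrix_vector_mul_assoc GG)
    then have "x \<bullet> (A *v x) = 0" by (simp add: x)
    then show ?thesis using A unfolding pos_def_def by fastforce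
  qed
  then obtain B where "B ** transpose ?G = mat 1"
    using matrix_left_invertible_ker[of "transpose ?G"] by blast
  then have "transpose (B ** transpose ?G) = mat 1" by simp
  then have GB: "?G ** transpose B = mat 1" by (simp add: matrix_transpose_mul)
  then have BG: "transpose B ** ?G = mat 1" by (simp add: matrix_left_right_inverse)
  have "block_lower L"
    using tri by (auto simp: block_lower_def lower_triangular_def)
  then have lowG: "block_lower ?G"
    by (simp add: block_lower_def block_diag_mult_right)
  have "innovation ?G (transpose B)"
    using GB BG lowG block_lower_inverse[OF lowG GB BG] by unfold_locales
  then show ?thesis using GG by (rule that)
qed

text \<open>
  For \<open>s > 0\<close> and \<open>u = lam / (4 s)\<close>, the number \<open>f_lam lam s\<close> is the positive root of
  \<open>c\<^sup>2 + 2 u c = 1\<close>, which is the critical equation divided by \<open>2 s\<close>.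
\<close>

lemma f_lam_properties:
  assumes lam: "0 < lam" and s: "0 \<le> s"
  shows "\<bar>f_lam lam s\<bar> < 1" and "lam * f_lam lam s = 2 * s * (1 - (f_lam lam s)\<^sup>2)"
proof -
  have "\<bar>f_lam lam s\<bar> < 1 \<and> lam * f_lam lam s = 2 * s * (1 - (f_lam lam s)\<^sup>2)"
  proof (cases "s = 0")
    case False
    with s have s: "0 < s" by simp
    define u where "u = lam / (4 * s)"
    define c where "c = sqrt (u\<^sup>2 + 1) - u"
    have u: "0 < u" using lam s by (simp add: u_def)
    have f: "f_lam lam s = c" using s by (simp add: f_lam_def c_def u_def)
    have "(c + u)\<^sup>2 = u\<^sup>2 + 1" by (simp add: c_def)
    then have q: "1 - c\<^sup>2 = 2 * u * c" by (simp add: power2_eq_square algebra_simps)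
    have "u < sqrt (u\<^sup>2 + 1)" using u by (intro real_less_rsqrt) simp
    moreover have "sqrt (u\<^sup>2 + 1) < 1 + u" using u by (intro real_less_lsqrt) (simp_all add: power2_eq_square algebra_simps)
    ultimately have "\<bar>c\<bar> < 1" by (simp add: c_def)
    moreover have "lam * c = 2 * s * (1 - c\<^sup>2)"
      using s by (simp add: q) (simp add: u_def)
    ultimately show ?thesis by (simp add: f)
  qed (simp add: f_lam_def)
  then show "\<bar>f_lam lam s\<bar> < 1" and "lam * f_lam lam s = 2 * s * (1 - (f_lam lam s)\<^sup>2)" by auto
qed

theorem theorem2p5:
  fixes a b :: "real^('t::{finite,linorder} \<times> 'd::{finite,linorder})"
    and A B L M :: "real^('t \<times> 'd)^('t \<times> 'd)"
    and U S V :: "'t \<Rightarrow> real^'d::{finite,linorder}^'d::{finite,linorder}"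
    and \<mu> \<nu> :: "(real^('t \<times> 'd)) measure"
    and lam :: real
  assumes "\<mu> = gaussian a A" and "pos_def A" and "cholesky A L"
    and "\<nu> = gaussian b B" and "pos_def B" and "cholesky B M"
    and "0 \<le> lam"
    and "\<And>t. is_svd (block (transpose M ** L) t t) (U t) (S t) (V t)"
  shows
    "(0 < lam \<longrightarrow>
        is_unique_optimizer lam \<mu> \<nu>
          (pi_P a b L M (block_diag (\<lambda>t.
             V t ** block (map_matrix (f_lam lam) (block_diag S)) t t ** transpose (U t)))))
     \<and>
     (lam = 0 \<longrightarrow>
        (\<forall>D. (\<forall>t. unit_contraction (S t) (D t)) \<longrightarrow>
           is_optimizer 0 \<mu> \<nu> (pi_P a b L M (block_diag (\<lambda>t. V t ** D t ** transpose (U t))))) \<and>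
        (\<forall>\<pi>. is_gaussian_pair \<pi> \<and> is_optimizer 0 \<mu> \<nu> \<pi> \<longrightarrow>
           (\<exists>D. (\<forall>t. unit_contraction (S t) (D t)) \<and>
                \<pi> = pi_P a b L M (block_diag (\<lambda>t. V t ** D t ** transpose (U t))))) \<and>
        (\<forall>D. (\<forall>t. unit_contraction (S t) (D t)) \<longrightarrow>
           (is_unique_optimizer 0 \<mu> \<nu>
              (pi_P a b L M (block_diag (\<lambda>t. V t ** D t ** transpose (U t))))
            \<longleftrightarrow> invertible (block_diag S))))"
proof -
  note svd = assms(8)
  have UV: "\<And>t. orthogonal_matrix (U t)" "\<And>t. orthogonal_matrix (V t)"
    and S_off: "\<And>t i j. i \<noteq> j \<Longrightarrow> S t $ i $ j = 0" and S_nonneg: "\<And>t i. 0 \<le> S t $ i $ i"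
    and S_eq: "\<And>t. block (transpose M ** L) t t = U t ** S t ** transpose (V t)"
    using svd by (auto simp: is_svd_def)
  define G H where "G = L ** block_diag V" and "H = M ** block_diag U"
  obtain G' where G': "innovation G G'" and GG: "G ** transpose G = A"
    unfolding G_def by (rule innovation_of_factor[OF assms(2,3) UV(2)])
  obtain H' where H': "innovation H H'" and HH: "H ** transpose H = B"
    unfolding H_def by (rule innovation_of_factor[OF assms(5,6) UV(1)])
  define s where "s p = S (fst p) $ snd p $ snd p" for p
  have cross: "(transpose H ** G) $ q $ p = (if p = q then s p else 0)" if same: "fst p = fst q" for p q
  proof -
    obtain t i j where pq: "p = (t, i)" "q = (t, j)"
      using same by (metis prod.collapse)
    have "transpose H ** G = block_diag (\<lambda>t. transpose (U t)) ** (transpose M ** L) ** block_diag V"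
      by (simp add: G_def H_def matrix_transpose_mul transpose_block_diag matrix_mul_assoc)
    then have "block (transpose H ** G) t t = transpose (U t) ** (U t ** S t ** transpose (V t)) ** V t"
      by (simp add: block_of_block_diag_mult S_eq)
    also have "\<dots> = (transpose (U t) ** U t) ** S t ** (transpose (V t) ** V t)"
      by (simp add: matrix_mul_assoc)
    also have "\<dots> = S t"
      using UV by (simp add: orthogonal_matrix_def)
    finally have "(transpose H ** G) $ (t, j) $ (t, i) = S t $ j $ i"
      by (simp add: block_def vec_eq_iff)
    then show ?thesis
      using S_off[of j i t] by (auto simp: pq s_def)
  qed
  interpret X: innovation a G G' by fact
  interpret Y: innovation b H H' by fact
  interpret correlated_innovations a b G G' H H' s
    by unfold_locales (simp_all add: cross, simp add: s_def S_nonneg)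
  have \<mu>: "\<mu> = X.law" and \<nu>: "\<nu> = Y.law"
    by (simp_all add: assms(1,4) X.law_def Y.law_def gaussian_eq_distr[OF GG] gaussian_eq_distr[OF HH])
  have pi_P_eq: "pi_P a b L M (block_diag (\<lambda>t. V t ** D t ** transpose (U t))) = pi_P a b G H (block_diag D)" for D
  proof -
    have P: "block_diag (\<lambda>t. V t ** D t ** transpose (U t)) = block_diag V ** block_diag D ** transpose (block_diag U)"
      by (simp add: transpose_block_diag block_diag_mult)
    have "L ** transpose L = G ** transpose G" "M ** transpose M = H ** transpose H"
      using assms(3,6) by (simp_all add: GG HH cholesky_def)
    moreover have "L ** block_diag (\<lambda>t. V t ** D t ** transpose (U t)) ** transpose M = G ** block_diag D ** transpose H"
      by (simp add: P G_def H_def matrix_transpose_mul matrix_mul_assoc)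
    moreover have "M ** transpose (block_diag (\<lambda>t. V t ** D t ** transpose (U t))) ** transpose L = H ** transpose (block_diag D) ** transpose G"
      by (simp add: P G_def H_def matrix_transpose_mul matrix_mul_assoc)
    ultimately show ?thesis by (simp add: pi_P_def)
  qed
  have uc: "(\<forall>t. unit_contraction (S t) (D t)) \<longleftrightarrow> (\<forall>t. contraction (D t)) \<and> (\<forall>p. s p \<noteq> 0 \<longrightarrow> D (fst p) $ snd p $ snd p = 1)" for D
    by (auto simp: unit_contraction_def s_def)
  have diagS: "block_diag S = diag_matrix s"
    using S_off by (auto simp: vec_eq_iff block_diag_def diag_matrix_def s_def)
  have "invertible (block_diag S) \<longleftrightarrow> (\<forall>p. s p \<noteq> 0)"
  proof -
    have "det (diag_matrix s) = (\<Prod>p\<in>UNIV. s p)"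
      by (subst det_diagonal) (simp_all add: diag_matrix_def)
    then show ?thesis by (simp add: diagS invertible_det_nz)
  qed
  moreover have "is_unique_optimizer lam \<mu> \<nu>
          (pi_P a b L M (block_diag (\<lambda>t. V t ** block (map_matrix (f_lam lam) (block_diag S)) t t ** transpose (U t))))"
    if "0 < lam"
  proof -
    let ?c = "\<lambda>p. f_lam lam (s p)"
    note c = f_lam_properties[OF that s_nonneg]
    have "block_diag (\<lambda>t. block (map_matrix (f_lam lam) (block_diag S)) t t) = diag_matrix ?c"
      unfolding diagS by (auto simp: vec_eq_iff block_diag_def block_def diag_matrix_def f_lam_def)
    then have "pi_P a b L M (block_diag (\<lambda>t. V t ** block (map_matrix (f_lam lam) (block_diag S)) t t ** transpose (U t)))
      = diag_couple ?c"
      using pi_P_diag_matrix[of ?c] c(1) by (simp add: pi_P_eq less_imp_le)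
    then show ?thesis
      using entropic_unique_optimizer[OF that, of ?c] c by (simp add: \<mu> \<nu>)
  qed
  moreover have "is_optimizer 0 \<mu> \<nu> (pi_P a b L M (block_diag (\<lambda>t. V t ** D t ** transpose (U t))))"
    if "\<forall>t. unit_contraction (S t) (D t)" for D
    using that pi_P_block_diag_optimizer[of D] by (simp only: pi_P_eq uc \<mu> \<nu>) blast
  moreover have "\<exists>D. (\<forall>t. unit_contraction (S t) (D t)) \<and> \<pi> = pi_P a b L M (block_diag (\<lambda>t. V t ** D t ** transpose (U t)))"
    if "is_gaussian_pair \<pi>" "is_optimizer 0 \<mu> \<nu> \<pi>" for \<pi>
    using that gaussian_optimizer_block_diag[of \<pi>] unfolding pi_P_eq uc \<mu> \<nu> by metis
  ultimately show ?thesis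
    using unique_optimizer not_unique_optimizer unfolding \<mu> \<nu> by blast
qed

end
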